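(* Let $R$ be a commutative Noetherian ring with identity, let $\mathfrak{a}$ be an ideal of $R$ and let $M,N$ be two finitely generated $R$-modules such that the projective dimension $\operatorname{pd} N$ of $N$ is finite. Then $f_{\mathfrak{a}}(M,N)\geq f_{\mathfrak{a}}(M,R)-\operatorname{pd} N$.
   Context: All modules are unitary. For $R$-modules $M,N$ and $i\ge 0$, the $i$-th generalized local cohomology module with respect to $\mathfrak{a}$ is $H^i_{\mathfrak{a}}(M,N):=\varinjlim_n \operatorname{Ext}^i_R(M/\mathfrak{a}^nM,N)$. For finitely generated $M,N$, $f_{\mathfrak{a}}(M,N):=\inf\{i\ge 0: H^i_{\mathfrak{a}}(M,N)\text{ is not finitely generated}\}$, where the infimum of the empty set is $+\infty$. *)

theory Defs
  imports "HOL-Library.Extended_Real" "HOL-Library.FSet" "HOL-Algebra.Module" "HOL-Algebra.AbelCoset"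
    "HOL-Algebra.Ring_Divisibility" "HOL-Algebra.Ideal_Product"
begin

text \<open>Modules are the records of HOL-Algebra. These inherit from the ring records the fields
  \<open>mult\<close> and \<open>one\<close>, which play no role in the locale \<open>module\<close>; they are left
  unspecified below.\<close>

section \<open>Modules\<close>

definition module_span :: "('a, 'r) ring_scheme \<Rightarrow> ('a, 'm, 'k) module_scheme \<Rightarrow> 'm set \<Rightarrow> 'm set"
  where "module_span R M A = \<Inter> {H. submodule H R M \<and> A \<subseteq> H}"

definition fin_gen_module :: "('a, 'r) ring_scheme \<Rightarrow> ('a, 'm, 'k) module_scheme \<Rightarrow> bool"
  where "fin_gen_module R M \<longleftrightarrow> (\<exists>A \<subseteq> carrier M. finite A \<and> module_span R M A = carrier M)"

definition ring_module :: "('a, 'r) ring_scheme \<Rightarrow> ('a, 'a) module"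
  where "ring_module R = \<lparr>carrier = carrier R, monoid.mult = monoid.mult R, one = one R,
    zero = zero R, add = add R, smult = monoid.mult R\<rparr>"

definition ideal_smult :: "('a, 'r) ring_scheme \<Rightarrow> ('a, 'm, 'k) module_scheme \<Rightarrow> 'a set \<Rightarrow> 'm set"
  where "ideal_smult R M I = module_span R M {r \<odot>\<^bsub>M\<^esub> x | r x. r \<in> I \<and> x \<in> carrier M}"

definition quot_module :: "('a, 'm, 'k) module_scheme \<Rightarrow> 'm set \<Rightarrow> ('a, 'm set) module"
  where "quot_module M H = \<lparr>carrier = a_rcosets\<^bsub>M\<^esub> H, monoid.mult = undefined, one = undefined,
    zero = H, add = set_add M, smult = (\<lambda>r X. \<Union>x\<in>X. H +>\<^bsub>M\<^esub> (r \<odot>\<^bsub>M\<^esub> x))\<rparr>"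

definition module_homs ::
    "('a, 'r) ring_scheme \<Rightarrow> ('a, 'm, 'k) module_scheme \<Rightarrow> ('a, 'n, 'l) module_scheme \<Rightarrow> ('m \<Rightarrow> 'n) set"
  where "module_homs R M N = {f \<in> carrier M \<rightarrow> carrier N.
    (\<forall>x\<in>carrier M. \<forall>y\<in>carrier M. f (x \<oplus>\<^bsub>M\<^esub> y) = f x \<oplus>\<^bsub>N\<^esub> f y) \<and>
    (\<forall>r\<in>carrier R. \<forall>x\<in>carrier M. f (r \<odot>\<^bsub>M\<^esub> x) = r \<odot>\<^bsub>N\<^esub> f x)}"

definition hom_module ::
    "('a, 'r) ring_scheme \<Rightarrow> ('a, 'm, 'k) module_scheme \<Rightarrow> ('a, 'n, 'l) module_scheme \<Rightarrow>
      ('a, 'm \<Rightarrow> 'n) module"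
  where "hom_module R M N = \<lparr>carrier = module_homs R M N \<inter> extensional (carrier M),
    monoid.mult = undefined, one = undefined, zero = (\<lambda>x\<in>carrier M. \<zero>\<^bsub>N\<^esub>),
    add = (\<lambda>f g. \<lambda>x\<in>carrier M. f x \<oplus>\<^bsub>N\<^esub> g x),
    smult = (\<lambda>r f. \<lambda>x\<in>carrier M. r \<odot>\<^bsub>N\<^esub> f x)\<rparr>"


section \<open>Free modules\<close>

definition supp :: "('a, 'r) ring_scheme \<Rightarrow> ('b \<Rightarrow> 'a) \<Rightarrow> 'b set"
  where "supp R f = {b. f b \<noteq> \<zero>\<^bsub>R\<^esub>}"

definition free_module :: "('a, 'r) ring_scheme \<Rightarrow> 'b set \<Rightarrow> ('a, 'b \<Rightarrow> 'a) module"
  where "free_module R B =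
    \<lparr>carrier = {f. range f \<subseteq> carrier R \<and> finite (supp R f) \<and> supp R f \<subseteq> B},
    monoid.mult = undefined, one = undefined, zero = (\<lambda>b. \<zero>\<^bsub>R\<^esub>),
    add = (\<lambda>f g b. f b \<oplus>\<^bsub>R\<^esub> g b), smult = (\<lambda>r f b. r \<otimes>\<^bsub>R\<^esub> f b)\<rparr>"

definition basis_vec :: "('a, 'r) ring_scheme \<Rightarrow> 'b \<Rightarrow> 'b \<Rightarrow> 'a"
  where "basis_vec R b = (\<lambda>c. if c = b then \<one>\<^bsub>R\<^esub> else \<zero>\<^bsub>R\<^esub>)"

text \<open>The linear extension to a free module of a map \<open>v\<close> from its basis to \<open>M\<close>.\<close>

definition lin_ext ::
    "('a, 'r) ring_scheme \<Rightarrow> ('a, 'm, 'k) module_scheme \<Rightarrow> ('b \<Rightarrow> 'm) \<Rightarrow> ('b \<Rightarrow> 'a) \<Rightarrow> 'm"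
  where "lin_ext R M v f = (\<Oplus>\<^bsub>M\<^esub>b\<in>supp R f. f b \<odot>\<^bsub>M\<^esub> v b)"

definition free_map :: "('a, 'r) ring_scheme \<Rightarrow> ('b \<Rightarrow> 'c) \<Rightarrow> ('b \<Rightarrow> 'a) \<Rightarrow> ('c \<Rightarrow> 'a)"
  where "free_map R \<phi> = lin_ext R (free_module R UNIV) (\<lambda>b. basis_vec R (\<phi> b))"


section \<open>The standard free resolution\<close>

text \<open>The standard free resolution \<open>\<dots> \<rightarrow> F\<^sub>1 \<rightarrow> F\<^sub>0 \<rightarrow> M \<rightarrow> 0\<close> of a module: \<open>F\<^sub>0\<close> is free on the
  set of elements of \<open>M\<close>, and \<open>F\<^bsub>k+1\<^esub>\<close> is free on the set of elements of the kernel of the map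
  going out of \<open>F\<^sub>k\<close>; every basis element is sent to the element that it stands for. It is
  functorial in \<open>M\<close>.

  The bases of all the \<open>F\<^sub>k\<close> live in one type: \<open>Gen m\<close> is the basis element of \<open>F\<^sub>0\<close> that
  stands for \<open>m\<close>, and \<open>Syz G\<close> the basis element of \<open>F\<^bsub>k+1\<^esub>\<close> that stands for the finitely
  supported function with graph \<open>G\<close> (over its support).\<close>

datatype ('a, 'm) cell = Gen (ungen: 'm) | Syz "(('a, 'm) cell \<times> 'a) fset"

definition syz :: "('a, 'r) ring_scheme \<Rightarrow> (('a, 'm) cell \<Rightarrow> 'a) \<Rightarrow> ('a, 'm) cell"
  where "syz R f = Syz (Abs_fset ((\<lambda>b. (b, f b)) ` supp R f))"

definition unsyz :: "('a, 'r) ring_scheme \<Rightarrow> ('a, 'm) cell \<Rightarrow> (('a, 'm) cell \<Rightarrow> 'a)"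
  where "unsyz R = inv_into {f. finite (supp R f)} (syz R)"

definition augm ::
    "('a, 'r) ring_scheme \<Rightarrow> ('a, 'm, 'k) module_scheme \<Rightarrow> (('a, 'm) cell \<Rightarrow> 'a) \<Rightarrow> 'm"
  where "augm R M = lin_ext R M ungen"

definition bdry ::
    "('a, 'r) ring_scheme \<Rightarrow> (('a, 'm) cell \<Rightarrow> 'a) \<Rightarrow> (('a, 'm) cell \<Rightarrow> 'a)"
  where "bdry R = lin_ext R (free_module R UNIV) (unsyz R)"

primrec std_basis ::
    "('a, 'r) ring_scheme \<Rightarrow> ('a, 'm, 'k) module_scheme \<Rightarrow> nat \<Rightarrow> ('a, 'm) cell set"
  where
    "std_basis R M 0 = Gen ` carrier M"
  | "std_basis R M (Suc k) = syz R ` {f \<in> carrier (free_module R (std_basis R M k)).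
      if k = 0 then augm R M f = \<zero>\<^bsub>M\<^esub> else bdry R f = (\<lambda>b. \<zero>\<^bsub>R\<^esub>)}"

definition std_res ::
    "('a, 'r) ring_scheme \<Rightarrow> ('a, 'm, 'k) module_scheme \<Rightarrow> nat \<Rightarrow> ('a, ('a, 'm) cell \<Rightarrow> 'a) module"
  where "std_res R M k = free_module R (std_basis R M k)"

text \<open>The chain map between the standard resolutions that lifts a homomorphism \<open>h\<close>.\<close>

primrec cell_map ::
    "('a, 'r) ring_scheme \<Rightarrow> ('m \<Rightarrow> 'n) \<Rightarrow> nat \<Rightarrow> ('a, 'm) cell \<Rightarrow> ('a, 'n) cell"
  where
    "cell_map R h 0 = (\<lambda>b. Gen (h (ungen b)))"
  | "cell_map R h (Suc k) = (\<lambda>b. syz R (free_map R (cell_map R h k) (unsyz R b)))"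

definition std_map ::
    "('a, 'r) ring_scheme \<Rightarrow> ('m \<Rightarrow> 'n) \<Rightarrow> nat \<Rightarrow>
      (('a, 'm) cell \<Rightarrow> 'a) \<Rightarrow> (('a, 'n) cell \<Rightarrow> 'a)"
  where "std_map R h k = free_map R (cell_map R h k)"


section \<open>Ext\<close>

text \<open>\<open>Ext R i M N\<close> is the \<open>i\<close>-th cohomology module of the complex of homomorphisms from the
  standard free resolution of \<open>M\<close> to \<open>N\<close>.\<close>

definition ext_cocycles ::
    "('a, 'r) ring_scheme \<Rightarrow> nat \<Rightarrow> ('a, 'm, 'k) module_scheme \<Rightarrow> ('a, 'n, 'l) module_scheme \<Rightarrow>
      ((('a, 'm) cell \<Rightarrow> 'a) \<Rightarrow> 'n) set"
  where "ext_cocycles R i M N = {f \<in> carrier (hom_module R (std_res R M i) N).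
    \<forall>x\<in>carrier (std_res R M (Suc i)). f (bdry R x) = \<zero>\<^bsub>N\<^esub>}"

definition ext_coboundaries ::
    "('a, 'r) ring_scheme \<Rightarrow> nat \<Rightarrow> ('a, 'm, 'k) module_scheme \<Rightarrow> ('a, 'n, 'l) module_scheme \<Rightarrow>
      ((('a, 'm) cell \<Rightarrow> 'a) \<Rightarrow> 'n) set"
  where "ext_coboundaries R i M N = (case i of
      0 \<Rightarrow> {\<zero>\<^bsub>hom_module R (std_res R M 0) N\<^esub>}
    | Suc j \<Rightarrow> (\<lambda>g. \<lambda>x\<in>carrier (std_res R M i). g (bdry R x)) `
        carrier (hom_module R (std_res R M j) N))"

definition Ext ::
    "('a, 'r) ring_scheme \<Rightarrow> nat \<Rightarrow> ('a, 'm, 'k) module_scheme \<Rightarrow> ('a, 'n, 'l) module_scheme \<Rightarrow>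
      ('a, ((('a, 'm) cell \<Rightarrow> 'a) \<Rightarrow> 'n) set) module"
  where "Ext R i M N =
    quot_module (hom_module R (std_res R M i) N \<lparr>carrier := ext_cocycles R i M N\<rparr>)
      (ext_coboundaries R i M N)"

text \<open>The map from \<open>Ext R i M' N\<close> to \<open>Ext R i M N\<close> induced by a homomorphism \<open>h\<close> from \<open>M\<close>
  to \<open>M'\<close>; it does not mention \<open>M'\<close>.\<close>

definition Ext_map ::
    "('a, 'r) ring_scheme \<Rightarrow> nat \<Rightarrow> ('a, 'm, 'k) module_scheme \<Rightarrow> ('a, 'n, 'l) module_scheme \<Rightarrow>
      ('m \<Rightarrow> 'm2) \<Rightarrow> ((('a, 'm2) cell \<Rightarrow> 'a) \<Rightarrow> 'n) set \<Rightarrow> ((('a, 'm) cell \<Rightarrow> 'a) \<Rightarrow> 'n) set"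
  where "Ext_map R i M N h X = (\<Union>f\<in>X.
    ext_coboundaries R i M N +>\<^bsub>hom_module R (std_res R M i) N\<^esub>
      (\<lambda>x\<in>carrier (std_res R M i). f (std_map R h i x)))"


section \<open>Direct limits of sequences of modules\<close>

text \<open>\<open>t n m\<close>, for \<open>n \<le> m\<close>, is the transition map from \<open>G n\<close> to \<open>G m\<close>. The elements of the
  limit are the classes of pairs \<open>(n, x)\<close> with \<open>x\<close> in \<open>G n\<close>.\<close>

definition lim_class ::
    "(nat \<Rightarrow> ('a, 'e, 'k) module_scheme) \<Rightarrow> (nat \<Rightarrow> nat \<Rightarrow> 'e \<Rightarrow> 'e) \<Rightarrow> nat \<Rightarrow> 'e \<Rightarrow> (nat \<times> 'e) set"
  where "lim_class G t n x =
    {(m, y). y \<in> carrier (G m) \<and> (\<exists>k. n \<le> k \<and> m \<le> k \<and> t n k x = t m k y)}"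

definition direct_lim ::
    "(nat \<Rightarrow> ('a, 'e, 'k) module_scheme) \<Rightarrow> (nat \<Rightarrow> nat \<Rightarrow> 'e \<Rightarrow> 'e) \<Rightarrow> ('a, (nat \<times> 'e) set) module"
  where "direct_lim G t = \<lparr>carrier = (\<Union>n. lim_class G t n ` carrier (G n)),
    monoid.mult = undefined, one = undefined, zero = lim_class G t 0 \<zero>\<^bsub>G 0\<^esub>,
    add = (\<lambda>X Y. \<Union>(n, x)\<in>X. \<Union>(m, y)\<in>Y.
      lim_class G t (max n m) (t n (max n m) x \<oplus>\<^bsub>G (max n m)\<^esub> t m (max n m) y)),
    smult = (\<lambda>r X. \<Union>(n, x)\<in>X. lim_class G t n (r \<odot>\<^bsub>G n\<^esub> x))\<rparr>"


section \<open>Generalized local cohomology\<close>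

definition adic_sub :: "('a, 'r) ring_scheme \<Rightarrow> 'a set \<Rightarrow> ('a, 'm, 'k) module_scheme \<Rightarrow> nat \<Rightarrow> 'm set"
  where "adic_sub R I M n = ideal_smult R M (I [^]\<^bsub>ideals_set R\<^esub> n)"

text \<open>The canonical surjection from \<open>M/I\<^sup>mM\<close> onto \<open>M/I\<^sup>nM\<close>, for \<open>n \<le> m\<close>, sends a coset \<open>X\<close> to
  \<open>X + I\<^sup>nM\<close>.\<close>

definition gen_local_cohomology ::
    "('a, 'r) ring_scheme \<Rightarrow> 'a set \<Rightarrow> nat \<Rightarrow> ('a, 'm, 'k) module_scheme \<Rightarrow> ('a, 'n, 'l) module_scheme \<Rightarrow>
      ('a, (nat \<times> ((('a, 'm set) cell \<Rightarrow> 'a) \<Rightarrow> 'n) set) set) module"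
  where "gen_local_cohomology R I i M N =
    direct_lim (\<lambda>n. Ext R i (quot_module M (adic_sub R I M n)) N)
      (\<lambda>n m. Ext_map R i (quot_module M (adic_sub R I M m)) N
        (\<lambda>X. X <+>\<^bsub>M\<^esub> adic_sub R I M n))"

definition finiteness_dim ::
    "('a, 'r) ring_scheme \<Rightarrow> 'a set \<Rightarrow> ('a, 'm, 'k) module_scheme \<Rightarrow> ('a, 'n, 'l) module_scheme \<Rightarrow> enat"
  where "finiteness_dim R I M N =
    Inf {enat i | i. \<not> fin_gen_module R (gen_local_cohomology R I i M N)}"


section \<open>Projective dimension\<close>

text \<open>The lifting property against surjections \<open>A \<rightarrow> B\<close> has to fix the types of the elements of
  \<open>A\<close> and \<open>B\<close>. The types chosen lose nothing: they admit the surjection from the free module on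
  the elements of \<open>P\<close> onto \<open>P\<close>, and if this splits then \<open>P\<close> is a direct summand of a free
  module.\<close>

definition projective_module :: "('a, 'r) ring_scheme \<Rightarrow> ('a, 'p) module \<Rightarrow> bool"
  where "projective_module R P \<longleftrightarrow> Module.module R P \<and>
    (\<forall>(A :: ('a, 'p \<Rightarrow> 'a) module) (B :: ('a, 'p) module). \<forall>p g.
      Module.module R A \<and> Module.module R B \<and>
      p \<in> module_homs R A B \<and> p ` carrier A = carrier B \<and> g \<in> module_homs R P B \<longrightarrow>
      (\<exists>h\<in>module_homs R P A. \<forall>x\<in>carrier P. p (h x) = g x))"

text \<open>A projective resolution
  \<open>0 \<rightarrow> P\<^sub>n \<rightarrow> \<dots> \<rightarrow> P\<^sub>0 \<rightarrow> N \<rightarrow> 0\<close> of length \<open>n\<close>, continued by zero modules.\<close>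

definition projective_resolution ::
    "('a, 'r) ring_scheme \<Rightarrow> ('a, 'n, 'l) module_scheme \<Rightarrow> nat \<Rightarrow>
      (nat \<Rightarrow> ('a, 'p) module) \<Rightarrow> (nat \<Rightarrow> 'p \<Rightarrow> 'p) \<Rightarrow> ('p \<Rightarrow> 'n) \<Rightarrow> bool"
  where "projective_resolution R N n P d e \<longleftrightarrow>
    (\<forall>k. projective_module R (P k)) \<and>
    (\<forall>k>n. carrier (P k) = {\<zero>\<^bsub>P k\<^esub>}) \<and>
    (\<forall>k. d k \<in> module_homs R (P (Suc k)) (P k)) \<and>
    e \<in> module_homs R (P 0) N \<and>
    e ` carrier (P 0) = carrier N \<and>
    {x \<in> carrier (P 0). e x = \<zero>\<^bsub>N\<^esub>} = d 0 ` carrier (P 1) \<and>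
    (\<forall>k. {x \<in> carrier (P (Suc k)). d k x = \<zero>\<^bsub>P k\<^esub>} = d (Suc k) ` carrier (P (Suc (Suc k))))"

text \<open>The resolutions range over modules with elements in the type of the standard resolution.
  This loses nothing: if \<open>N\<close> has a projective resolution of length \<open>n\<close>, then by Schanuel's lemma
  the truncation of the standard resolution at its \<open>n\<close>-th syzygy module is one too (for
  \<open>n = 0\<close>, up to a copy of \<open>N\<close> in that type). The zero module gets projective dimension 0.\<close>

definition proj_dim :: "('a, 'r) ring_scheme \<Rightarrow> ('a, 'n, 'l) module_scheme \<Rightarrow> enat"
  where "proj_dim R N = Inf {enat n | n.
    \<exists>(P :: nat \<Rightarrow> ('a, ('a, 'n) cell \<Rightarrow> 'a) module) d e. projective_resolution R N n P d e}"

end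

theory Submission
  imports Defs
begin

text \<open>The bound is proved by dimension shifting in the second argument. For a short exact sequence
  \<open>0 \<rightarrow> L \<rightarrow> F \<rightarrow> N \<rightarrow> 0\<close> with \<open>F\<close> free of finite rank, the sequence
  \<open>H\<^sup>i(M,F) \<rightarrow> H\<^sup>i(M,N) \<rightarrow> H\<^bsup>i+1\<^esup>(M,L)\<close> is exact and \<open>H\<^sup>i(M,F)\<close> is a finite direct sum of copies of
  \<open>H\<^sup>i(M,R)\<close>. Since \<open>R\<close> is noetherian, \<open>H\<^sup>i(M,N)\<close> is finitely generated if \<open>H\<^sup>i(M,R)\<close> and
  \<open>H\<^bsup>i+1\<^esup>(M,L)\<close> are (\<open>fin_gen_ext_lim_cokernel\<close>). Passing to the syzygy \<open>L\<close> raises the degree by one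
  and lowers the projective dimension by one, and for projective dimension 0 the module is a direct
  summand of a free module of finite rank (\<open>fin_gen_ext_lim_of_proj_dim_0\<close>). So \<open>H\<^sup>i(M,N)\<close> is
  finitely generated whenever \<open>H\<^sup>j(M,R)\<close> is for all \<open>j \<le> i + pd N\<close>
  (\<open>fin_gen_ext_lim_of_proj_dim\<close>), which is the claim.

  That the syzygies of a resolution by free modules of finite rank become projective after \<open>pd N\<close>
  steps has to be drawn from an arbitrary projective resolution of \<open>N\<close>, whose modules may be
  infinitely generated. In place of Schanuel's lemma, a relation between the syzygies of both
  resolutions is carried along: the identity of the finitely generated syzygy is, up to a
  homomorphism that factors through a free module of finite rank, a composite through the other
  syzygy (\<open>retract_mod_free\<close>, \<open>retract_mod_free_syzygy\<close>).

  The exactness is an argument with cocycles. It rests on three properties of the standard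
  resolutions: their modules are free, consecutive boundaries compose to zero, and the maps induced
  by homomorphisms are functorial chain maps. Colimits of Ext modules are accessed through classes
  \<open>cls i N n f\<close> of cocycles \<open>f\<close> at a stage \<open>n\<close>; such a class is zero exactly if \<open>f\<close> becomes a
  coboundary at a later stage (\<open>cls_eq_zero_iff\<close>).\<close>


section \<open>Modules and homomorphisms\<close>

context cring
begin

text \<open>Negatives are multiples by \<open>-1\<close>, so they do not have to be exhibited.\<close>

lemma moduleI_zero_smult:
  assumes "\<zero>\<^bsub>M\<^esub> \<in> carrier M"
    and "\<And>x y. \<lbrakk>x \<in> carrier M; y \<in> carrier M\<rbrakk> \<Longrightarrow> x \<oplus>\<^bsub>M\<^esub> y \<in> carrier M"
    and "\<And>r x. \<lbrakk>r \<in> carrier R; x \<in> carrier M\<rbrakk> \<Longrightarrow> r \<odot>\<^bsub>M\<^esub> x \<in> carrier M"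
    and "\<And>x y z. \<lbrakk>x \<in> carrier M; y \<in> carrier M; z \<in> carrier M\<rbrakk>
      \<Longrightarrow> (x \<oplus>\<^bsub>M\<^esub> y) \<oplus>\<^bsub>M\<^esub> z = x \<oplus>\<^bsub>M\<^esub> (y \<oplus>\<^bsub>M\<^esub> z)"
    and "\<And>x y. \<lbrakk>x \<in> carrier M; y \<in> carrier M\<rbrakk> \<Longrightarrow> x \<oplus>\<^bsub>M\<^esub> y = y \<oplus>\<^bsub>M\<^esub> x"
    and "\<And>x. x \<in> carrier M \<Longrightarrow> \<zero>\<^bsub>M\<^esub> \<oplus>\<^bsub>M\<^esub> x = x"
    and l_distr: "\<And>r s x. \<lbrakk>r \<in> carrier R; s \<in> carrier R; x \<in> carrier M\<rbrakk>
      \<Longrightarrow> (r \<oplus> s) \<odot>\<^bsub>M\<^esub> x = r \<odot>\<^bsub>M\<^esub> x \<oplus>\<^bsub>M\<^esub> s \<odot>\<^bsub>M\<^esub> x"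
    and "\<And>r x y. \<lbrakk>r \<in> carrier R; x \<in> carrier M; y \<in> carrier M\<rbrakk>
      \<Longrightarrow> r \<odot>\<^bsub>M\<^esub> (x \<oplus>\<^bsub>M\<^esub> y) = r \<odot>\<^bsub>M\<^esub> x \<oplus>\<^bsub>M\<^esub> r \<odot>\<^bsub>M\<^esub> y"
    and "\<And>r s x. \<lbrakk>r \<in> carrier R; s \<in> carrier R; x \<in> carrier M\<rbrakk>
      \<Longrightarrow> (r \<otimes> s) \<odot>\<^bsub>M\<^esub> x = r \<odot>\<^bsub>M\<^esub> (s \<odot>\<^bsub>M\<^esub> x)"
    and one: "\<And>x. x \<in> carrier M \<Longrightarrow> \<one> \<odot>\<^bsub>M\<^esub> x = x"
    and zero: "\<And>x. x \<in> carrier M \<Longrightarrow> \<zero> \<odot>\<^bsub>M\<^esub> x = \<zero>\<^bsub>M\<^esub>"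
  shows "module R M"
proof (rule moduleI[OF is_cring abelian_groupI])
  fix x assume x: "x \<in> carrier M"
  have "(\<ominus> \<one>) \<odot>\<^bsub>M\<^esub> x \<oplus>\<^bsub>M\<^esub> x = (\<ominus> \<one> \<oplus> \<one>) \<odot>\<^bsub>M\<^esub> x"
    using l_distr[of "\<ominus> \<one>" \<one> x] one x by simp
  also have "\<dots> = \<zero>\<^bsub>M\<^esub>"
    using zero x by (simp add: l_neg)
  finally show "\<exists>y\<in>carrier M. y \<oplus>\<^bsub>M\<^esub> x = \<zero>\<^bsub>M\<^esub>"
    using x assms(3) by blast
qed (rule assms; assumption?)+

end

lemma module_homsI:
  assumes "\<And>x. x \<in> carrier M \<Longrightarrow> f x \<in> carrier N"
    and "\<And>x y. \<lbrakk>x \<in> carrier M; y \<in> carrier M\<rbrakk> \<Longrightarrow> f (x \<oplus>\<^bsub>M\<^esub> y) = f x \<oplus>\<^bsub>N\<^esub> f y"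
    and "\<And>r x. \<lbrakk>r \<in> carrier R; x \<in> carrier M\<rbrakk> \<Longrightarrow> f (r \<odot>\<^bsub>M\<^esub> x) = r \<odot>\<^bsub>N\<^esub> f x"
  shows "f \<in> module_homs R M N"
  using assms by (auto simp: module_homs_def)

lemma hom_closed: "\<lbrakk>f \<in> module_homs R M N; x \<in> carrier M\<rbrakk> \<Longrightarrow> f x \<in> carrier N"
  and hom_add: "\<lbrakk>f \<in> module_homs R M N; x \<in> carrier M; y \<in> carrier M\<rbrakk>
    \<Longrightarrow> f (x \<oplus>\<^bsub>M\<^esub> y) = f x \<oplus>\<^bsub>N\<^esub> f y"
  and hom_smult: "\<lbrakk>f \<in> module_homs R M N; r \<in> carrier R; x \<in> carrier M\<rbrakk>
    \<Longrightarrow> f (r \<odot>\<^bsub>M\<^esub> x) = r \<odot>\<^bsub>N\<^esub> f x"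
  by (auto simp: module_homs_def)

lemma hom_cong:
  assumes "f \<in> module_homs R M N" "module R M" "\<And>x. x \<in> carrier M \<Longrightarrow> g x = f x"
  shows "g \<in> module_homs R M N"
proof -
  interpret module R M by fact
  show ?thesis
    using assms(1,3) by (auto intro!: module_homsI simp: hom_closed hom_add hom_smult)
qed

lemma hom_comp:
  "\<lbrakk>f \<in> module_homs R M N; g \<in> module_homs R N K\<rbrakk> \<Longrightarrow> (\<lambda>x. g (f x)) \<in> module_homs R M K"
  by (auto simp: module_homs_def Pi_def)

lemma hom_id: "(\<lambda>x. x) \<in> module_homs R M M"
  by (auto simp: module_homs_def)

lemma hom_into_submodule:
  "\<lbrakk>u \<in> module_homs R M (N\<lparr>carrier := H\<rparr>); H \<subseteq> carrier N\<rbrakk> \<Longrightarrow> u \<in> module_homs R M N"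
  by (auto simp: module_homs_def)

lemma hom_corestrict:
  "\<lbrakk>u \<in> module_homs R M N; \<And>x. x \<in> carrier M \<Longrightarrow> u x \<in> H\<rbrakk> \<Longrightarrow> u \<in> module_homs R M (N\<lparr>carrier := H\<rparr>)"
  by (auto simp: module_homs_def)

lemma hom_restrict_submodule:
  "\<lbrakk>u \<in> module_homs R M N; H \<subseteq> carrier M\<rbrakk> \<Longrightarrow> u \<in> module_homs R (M\<lparr>carrier := H\<rparr>) N"
  by (auto simp: module_homs_def subset_iff)

lemma hom_zero:
  assumes "f \<in> module_homs R M N" "module R M" "module R N"
  shows "f \<zero>\<^bsub>M\<^esub> = \<zero>\<^bsub>N\<^esub>"
proof -
  interpret M: module R M by fact
  interpret N: module R N by fact
  have "f (\<zero>\<^bsub>R\<^esub> \<odot>\<^bsub>M\<^esub> \<zero>\<^bsub>M\<^esub>) = \<zero>\<^bsub>R\<^esub> \<odot>\<^bsub>N\<^esub> f \<zero>\<^bsub>M\<^esub>"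
    by (rule hom_smult[OF assms(1)]) auto
  then show ?thesis
    using hom_closed[OF assms(1) M.M.zero_closed] by simp
qed

lemma (in module) a_inv_eq_smult: "x \<in> carrier M \<Longrightarrow> \<ominus>\<^bsub>M\<^esub> x = (\<ominus> \<one>) \<odot>\<^bsub>M\<^esub> x"
  by (simp add: smult_l_minus)

lemma hom_a_inv:
  assumes "f \<in> module_homs R M N" "module R M" "module R N" "x \<in> carrier M"
  shows "f (\<ominus>\<^bsub>M\<^esub> x) = \<ominus>\<^bsub>N\<^esub> f x"
proof -
  interpret M: module R M by fact
  interpret N: module R N by fact
  show ?thesis
    using assms(1,4) by (simp add: M.a_inv_eq_smult N.a_inv_eq_smult hom_smult hom_closed)
qed

lemma hom_minus:
  assumes "f \<in> module_homs R M N" "module R M" "module R N" "x \<in> carrier M" "y \<in> carrier M"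
  shows "f (x \<ominus>\<^bsub>M\<^esub> y) = f x \<ominus>\<^bsub>N\<^esub> f y"
proof -
  interpret M: module R M by fact
  show ?thesis
    using assms by (simp add: a_minus_def hom_add[OF assms(1)] hom_a_inv[OF assms(1-3)])
qed

lemma hom_pointwise_add:
  assumes "f \<in> module_homs R M N" "g \<in> module_homs R M N" "module R M" "module R N"
  shows "(\<lambda>x. f x \<oplus>\<^bsub>N\<^esub> g x) \<in> module_homs R M N"
proof -
  interpret M: module R M by fact
  interpret N: module R N by fact
  show ?thesis
    using assms(1,2)
    by (auto intro!: module_homsI simp: hom_closed hom_add hom_smult N.M.a_ac N.smult_r_distr)
qed

lemma hom_pointwise_smult:
  assumes "f \<in> module_homs R M N" "r \<in> carrier R" "module R M" "module R N"
  shows "(\<lambda>x. r \<odot>\<^bsub>N\<^esub> f x) \<in> module_homs R M N"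
proof -
  interpret M: module R M by fact
  interpret N: module R N by fact
  show ?thesis
    using assms(1,2)
    by (auto intro!: module_homsI simp: hom_closed hom_add hom_smult N.smult_r_distr
        N.smult_assoc1[symmetric] M.R.m_comm)
qed

lemma hom_pointwise_minus:
  assumes "f \<in> module_homs R M N" "g \<in> module_homs R M N" "module R M" "module R N"
  shows "(\<lambda>x. f x \<ominus>\<^bsub>N\<^esub> g x) \<in> module_homs R M N"
proof -
  interpret N: module R N by fact
  have "(\<lambda>x. f x \<oplus>\<^bsub>N\<^esub> (\<ominus>\<^bsub>R\<^esub> \<one>\<^bsub>R\<^esub>) \<odot>\<^bsub>N\<^esub> g x) \<in> module_homs R M N"
    by (intro hom_pointwise_add hom_pointwise_smult assms) auto
  then show ?thesis
    by (rule hom_cong) (use assms in \<open>auto simp: a_minus_def N.a_inv_eq_smult hom_closed\<close>)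
qed

lemma hom_zero_map:
  assumes "module R N"
  shows "(\<lambda>x. \<zero>\<^bsub>N\<^esub>) \<in> module_homs R M N"
proof -
  interpret N: module R N by fact
  show ?thesis by (auto intro!: module_homsI)
qed

lemma hom_restrict: "module R M \<Longrightarrow> f \<in> module_homs R M N \<Longrightarrow> restrict f (carrier M) \<in> module_homs R M N"
  by (rule hom_cong) auto

lemma hom_module_simps [simp]:
  "carrier (hom_module R M N) = module_homs R M N \<inter> extensional (carrier M)"
  "\<zero>\<^bsub>hom_module R M N\<^esub> = (\<lambda>x\<in>carrier M. \<zero>\<^bsub>N\<^esub>)"
  "f \<oplus>\<^bsub>hom_module R M N\<^esub> g = (\<lambda>x\<in>carrier M. f x \<oplus>\<^bsub>N\<^esub> g x)"
  "r \<odot>\<^bsub>hom_module R M N\<^esub> f = (\<lambda>x\<in>carrier M. r \<odot>\<^bsub>N\<^esub> f x)"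
  by (simp_all add: hom_module_def)

lemma module_hom_module:
  assumes "module R M" "module R N"
  shows "module R (hom_module R M N)"
proof -
  interpret M: module R M by fact
  interpret N: module R N by fact
  show ?thesis
    by (rule M.moduleI_zero_smult)
      (auto intro!: hom_restrict hom_pointwise_add hom_pointwise_smult hom_zero_map assms
        intro: extensionalityI[of _ "carrier M"]
        simp: hom_closed N.M.a_ac N.smult_r_distr N.smult_l_distr N.smult_assoc1)
qed


section \<open>Submodules, spans and finite generation\<close>

lemma submodule_carrier: "submodule H R M \<Longrightarrow> H \<subseteq> carrier M"
  using subgroup.subset[OF submodule.axioms(1)] by fastforce

lemma submodule_zero: "submodule H R M \<Longrightarrow> \<zero>\<^bsub>M\<^esub> \<in> H"
  using subgroup.one_closed[OF submodule.axioms(1)] by fastforce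

lemma submodule_add: "\<lbrakk>submodule H R M; x \<in> H; y \<in> H\<rbrakk> \<Longrightarrow> x \<oplus>\<^bsub>M\<^esub> y \<in> H"
  using subgroup.m_closed[OF submodule.axioms(1)] by fastforce

lemma submodule_smult: "\<lbrakk>submodule H R M; r \<in> carrier R; x \<in> H\<rbrakk> \<Longrightarrow> r \<odot>\<^bsub>M\<^esub> x \<in> H"
  by (rule submodule.smult_closed)

context module
begin

lemma submodule_minus:
  assumes "submodule H R M" "x \<in> H" "y \<in> H"
  shows "x \<ominus>\<^bsub>M\<^esub> y \<in> H"
  unfolding a_minus_def by (rule submoduleE(5)[OF assms(1,2) submoduleE(3)[OF assms(1,3)]])

lemma add_minus_cancel: "\<lbrakk>x \<in> carrier M; y \<in> carrier M\<rbrakk> \<Longrightarrow> y \<oplus>\<^bsub>M\<^esub> (x \<ominus>\<^bsub>M\<^esub> y) = x"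
  by (simp add: a_minus_def M.a_lcomm[of y x] M.r_neg)

lemma minus_eq_zero_iff:
  assumes "x \<in> carrier M" "y \<in> carrier M"
  shows "x \<ominus>\<^bsub>M\<^esub> y = \<zero>\<^bsub>M\<^esub> \<longleftrightarrow> x = y"
proof
  assume "x \<ominus>\<^bsub>M\<^esub> y = \<zero>\<^bsub>M\<^esub>"
  then show "x = y" using add_minus_cancel[OF assms] assms(2) by simp
qed (use assms(2) in \<open>simp add: a_minus_def M.r_neg\<close>)

lemma submoduleI_smult:
  assumes "H \<subseteq> carrier M" "\<zero>\<^bsub>M\<^esub> \<in> H" "\<And>x y. \<lbrakk>x \<in> H; y \<in> H\<rbrakk> \<Longrightarrow> x \<oplus>\<^bsub>M\<^esub> y \<in> H"
    and "\<And>r x. \<lbrakk>r \<in> carrier R; x \<in> H\<rbrakk> \<Longrightarrow> r \<odot>\<^bsub>M\<^esub> x \<in> H"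
  shows "submodule H R M"
proof (rule submoduleI)
  fix x assume "x \<in> H"
  then show "\<ominus>\<^bsub>M\<^esub> x \<in> H"
    using assms(4)[of "\<ominus> \<one>" x] assms(1) by (auto simp: a_inv_eq_smult)
qed (rule assms; assumption)+

lemma span_submodule:
  assumes "A \<subseteq> carrier M"
  shows "submodule (module_span R M A) R M"
proof (rule submoduleI_smult)
  show "module_span R M A \<subseteq> carrier M"
    using carrier_is_submodule assms by (auto simp: module_span_def)
qed (auto simp: module_span_def submodule_zero submodule_add submodule_smult)

lemma span_superset: "A \<subseteq> module_span R M A"
  by (auto simp: module_span_def)

lemma span_minimal: "\<lbrakk>submodule H R M; A \<subseteq> H\<rbrakk> \<Longrightarrow> module_span R M A \<subseteq> H"
  by (auto simp: module_span_def)

lemma span_mono: "A \<subseteq> B \<Longrightarrow> module_span R M A \<subseteq> module_span R M B"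
  by (auto simp: module_span_def)

lemma fin_gen_moduleI:
  assumes "finite A" "A \<subseteq> carrier M" "carrier M \<subseteq> module_span R M A"
  shows "fin_gen_module R M"
proof -
  have "module_span R M A = carrier M"
    using assms(3) span_minimal[OF carrier_is_submodule assms(2)] by (rule subset_antisym[rotated])
  then show ?thesis
    using assms(1,2) by (auto simp: fin_gen_module_def)
qed

end

lemma hom_kernel_submodule:
  assumes "f \<in> module_homs R M N" "module R M" "module R N"
  shows "submodule {x \<in> carrier M. f x = \<zero>\<^bsub>N\<^esub>} R M"
proof -
  interpret M: module R M by fact
  interpret N: module R N by fact
  show ?thesis
    using assms by (intro M.submoduleI_smult) (auto simp: hom_zero hom_add hom_smult)
qed

lemma hom_image_submodule:
  assumes f: "f \<in> module_homs R M N" and "module R M" "module R N"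
  shows "submodule (f ` carrier M) R N"
proof -
  interpret M: module R M by fact
  interpret N: module R N by fact
  show ?thesis
  proof (rule N.submoduleI_smult)
    show "f ` carrier M \<subseteq> carrier N"
      using hom_closed[OF f] by blast
    show "\<zero>\<^bsub>N\<^esub> \<in> f ` carrier M"
      using hom_zero[OF assms] by (metis M.M.zero_closed image_eqI)
  next
    fix x y assume "x \<in> f ` carrier M" "y \<in> f ` carrier M"
    then show "x \<oplus>\<^bsub>N\<^esub> y \<in> f ` carrier M"
      using hom_add[OF f] by (metis (no_types, lifting) M.M.a_closed imageE image_eqI)
  next
    fix r x assume "r \<in> carrier R" "x \<in> f ` carrier M"
    then show "r \<odot>\<^bsub>N\<^esub> x \<in> f ` carrier M"
      using hom_smult[OF f] by (metis (no_types, lifting) M.smult_closed imageE image_eqI)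
  qed
qed

lemma hom_preimage_submodule:
  assumes "f \<in> module_homs R M N" "module R M" "module R N" "submodule H R N"
  shows "submodule {x \<in> carrier M. f x \<in> H} R M"
proof -
  interpret M: module R M by fact
  interpret N: module R N by fact
  show ?thesis
    using assms
    by (intro M.submoduleI_smult)
      (auto simp: hom_zero hom_add hom_smult submodule_zero submodule_add submodule_smult)
qed

lemma hom_span_subset:
  assumes "f \<in> module_homs R M N" "module R M" "module R N" "A \<subseteq> carrier M"
  shows "f ` module_span R M A \<subseteq> module_span R N (f ` A)"
proof -
  interpret M: module R M by fact
  interpret N: module R N by fact
  have "f ` A \<subseteq> carrier N"
    using assms(4) hom_closed[OF assms(1)] by blast
  then have "submodule {x \<in> carrier M. f x \<in> module_span R N (f ` A)} R M"
    by (intro hom_preimage_submodule[OF assms(1-3)] N.span_submodule)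
  then have "module_span R M A \<subseteq> {x \<in> carrier M. f x \<in> module_span R N (f ` A)}"
    using assms(4) N.span_superset[of "f ` A"] by (intro M.span_minimal) auto
  then show ?thesis by auto
qed

text \<open>The noetherian property passes from ideals to submodules by induction on the number of
  generators of the ambient module: modulo the span of all generators but one, \<open>a\<close>, a submodule
  \<open>H\<close> is \<open>I a\<close> for an ideal \<open>I\<close>, so generators of \<open>I\<close>, lifted to \<open>H\<close>, and generators of
  the part of \<open>H\<close> inside that span suffice.\<close>

lemma (in module) noetherian_submodule_of_span:
  assumes noeth: "noetherian_ring R" and "finite A"
  shows "A \<subseteq> carrier M \<Longrightarrow> submodule H R M \<Longrightarrow> H \<subseteq> module_span R M A
    \<Longrightarrow> \<exists>B. finite B \<and> B \<subseteq> H \<and> H \<subseteq> module_span R M B"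
  using \<open>finite A\<close>
proof (induction A arbitrary: H)
  case empty
  then show ?case by (intro exI[of _ "{}"]) auto
next
  case (insert a A)
  interpret noetherian_ring R by fact
  let ?S = "module_span R M"
  have a: "a \<in> carrier M" and A: "A \<subseteq> carrier M" using insert by auto
  note SA = span_submodule[OF A]
  note SAc = subsetD[OF submodule_carrier[OF SA]]
  note Hc = subsetD[OF submodule_carrier[OF insert.prems(2)]]
  have lincomb: "(r \<oplus> s) \<odot>\<^bsub>M\<^esub> a \<oplus>\<^bsub>M\<^esub> (x \<oplus>\<^bsub>M\<^esub> y) = (r \<odot>\<^bsub>M\<^esub> a \<oplus>\<^bsub>M\<^esub> x) \<oplus>\<^bsub>M\<^esub> (s \<odot>\<^bsub>M\<^esub> a \<oplus>\<^bsub>M\<^esub> y)"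
    if "r \<in> carrier R" "s \<in> carrier R" "x \<in> carrier M" "y \<in> carrier M" for r s x y
    using that a by (simp add: smult_l_distr M.a_ac)
  have lincomb': "(s \<otimes> r) \<odot>\<^bsub>M\<^esub> a \<oplus>\<^bsub>M\<^esub> s \<odot>\<^bsub>M\<^esub> x = s \<odot>\<^bsub>M\<^esub> (r \<odot>\<^bsub>M\<^esub> a \<oplus>\<^bsub>M\<^esub> x)"
    if "r \<in> carrier R" "s \<in> carrier R" "x \<in> carrier M" for r s x
    using that a by (simp add: smult_assoc1 smult_r_distr)
  have coeff_ideal: "ideal {r \<in> carrier R. \<exists>x \<in> ?S A. r \<odot>\<^bsub>M\<^esub> a \<oplus>\<^bsub>M\<^esub> x \<in> K} R" (is "ideal ?I R")
    if K: "submodule K R M" for K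
  proof (rule idealI[OF ring_axioms])
    show "subgroup ?I (add_monoid R)"
    proof (rule group.subgroupI[OF R.a_group])
      have "\<zero> \<in> ?I"
        using submodule_zero[OF SA] submodule_zero[OF K] a by force
      then show "?I \<noteq> {}" by blast
      fix r assume "r \<in> ?I"
      then obtain x where x: "r \<in> carrier R" "x \<in> ?S A" "r \<odot>\<^bsub>M\<^esub> a \<oplus>\<^bsub>M\<^esub> x \<in> K" by blast
      have "(\<ominus> r) \<odot>\<^bsub>M\<^esub> a \<oplus>\<^bsub>M\<^esub> (\<ominus> \<one>) \<odot>\<^bsub>M\<^esub> x \<in> K"
        using lincomb'[of r "\<ominus> \<one>" x] x SAc submodule_smult[OF K, of "\<ominus> \<one>"] by (simp add: l_minus)
      then show "inv\<^bsub>add_monoid R\<^esub> r \<in> ?I"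
        using x submodule_smult[OF SA, of "\<ominus> \<one>" x] by (auto simp: a_inv_def[symmetric])
    next
      fix r s assume "r \<in> ?I" "s \<in> ?I"
      then obtain x y where "r \<in> carrier R" "x \<in> ?S A" "r \<odot>\<^bsub>M\<^esub> a \<oplus>\<^bsub>M\<^esub> x \<in> K"
        "s \<in> carrier R" "y \<in> ?S A" "s \<odot>\<^bsub>M\<^esub> a \<oplus>\<^bsub>M\<^esub> y \<in> K" by blast
      then have "(r \<oplus> s) \<odot>\<^bsub>M\<^esub> a \<oplus>\<^bsub>M\<^esub> (x \<oplus>\<^bsub>M\<^esub> y) \<in> K" "x \<oplus>\<^bsub>M\<^esub> y \<in> ?S A" "r \<oplus> s \<in> carrier R"
        using lincomb[of r s x y] SAc submodule_add[OF K] submodule_add[OF SA] by auto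
      then show "r \<otimes>\<^bsub>add_monoid R\<^esub> s \<in> ?I" by auto
    qed auto
    fix r s assume "r \<in> ?I" and s: "s \<in> carrier R"
    then obtain x where x: "r \<in> carrier R" "x \<in> ?S A" "r \<odot>\<^bsub>M\<^esub> a \<oplus>\<^bsub>M\<^esub> x \<in> K" by blast
    then have "(s \<otimes> r) \<odot>\<^bsub>M\<^esub> a \<oplus>\<^bsub>M\<^esub> s \<odot>\<^bsub>M\<^esub> x \<in> K"
      using lincomb'[of r s x] s SAc submodule_smult[OF K] by auto
    then show "s \<otimes> r \<in> ?I"
      using x s submodule_smult[OF SA] by blast
    then show "r \<otimes> s \<in> ?I"
      using x s by (simp add: m_comm)
  qed
  let ?I = "{r \<in> carrier R. \<exists>x \<in> ?S A. r \<odot>\<^bsub>M\<^esub> a \<oplus>\<^bsub>M\<^esub> x \<in> H}"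
  obtain T where T: "T \<subseteq> carrier R" "finite T" "?I = Idl T"
    using finetely_gen[OF coeff_ideal[OF insert.prems(2)]] by blast
  have "\<forall>t\<in>T. \<exists>x. x \<in> ?S A \<and> t \<odot>\<^bsub>M\<^esub> a \<oplus>\<^bsub>M\<^esub> x \<in> H"
    using genideal_self[OF T(1)] T(3) by blast
  then obtain \<xi> where \<xi>: "\<And>t. t \<in> T \<Longrightarrow> \<xi> t \<in> ?S A \<and> t \<odot>\<^bsub>M\<^esub> a \<oplus>\<^bsub>M\<^esub> \<xi> t \<in> H"
    by metis
  have "submodule (H \<inter> ?S A) R M"
    using insert.prems(2) SA Hc
    by (intro submoduleI_smult) (auto simp: submodule_zero submodule_add submodule_smult)
  then obtain B where B: "finite B" "B \<subseteq> H \<inter> ?S A" "H \<inter> ?S A \<subseteq> ?S B"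
    using insert.IH[OF A, of "H \<inter> ?S A"] by auto
  define C where "C = B \<union> (\<lambda>t. t \<odot>\<^bsub>M\<^esub> a \<oplus>\<^bsub>M\<^esub> \<xi> t) ` T"
  have C: "finite C" "C \<subseteq> H"
    using B T \<xi> by (auto simp: C_def)
  then have Cc: "C \<subseteq> carrier M" using Hc by blast
  note SC = span_submodule[OF Cc]
  have T_sub: "T \<subseteq> {r \<in> carrier R. \<exists>x \<in> ?S A. r \<odot>\<^bsub>M\<^esub> a \<oplus>\<^bsub>M\<^esub> x \<in> ?S C}"
  proof
    fix t assume t: "t \<in> T"
    then have "t \<odot>\<^bsub>M\<^esub> a \<oplus>\<^bsub>M\<^esub> \<xi> t \<in> ?S C"
      using span_superset[of C] by (auto simp: C_def)
    then show "t \<in> {r \<in> carrier R. \<exists>x \<in> ?S A. r \<odot>\<^bsub>M\<^esub> a \<oplus>\<^bsub>M\<^esub> x \<in> ?S C}"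
      using t T(1) \<xi>[OF t] by auto
  qed
  have span_insert: "?S (insert a A) \<subseteq> {r \<odot>\<^bsub>M\<^esub> a \<oplus>\<^bsub>M\<^esub> x |r x. r \<in> carrier R \<and> x \<in> ?S A}" (is "_ \<subseteq> ?L")
  proof (rule span_minimal[OF submoduleI_smult])
    show "?L \<subseteq> carrier M" using a SAc by auto
    have "\<zero>\<^bsub>M\<^esub> = \<zero> \<odot>\<^bsub>M\<^esub> a \<oplus>\<^bsub>M\<^esub> \<zero>\<^bsub>M\<^esub>" using a by simp
    then show "\<zero>\<^bsub>M\<^esub> \<in> ?L" using submodule_zero[OF SA] by blast
    show "insert a A \<subseteq> ?L"
    proof
      fix x assume "x \<in> insert a A"
      then consider "x = a" | "x \<in> A" by blast
      then show "x \<in> ?L"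
      proof cases
        case 1
        then have "x = \<one> \<odot>\<^bsub>M\<^esub> a \<oplus>\<^bsub>M\<^esub> \<zero>\<^bsub>M\<^esub>" using a by simp
        then show ?thesis using submodule_zero[OF SA] by blast
      next
        case 2
        then have "x = \<zero> \<odot>\<^bsub>M\<^esub> a \<oplus>\<^bsub>M\<^esub> x" using a A by auto
        moreover have "x \<in> ?S A" using 2 span_superset[of A] by auto
        ultimately show ?thesis by blast
      qed
    qed
  next
    fix x y assume "x \<in> ?L" "y \<in> ?L"
    then obtain r s x' y' where "x = r \<odot>\<^bsub>M\<^esub> a \<oplus>\<^bsub>M\<^esub> x'" "y = s \<odot>\<^bsub>M\<^esub> a \<oplus>\<^bsub>M\<^esub> y'"
      and rs: "r \<in> carrier R" "s \<in> carrier R" "x' \<in> ?S A" "y' \<in> ?S A" by blast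
    then have "x \<oplus>\<^bsub>M\<^esub> y = (r \<oplus> s) \<odot>\<^bsub>M\<^esub> a \<oplus>\<^bsub>M\<^esub> (x' \<oplus>\<^bsub>M\<^esub> y')"
      using lincomb SAc by simp
    then show "x \<oplus>\<^bsub>M\<^esub> y \<in> ?L"
      using rs submodule_add[OF SA] by blast
  next
    fix s x assume s: "s \<in> carrier R" and "x \<in> ?L"
    then obtain r x' where "x = r \<odot>\<^bsub>M\<^esub> a \<oplus>\<^bsub>M\<^esub> x'" and r: "r \<in> carrier R" "x' \<in> ?S A" by blast
    then have "s \<odot>\<^bsub>M\<^esub> x = (s \<otimes> r) \<odot>\<^bsub>M\<^esub> a \<oplus>\<^bsub>M\<^esub> s \<odot>\<^bsub>M\<^esub> x'"
      using lincomb' SAc s by simp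
    then show "s \<odot>\<^bsub>M\<^esub> x \<in> ?L"
      using r s submodule_smult[OF SA] by blast
  qed
  have "H \<subseteq> ?S C"
  proof
    fix y assume y: "y \<in> H"
    then obtain r x where rx: "y = r \<odot>\<^bsub>M\<^esub> a \<oplus>\<^bsub>M\<^esub> x" "r \<in> carrier R" "x \<in> ?S A"
      using insert.prems(3) span_insert by blast
    then have "r \<in> ?I" using y by blast
    then obtain x' where x': "x' \<in> ?S A" "r \<odot>\<^bsub>M\<^esub> a \<oplus>\<^bsub>M\<^esub> x' \<in> ?S C"
      using genideal_minimal[OF coeff_ideal[OF SC] T_sub] T(3) by blast
    have c: "r \<odot>\<^bsub>M\<^esub> a \<in> carrier M" "x \<in> carrier M" "x' \<in> carrier M"
      using rx x' a SAc by auto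
    have "y = (r \<odot>\<^bsub>M\<^esub> a \<oplus>\<^bsub>M\<^esub> x') \<oplus>\<^bsub>M\<^esub> (x \<ominus>\<^bsub>M\<^esub> x')"
      using rx(1) c by (simp add: M.a_assoc add_minus_cancel)
    moreover from this have "x \<ominus>\<^bsub>M\<^esub> x' = y \<ominus>\<^bsub>M\<^esub> (r \<odot>\<^bsub>M\<^esub> a \<oplus>\<^bsub>M\<^esub> x')"
      using c by (simp add: a_minus_def M.a_comm[of "r \<odot>\<^bsub>M\<^esub> a \<oplus>\<^bsub>M\<^esub> x'"] M.a_assoc[of "x \<oplus>\<^bsub>M\<^esub> \<ominus>\<^bsub>M\<^esub> x'"] M.r_neg)
    then have "x \<ominus>\<^bsub>M\<^esub> x' \<in> H"
      using y x' span_minimal[OF insert.prems(2) C(2)] submodule_minus[OF insert.prems(2)] by auto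
    then have "x \<ominus>\<^bsub>M\<^esub> x' \<in> ?S C"
      using B(3) submodule_minus[OF SA rx(3) x'(1)] span_mono[of B C] unfolding C_def by blast
    ultimately show "y \<in> ?S C"
      using submodule_add[OF SC] x'(2) by metis
  qed
  then show ?case using C by blast
qed

lemma (in module) noetherian_submodule:
  assumes "noetherian_ring R" "fin_gen_module R M" "submodule H R M"
  shows "\<exists>B. finite B \<and> B \<subseteq> H \<and> H \<subseteq> module_span R M B"
proof -
  obtain A where "A \<subseteq> carrier M" "finite A" "module_span R M A = carrier M"
    using assms(2) by (auto simp: fin_gen_module_def)
  then show ?thesis
    using noetherian_submodule_of_span[OF assms(1), of A H] assms(3) submodule_carrier[OF assms(3)]
    by auto
qed

text \<open>Generators found in the ambient module also generate inside \<open>H\<close>, because a submodule of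
  \<open>H\<close> is a submodule of the ambient module.\<close>

lemma (in module) fin_gen_submodule:
  assumes "noetherian_ring R" "fin_gen_module R M" and H: "submodule H R M"
  shows "fin_gen_module R (M\<lparr>carrier := H\<rparr>)"
proof -
  interpret H: module R "M\<lparr>carrier := H\<rparr>"
    by (rule submodule.submodule_is_module[OF H module_axioms])
  obtain B where B: "finite B" "B \<subseteq> H" "H \<subseteq> module_span R M B"
    using noetherian_submodule[OF assms] by blast
  show ?thesis
  proof (rule H.fin_gen_moduleI[OF B(1)])
    let ?K = "module_span R (M\<lparr>carrier := H\<rparr>) B"
    have K: "submodule ?K R (M\<lparr>carrier := H\<rparr>)"
      using B(2) by (intro H.span_submodule) auto
    have "submodule ?K R M"
      using submodule_carrier[OF K] submodule_carrier[OF H] submodule_zero[OF K] submodule_add[OF K]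
        submodule_smult[OF K]
      by (intro submoduleI_smult) auto
    then have "module_span R M B \<subseteq> ?K"
      by (rule span_minimal[OF _ H.span_superset])
    then show "carrier (M\<lparr>carrier := H\<rparr>) \<subseteq> ?K"
      using B(3) by simp
  qed (use B(2) in simp)
qed

text \<open>Over a noetherian ring, the middle term of an exact sequence with finitely generated ends is
  finitely generated.
  The outgoing map is given only as a linear relation \<open>D\<close>, because the connecting map of the long
  exact sequence comes from a choice of lifts.\<close>

lemma fin_gen_middle:
  assumes noeth: "noetherian_ring R" and "module R X" "module R Y" "module R Z"
    and fgY: "fin_gen_module R Y" and fgZ: "fin_gen_module R Z"
    and e: "e \<in> module_homs R Z X"
    and D_sub: "D \<subseteq> carrier X \<times> carrier Y"
    and D_total: "\<And>x. x \<in> carrier X \<Longrightarrow> \<exists>y. (x, y) \<in> D"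
    and D_add: "\<And>x y x' y'. \<lbrakk>(x, y) \<in> D; (x', y') \<in> D\<rbrakk> \<Longrightarrow> (x \<oplus>\<^bsub>X\<^esub> x', y \<oplus>\<^bsub>Y\<^esub> y') \<in> D"
    and D_smult: "\<And>r x y. \<lbrakk>r \<in> carrier R; (x, y) \<in> D\<rbrakk> \<Longrightarrow> (r \<odot>\<^bsub>X\<^esub> x, r \<odot>\<^bsub>Y\<^esub> y) \<in> D"
    and exact: "\<And>x. (x, \<zero>\<^bsub>Y\<^esub>) \<in> D \<Longrightarrow> x \<in> e ` carrier Z"
  shows "fin_gen_module R X"
proof -
  interpret X: module R X by fact
  interpret Y: module R Y by fact
  interpret Z: module R Z by fact
  have D_zero: "(\<zero>\<^bsub>X\<^esub>, \<zero>\<^bsub>Y\<^esub>) \<in> D"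
  proof -
    obtain y where "(\<zero>\<^bsub>X\<^esub>, y) \<in> D" using D_total[of "\<zero>\<^bsub>X\<^esub>"] by blast
    moreover from this have "y \<in> carrier Y" using D_sub by blast
    ultimately show ?thesis
      using D_smult[of "\<zero>\<^bsub>R\<^esub>" "\<zero>\<^bsub>X\<^esub>" y] by simp
  qed
  have "submodule (Range D) R Y"
  proof (rule Y.submoduleI_smult)
    show "Range D \<subseteq> carrier Y" using D_sub by blast
    show "\<zero>\<^bsub>Y\<^esub> \<in> Range D" using D_zero by blast
  next
    fix x y assume "x \<in> Range D" "y \<in> Range D"
    then show "x \<oplus>\<^bsub>Y\<^esub> y \<in> Range D" by (meson D_add Range.simps)
  next
    fix r x assume "r \<in> carrier R" "x \<in> Range D"
    then show "r \<odot>\<^bsub>Y\<^esub> x \<in> Range D" by (meson D_smult Range.simps)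
  qed
  then obtain B where B: "finite B" "B \<subseteq> Range D" "Range D \<subseteq> module_span R Y B"
    using Y.noetherian_submodule[OF noeth fgY] by blast
  then have "\<forall>b\<in>B. \<exists>x. (x, b) \<in> D" by blast
  then obtain s where s: "\<And>b. b \<in> B \<Longrightarrow> (s b, b) \<in> D" by metis
  obtain A where A: "A \<subseteq> carrier Z" "finite A" "module_span R Z A = carrier Z"
    using fgZ by (auto simp: fin_gen_module_def)
  let ?T = "s ` B \<union> e ` A"
  have T: "?T \<subseteq> carrier X"
    using s D_sub A hom_closed[OF e] by blast
  note ST = X.span_submodule[OF T]
  have "submodule {y \<in> carrier Y. \<exists>x\<in>module_span R X ?T. (x, y) \<in> D} R Y" (is "submodule ?L R Y")
  proof (rule Y.submoduleI_smult)
    show "\<zero>\<^bsub>Y\<^esub> \<in> ?L"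
      using D_zero submodule_zero[OF ST] by auto
  next
    fix x y assume "x \<in> ?L" "y \<in> ?L"
    then show "x \<oplus>\<^bsub>Y\<^esub> y \<in> ?L"
      using D_add submodule_add[OF ST] by simp meson
  next
    fix r x assume "r \<in> carrier R" "x \<in> ?L"
    then show "r \<odot>\<^bsub>Y\<^esub> x \<in> ?L"
      using D_smult submodule_smult[OF ST] by simp meson
  qed auto
  moreover have "B \<subseteq> {y \<in> carrier Y. \<exists>x\<in>module_span R X ?T. (x, y) \<in> D}"
  proof
    fix b assume b: "b \<in> B"
    then have "s b \<in> module_span R X ?T" "b \<in> carrier Y"
      using X.span_superset[of ?T] s[OF b] D_sub by auto
    then show "b \<in> {y \<in> carrier Y. \<exists>x\<in>module_span R X ?T. (x, y) \<in> D}"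
      using s[OF b] by blast
  qed
  ultimately have lift: "Range D \<subseteq> {y \<in> carrier Y. \<exists>x\<in>module_span R X ?T. (x, y) \<in> D}"
    using B(3) Y.span_minimal by blast
  have eZ: "e ` carrier Z \<subseteq> module_span R X ?T"
    using hom_span_subset[OF e \<open>module R Z\<close> \<open>module R X\<close> A(1)] A(3) X.span_mono[of "e ` A" ?T] by auto
  show ?thesis
  proof (rule X.fin_gen_moduleI[OF _ T])
    show "carrier X \<subseteq> module_span R X ?T"
    proof
      fix x assume x: "x \<in> carrier X"
      then obtain y where y: "(x, y) \<in> D" using D_total by blast
      then obtain x' where x': "x' \<in> module_span R X ?T" "(x', y) \<in> D" using lift by blast
      have yc: "y \<in> carrier Y" and xc: "x' \<in> carrier X" using y x' D_sub by auto
      have "(x \<ominus>\<^bsub>X\<^esub> x', \<zero>\<^bsub>Y\<^esub>) \<in> D"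
        using D_add[OF y D_smult[OF _ x'(2), of "\<ominus>\<^bsub>R\<^esub> \<one>\<^bsub>R\<^esub>"]] x xc yc
        by (simp add: a_minus_def X.a_inv_eq_smult[symmetric] Y.a_inv_eq_smult[symmetric] Y.M.r_neg)
      then have "x \<ominus>\<^bsub>X\<^esub> x' \<in> module_span R X ?T"
        using exact eZ by blast
      then have "x' \<oplus>\<^bsub>X\<^esub> (x \<ominus>\<^bsub>X\<^esub> x') \<in> module_span R X ?T"
        using submodule_add[OF ST x'(1)] by blast
      then show "x \<in> module_span R X ?T"
        using x xc by (simp add: X.add_minus_cancel)
    qed
  qed (use B(1) A(2) in simp)
qed

lemma fin_gen_sum_of_images:
  assumes "module R X" "module R Y" "module R Z" "fin_gen_module R Y" "fin_gen_module R Z"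
    and f: "f \<in> module_homs R Y X" and g: "g \<in> module_homs R Z X"
    and sum: "\<And>x. x \<in> carrier X \<Longrightarrow> \<exists>y\<in>carrier Y. \<exists>z\<in>carrier Z. x = f y \<oplus>\<^bsub>X\<^esub> g z"
  shows "fin_gen_module R X"
proof -
  interpret X: module R X by fact
  from assms(4) obtain A where A: "A \<subseteq> carrier Y" "finite A" "module_span R Y A = carrier Y"
    unfolding fin_gen_module_def by blast
  from assms(5) obtain B where B: "B \<subseteq> carrier Z" "finite B" "module_span R Z B = carrier Z"
    unfolding fin_gen_module_def by blast
  let ?T = "f ` A \<union> g ` B"
  have T: "?T \<subseteq> carrier X"
    using A B hom_closed[OF f] hom_closed[OF g] by auto
  have "f ` carrier Y \<subseteq> module_span R X ?T" "g ` carrier Z \<subseteq> module_span R X ?T"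
    using hom_span_subset[OF f assms(2,1) A(1)] hom_span_subset[OF g assms(3,1) B(1)] A(3) B(3)
      X.span_mono[of "f ` A" ?T] X.span_mono[of "g ` B" ?T] by auto
  note images = this
  have "carrier X \<subseteq> module_span R X ?T"
  proof
    fix x assume "x \<in> carrier X"
    then obtain y z where "y \<in> carrier Y" "z \<in> carrier Z" and x: "x = f y \<oplus>\<^bsub>X\<^esub> g z"
      using sum by blast
    then have "f y \<in> module_span R X ?T" "g z \<in> module_span R X ?T"
      using images by auto
    then show "x \<in> module_span R X ?T"
      unfolding x by (rule submodule_add[OF X.span_submodule[OF T]])
  qed
  then show ?thesis
    using A(2) B(2) by (intro X.fin_gen_moduleI[OF _ T]) simp_all
qed


section \<open>Free modules\<close>

lemma free_module_simps [simp]: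
  "f \<oplus>\<^bsub>free_module R B\<^esub> g = (\<lambda>b. f b \<oplus>\<^bsub>R\<^esub> g b)"
  "r \<odot>\<^bsub>free_module R B\<^esub> f = (\<lambda>b. r \<otimes>\<^bsub>R\<^esub> f b)"
  "\<zero>\<^bsub>free_module R B\<^esub> = (\<lambda>b. \<zero>\<^bsub>R\<^esub>)"
  by (simp_all add: free_module_def)

lemma free_carrier_iff:
  "f \<in> carrier (free_module R B) \<longleftrightarrow>
    (\<forall>b. f b \<in> carrier R) \<and> finite (supp R f) \<and> (\<forall>b. b \<notin> B \<longrightarrow> f b = \<zero>\<^bsub>R\<^esub>)"
  by (auto simp: free_module_def supp_def)

lemma free_carrierD:
  assumes "f \<in> carrier (free_module R B)"
  shows "f b \<in> carrier R" "finite (supp R f)" "b \<notin> B \<Longrightarrow> f b = \<zero>\<^bsub>R\<^esub>" "supp R f \<subseteq> B"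
  using assms by (auto simp: free_module_def supp_def)

lemma free_module_mono: "B \<subseteq> C \<Longrightarrow> carrier (free_module R B) \<subseteq> carrier (free_module R C)"
  by (auto simp: free_module_def)

context cring
begin

lemma supp_add: "supp R (\<lambda>b. f b \<oplus> g b) \<subseteq> supp R f \<union> supp R g"
  by (auto simp: supp_def)

lemma supp_smult: "r \<in> carrier R \<Longrightarrow> supp R (\<lambda>b. r \<otimes> f b) \<subseteq> supp R f"
  by (auto simp: supp_def)

lemma free_zero_closed: "(\<lambda>b. \<zero>) \<in> carrier (free_module R B)"
  by (auto simp: free_carrier_iff supp_def)

lemma free_add_closed:
  assumes "f \<in> carrier (free_module R B)" "g \<in> carrier (free_module R B)"
  shows "(\<lambda>b. f b \<oplus> g b) \<in> carrier (free_module R B)"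
  using assms finite_subset[OF supp_add[of f g]] by (auto simp: free_carrier_iff)

lemma free_smult_closed:
  assumes "r \<in> carrier R" "f \<in> carrier (free_module R B)"
  shows "(\<lambda>b. r \<otimes> f b) \<in> carrier (free_module R B)"
  using assms finite_subset[OF supp_smult[of r f]] by (auto simp: free_carrier_iff)

lemma module_free_module: "module R (free_module R B)"
  by (rule moduleI_zero_smult)
    (auto simp: free_zero_closed free_add_closed free_smult_closed free_carrierD(1) a_ac
      l_distr r_distr m_assoc)

lemma basis_vec_closed: "b \<in> B \<Longrightarrow> basis_vec R b \<in> carrier (free_module R B)"
proof -
  assume "b \<in> B"
  moreover have "supp R (basis_vec R b) \<subseteq> {b}" by (auto simp: supp_def basis_vec_def)
  then have "finite (supp R (basis_vec R b))" by (rule finite_subset) simp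
  ultimately show ?thesis by (auto simp: free_carrier_iff basis_vec_def)
qed

text \<open>Every element of a free module is built from zero by adding multiples of basis vectors,
  so linear conditions need to be checked on the basis only.\<close>

lemma free_induct [consumes 1, case_names zero step]:
  assumes "f \<in> carrier (free_module R B)"
    and zero: "P (\<lambda>b. \<zero>)"
    and step: "\<And>g b r. \<lbrakk>g \<in> carrier (free_module R B); P g; b \<in> B; r \<in> carrier R\<rbrakk>
      \<Longrightarrow> P (\<lambda>c. g c \<oplus> r \<otimes> basis_vec R b c)"
  shows "P f"
proof -
  have "finite S \<Longrightarrow> S \<subseteq> B \<Longrightarrow> f \<in> carrier (free_module R B) \<Longrightarrow> supp R f \<subseteq> S \<Longrightarrow> P f" for S f
  proof (induction S arbitrary: f rule: finite_induct)
    case empty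
    then have "f = (\<lambda>b. \<zero>)" by (auto simp: supp_def)
    then show ?case using zero by simp
  next
    case (insert b S)
    define g where "g = (\<lambda>c. if c = b then \<zero> else f c)"
    have sg: "supp R g \<subseteq> S" using insert.prems(3) by (auto simp: g_def supp_def)
    have g: "g \<in> carrier (free_module R B)"
      using insert.prems(2) finite_subset[OF sg insert.hyps(1)]
      by (auto simp: free_carrier_iff g_def)
    have fb: "f b \<in> carrier R" using insert.prems(2) by (rule free_carrierD)
    have "P (\<lambda>c. g c \<oplus> f b \<otimes> basis_vec R b c)"
      using insert.prems(1) by (intro step g insert.IH sg fb) auto
    also have "(\<lambda>c. g c \<oplus> f b \<otimes> basis_vec R b c) = f"
      using free_carrierD(1)[OF insert.prems(2)] by (auto simp: g_def basis_vec_def fun_eq_iff)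
    finally show ?case .
  qed
  then show ?thesis
    using assms(1) free_carrierD(2,4)[OF assms(1)] by blast
qed

lemma lin_ext_superset:
  assumes "module R M" "f \<in> carrier (free_module R B)" "v \<in> B \<rightarrow> carrier M"
    and "finite S" "supp R f \<subseteq> S" "S \<subseteq> B"
  shows "lin_ext R M v f = (\<Oplus>\<^bsub>M\<^esub>b\<in>S. f b \<odot>\<^bsub>M\<^esub> v b)"
proof -
  interpret M: module R M by fact
  have v: "v b \<in> carrier M" if "b \<in> S" for b
    using that assms(3,6) by auto
  show ?thesis
    unfolding lin_ext_def
  proof (rule M.add.finprod_mono_neutral_cong_left[OF assms(4,5)])
    fix b assume "b \<in> S - supp R f"
    then show "f b \<odot>\<^bsub>M\<^esub> v b = \<zero>\<^bsub>M\<^esub>"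
      using v by (simp add: supp_def)
  qed (use v free_carrierD(1)[OF assms(2)] in auto)
qed

lemma lin_ext_hom:
  assumes M: "module R M" and v: "v \<in> B \<rightarrow> carrier M"
  shows "lin_ext R M v \<in> module_homs R (free_module R B) M"
proof -
  interpret M: module R M by fact
  have vc: "f b \<odot>\<^bsub>M\<^esub> v b \<in> carrier M"
    if "f \<in> carrier (free_module R B)" "S \<subseteq> B" "b \<in> S" for f S b
    using that v free_carrierD(1)[OF that(1), of b] by auto
  show ?thesis
  proof (rule module_homsI)
    fix f assume f: "f \<in> carrier (free_module R B)"
    show "lin_ext R M v f \<in> carrier M"
      unfolding lin_ext_def using vc[OF f free_carrierD(4)[OF f]]
      by (intro M.add.finprod_closed) auto
    fix g assume g: "g \<in> carrier (free_module R B)"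
    let ?S = "supp R f \<union> supp R g"
    have S: "finite ?S" "?S \<subseteq> B" using free_carrierD[OF f] free_carrierD[OF g] by auto
    have "lin_ext R M v (\<lambda>b. f b \<oplus> g b) = (\<Oplus>\<^bsub>M\<^esub>b\<in>?S. (f b \<oplus> g b) \<odot>\<^bsub>M\<^esub> v b)"
      by (rule lin_ext_superset[OF M free_add_closed[OF f g] v S(1) supp_add S(2)])
    also have "\<dots> = (\<Oplus>\<^bsub>M\<^esub>b\<in>?S. f b \<odot>\<^bsub>M\<^esub> v b \<oplus>\<^bsub>M\<^esub> g b \<odot>\<^bsub>M\<^esub> v b)"
    proof (rule M.add.finprod_cong')
      fix b assume "b \<in> ?S"
      then show "(f b \<oplus> g b) \<odot>\<^bsub>M\<^esub> v b = f b \<odot>\<^bsub>M\<^esub> v b \<oplus>\<^bsub>M\<^esub> g b \<odot>\<^bsub>M\<^esub> v b"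
        using S v by (intro M.smult_l_distr free_carrierD(1)[OF f] free_carrierD(1)[OF g]) auto
    qed (use vc[OF f S(2)] vc[OF g S(2)] in auto)
    also have "\<dots> = (\<Oplus>\<^bsub>M\<^esub>b\<in>?S. f b \<odot>\<^bsub>M\<^esub> v b) \<oplus>\<^bsub>M\<^esub> (\<Oplus>\<^bsub>M\<^esub>b\<in>?S. g b \<odot>\<^bsub>M\<^esub> v b)"
      using vc[OF f S(2)] vc[OF g S(2)] by (intro M.add.finprod_multf) auto
    also have "\<dots> = lin_ext R M v f \<oplus>\<^bsub>M\<^esub> lin_ext R M v g"
      using lin_ext_superset[OF M f v S(1) _ S(2)] lin_ext_superset[OF M g v S(1) _ S(2)] by simp
    finally show "lin_ext R M v (f \<oplus>\<^bsub>free_module R B\<^esub> g) = lin_ext R M v f \<oplus>\<^bsub>M\<^esub> lin_ext R M v g"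
      by simp
  next
    fix r f assume r: "r \<in> carrier R" and f: "f \<in> carrier (free_module R B)"
    let ?S = "supp R f"
    have S: "finite ?S" "?S \<subseteq> B" using free_carrierD[OF f] by auto
    have "lin_ext R M v (\<lambda>b. r \<otimes> f b) = (\<Oplus>\<^bsub>M\<^esub>b\<in>?S. (r \<otimes> f b) \<odot>\<^bsub>M\<^esub> v b)"
      by (rule lin_ext_superset[OF M free_smult_closed[OF r f] v S(1) supp_smult[OF r] S(2)])
    also have "\<dots> = (\<Oplus>\<^bsub>M\<^esub>b\<in>?S. r \<odot>\<^bsub>M\<^esub> (f b \<odot>\<^bsub>M\<^esub> v b))"
    proof (rule M.add.finprod_cong')
      fix b assume "b \<in> ?S"
      then show "(r \<otimes> f b) \<odot>\<^bsub>M\<^esub> v b = r \<odot>\<^bsub>M\<^esub> (f b \<odot>\<^bsub>M\<^esub> v b)"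
        using S v by (intro M.smult_assoc1 r free_carrierD(1)[OF f]) auto
    qed (use vc[OF f S(2)] r in auto)
    also have "\<dots> = r \<odot>\<^bsub>M\<^esub> lin_ext R M v f"
      unfolding lin_ext_def
      using vc[OF f S(2)] by (intro M.finsum_smult_ldistr[OF S(1) r, symmetric]) auto
    finally show "lin_ext R M v (r \<odot>\<^bsub>free_module R B\<^esub> f) = r \<odot>\<^bsub>M\<^esub> lin_ext R M v f"
      by simp
  qed
qed

lemma lin_ext_basis_vec:
  assumes M: "module R M" and v: "v b \<in> carrier M"
  shows "lin_ext R M v (basis_vec R b) = v b"
proof -
  interpret M: module R M by fact
  have "lin_ext R M v (basis_vec R b) = (\<Oplus>\<^bsub>M\<^esub>c\<in>{b}. basis_vec R b c \<odot>\<^bsub>M\<^esub> v c)"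
    using v by (intro lin_ext_superset[OF M basis_vec_closed[of b "{b}"]])
      (auto simp: supp_def basis_vec_def)
  also have "\<dots> = v b"
    using v by (simp add: basis_vec_def)
  finally show ?thesis .
qed

lemma hom_eq_on_basis:
  assumes f: "f \<in> module_homs R (free_module R B) M" and g: "g \<in> module_homs R (free_module R B) M"
    and M: "module R M" and "\<And>b. b \<in> B \<Longrightarrow> f (basis_vec R b) = g (basis_vec R b)"
    and "x \<in> carrier (free_module R B)"
  shows "f x = g x"
  using assms(5)
proof (induction rule: free_induct)
  case zero
  then show ?case
    using hom_zero[OF f module_free_module M] hom_zero[OF g module_free_module M] by simp
next
  case (step h b r)
  note b = basis_vec_closed[OF step.hyps(2)]
  note rb = free_smult_closed[OF step.hyps(3) b]
  have "f (\<lambda>c. h c \<oplus> r \<otimes> basis_vec R b c) = f h \<oplus>\<^bsub>M\<^esub> r \<odot>\<^bsub>M\<^esub> f (basis_vec R b)"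
    using hom_add[OF f step.hyps(1) rb] hom_smult[OF f step.hyps(3) b] by simp
  also have "\<dots> = g h \<oplus>\<^bsub>M\<^esub> r \<odot>\<^bsub>M\<^esub> g (basis_vec R b)"
    using step.IH assms(4)[OF step.hyps(2)] by simp
  also have "\<dots> = g (\<lambda>c. h c \<oplus> r \<otimes> basis_vec R b c)"
    using hom_add[OF g step.hyps(1) rb] hom_smult[OF g step.hyps(3) b] by simp
  finally show ?case .
qed

text \<open>All free modules are submodules of the one on all of the type, which is the codomain
  used in the definition of maps between free modules.\<close>

lemma lin_ext_free_hom:
  assumes "v \<in> B \<rightarrow> carrier (free_module R C)"
  shows "lin_ext R (free_module R UNIV) v \<in> module_homs R (free_module R B) (free_module R C)"
proof -
  have v: "v \<in> B \<rightarrow> carrier (free_module R UNIV)"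
    using assms free_module_mono[of C UNIV R] by auto
  note h = lin_ext_hom[OF module_free_module v]
  have "lin_ext R (free_module R UNIV) v x \<in> carrier (free_module R C)"
    if "x \<in> carrier (free_module R B)" for x
    using that
  proof (induction rule: free_induct)
    case zero
    then show ?case
      using hom_zero[OF h module_free_module module_free_module] free_zero_closed by simp
  next
    case (step g b r)
    note b = basis_vec_closed[OF step.hyps(2)]
    have "lin_ext R (free_module R UNIV) v (basis_vec R b) = v b"
      using v step.hyps(2) by (intro lin_ext_basis_vec[OF module_free_module]) auto
    then show ?case
      using hom_add[OF h step.hyps(1) free_smult_closed[OF step.hyps(3) b]] hom_smult[OF h step.hyps(3) b] step.IH step.hyps(3)
        assms step.hyps(2)
      by (simp add: free_add_closed free_smult_closed Pi_iff)
  qed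
  then show ?thesis
    using hom_add[OF h] hom_smult[OF h] by (intro module_homsI) simp_all
qed

lemma lin_ext_free_basis_vec:
  "v b \<in> carrier (free_module R C) \<Longrightarrow> lin_ext R (free_module R UNIV) v (basis_vec R b) = v b"
  using free_module_mono[of C UNIV R] by (intro lin_ext_basis_vec[OF module_free_module]) auto

lemma free_lift:
  assumes p: "p \<in> module_homs R A C" and surj: "p ` carrier A = carrier C"
    and g: "g \<in> module_homs R (free_module R B) C" and A: "module R A" and C: "module R C"
  obtains h where "h \<in> module_homs R (free_module R B) A"
    "\<And>x. x \<in> carrier (free_module R B) \<Longrightarrow> p (h x) = g x"
proof -
  have "\<forall>b\<in>B. \<exists>a. a \<in> carrier A \<and> p a = g (basis_vec R b)"
  proof
    fix b assume "b \<in> B"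
    then have "g (basis_vec R b) \<in> p ` carrier A"
      unfolding surj by (intro hom_closed[OF g] basis_vec_closed)
    then show "\<exists>a. a \<in> carrier A \<and> p a = g (basis_vec R b)" by auto
  qed
  then obtain v where v: "\<And>b. b \<in> B \<Longrightarrow> v b \<in> carrier A \<and> p (v b) = g (basis_vec R b)"
    by metis
  let ?h = "lin_ext R A v"
  have h: "?h \<in> module_homs R (free_module R B) A"
    using v by (intro lin_ext_hom A) auto
  have "p (?h x) = g x" if "x \<in> carrier (free_module R B)" for x
  proof (rule hom_eq_on_basis[OF hom_comp[OF h p] g C _ that])
    fix b assume "b \<in> B"
    then show "p (?h (basis_vec R b)) = g (basis_vec R b)"
      using v lin_ext_basis_vec[OF A, of v b] by simp
  qed
  with h show ?thesis by (rule that)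
qed

lemma free_cover_elements:
  assumes "module R P"
  shows "lin_ext R P (\<lambda>x. x) \<in> module_homs R (free_module R (carrier P)) P"
    and "x \<in> carrier P \<Longrightarrow> lin_ext R P (\<lambda>x. x) (basis_vec R x) = x"
  using lin_ext_hom[OF assms, of "\<lambda>x. x" "carrier P"] lin_ext_basis_vec[OF assms, of "\<lambda>x. x" x]
  by auto

text \<open>The lifting property in \<^const>\<open>projective_module\<close> is restricted to particular types. Those
  types contain the surjection from the free module on the elements of \<open>P\<close>, so \<open>P\<close> is a retract
  of a free module and the lifting property follows for all types.\<close>

lemma projective_lift:
  assumes P: "projective_module R P"
    and p: "p \<in> module_homs R A C" and surj: "p ` carrier A = carrier C"
    and g: "g \<in> module_homs R P C" and A: "module R A" and C: "module R C"
  obtains h where "h \<in> module_homs R P A" "\<And>x. x \<in> carrier P \<Longrightarrow> p (h x) = g x"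
proof -
  have mP: "module R P" using P by (simp add: projective_module_def)
  let ?F = "free_module R (carrier P)" and ?q = "lin_ext R P (\<lambda>x. x)"
  note q = free_cover_elements[OF mP]
  have q_surj: "?q ` carrier ?F = carrier P"
  proof
    show "?q ` carrier ?F \<subseteq> carrier P" using hom_closed[OF q(1)] by blast
    show "carrier P \<subseteq> ?q ` carrier ?F"
      using q(2) basis_vec_closed[of _ "carrier P"] by (metis image_eqI subsetI)
  qed
  have "\<exists>s\<in>module_homs R P ?F. \<forall>x\<in>carrier P. ?q (s x) = x"
    using P module_free_module mP q(1) q_surj hom_id unfolding projective_module_def by blast
  then obtain s where s: "s \<in> module_homs R P ?F" "\<And>x. x \<in> carrier P \<Longrightarrow> ?q (s x) = x" by blast
  obtain k where k: "k \<in> module_homs R ?F A" "\<And>x. x \<in> carrier ?F \<Longrightarrow> p (k x) = g (?q x)"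
    using free_lift[OF p surj hom_comp[OF q(1) g] A C] by blast
  show ?thesis
  proof (rule that)
    show "(\<lambda>x. k (s x)) \<in> module_homs R P A" by (rule hom_comp[OF s(1) k(1)])
    show "p (k (s x)) = g x" if "x \<in> carrier P" for x
      using k(2)[OF hom_closed[OF s(1) that]] s(2)[OF that] by simp
  qed
qed

lemma fin_gen_free_cover:
  assumes M: "module R M" and "fin_gen_module R M"
  obtains k :: nat and p where "p \<in> module_homs R (free_module R {..<k}) M"
    "p ` carrier (free_module R {..<k}) = carrier M"
proof -
  interpret M: module R M by fact
  obtain A where A: "A \<subseteq> carrier M" "finite A" "module_span R M A = carrier M"
    using assms(2) unfolding fin_gen_module_def by blast
  obtain v :: "nat \<Rightarrow> 'c" and k where v: "A = v ` {..<k}"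
    using finite_imp_nat_seg_image_inj_on[OF A(2)] by (auto simp: lessThan_def)
  let ?p = "lin_ext R M v"
  have p: "?p \<in> module_homs R (free_module R {..<k}) M"
    using A(1) v by (intro lin_ext_hom M) auto
  have "A \<subseteq> ?p ` carrier (free_module R {..<k})"
  proof
    fix a assume "a \<in> A"
    then obtain i where i: "i < k" "a = v i" using v by auto
    then have "a = ?p (basis_vec R i)"
      using \<open>a \<in> A\<close> A(1) by (intro lin_ext_basis_vec[OF M, symmetric, THEN trans[rotated]]) auto
    then show "a \<in> ?p ` carrier (free_module R {..<k})"
      using basis_vec_closed[of i "{..<k}"] i(1) by auto
  qed
  then have "carrier M \<subseteq> ?p ` carrier (free_module R {..<k})"
    using M.span_minimal[OF hom_image_submodule[OF p module_free_module M]] A(3) by blast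
  moreover have "?p ` carrier (free_module R {..<k}) \<subseteq> carrier M"
    using hom_closed[OF p] by blast
  ultimately show ?thesis using p that by blast
qed

lemma fin_gen_free_module:
  assumes "finite B"
  shows "fin_gen_module R (free_module R B)"
proof -
  interpret F: module R "free_module R B" by (rule module_free_module)
  let ?A = "basis_vec R ` B"
  have A: "?A \<subseteq> carrier (free_module R B)" using basis_vec_closed by auto
  note S = F.span_submodule[OF A]
  have "x \<in> module_span R (free_module R B) ?A" if "x \<in> carrier (free_module R B)" for x
    using that
  proof (induction rule: free_induct)
    case zero
    then show ?case using submodule_zero[OF S] by simp
  next
    case (step g b r)
    then have "basis_vec R b \<in> module_span R (free_module R B) ?A"
      using F.span_superset[of ?A] by auto
    from submodule_add[OF S step.IH submodule_smult[OF S step.hyps(3) this]] show ?case by simp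
  qed
  then show ?thesis
    using assms A by (intro F.fin_gen_moduleI[of ?A]) auto
qed

end

lemma ring_module_simps [simp]:
  "carrier (ring_module R) = carrier R"
  "x \<oplus>\<^bsub>ring_module R\<^esub> y = x \<oplus>\<^bsub>R\<^esub> y"
  "x \<odot>\<^bsub>ring_module R\<^esub> y = x \<otimes>\<^bsub>R\<^esub> y"
  "\<zero>\<^bsub>ring_module R\<^esub> = \<zero>\<^bsub>R\<^esub>"
  by (simp_all add: ring_module_def)

lemma (in cring) module_ring_module: "module R (ring_module R)"
  by (rule moduleI_zero_smult) (auto simp: a_ac l_distr r_distr m_assoc)


section \<open>The standard resolution as a functor\<close>

text \<open>A function is recovered from its graph over the support because it vanishes elsewhere.\<close>

lemma unsyz_syz:
  assumes "finite (supp R f)"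
  shows "unsyz R (syz R f) = f"
proof -
  have "inj_on (syz R :: (('a, 'm) cell \<Rightarrow> 'a) \<Rightarrow> ('a, 'm) cell) {f. finite (supp R f)}"
  proof (rule inj_onI)
    fix f g :: "('a, 'm) cell \<Rightarrow> 'a"
    assume "f \<in> {f. finite (supp R f)}" "g \<in> {f. finite (supp R f)}" "syz R f = syz R g"
    then have eq: "(\<lambda>b. (b, f b)) ` supp R f = (\<lambda>b. (b, g b)) ` supp R g"
      unfolding syz_def by (simp add: Abs_fset_inject)
    show "f = g"
    proof
      fix b
      have "f b = g b" if "f b \<noteq> \<zero>\<^bsub>R\<^esub>"
      proof -
        have "(b, f b) \<in> (\<lambda>b. (b, g b)) ` supp R g"
          unfolding eq[symmetric] using that by (auto simp: supp_def)
        then show ?thesis by auto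
      qed
      moreover have "f b = g b" if "g b \<noteq> \<zero>\<^bsub>R\<^esub>"
      proof -
        have "(b, g b) \<in> (\<lambda>b. (b, f b)) ` supp R f"
          unfolding eq using that by (auto simp: supp_def)
        then show ?thesis by auto
      qed
      ultimately show "f b = g b" by metis
    qed
  qed
  then show ?thesis
    unfolding unsyz_def using assms by (intro inv_into_f_f) auto
qed

context cring
begin

lemma module_std_res: "module R (std_res R M k)"
  unfolding std_res_def by (rule module_free_module)

lemma std_hom_eq_on_basis:
  assumes "f \<in> module_homs R (std_res R M k) N" "g \<in> module_homs R (std_res R M k) N" "module R N"
    and "\<And>b. b \<in> std_basis R M k \<Longrightarrow> f (basis_vec R b) = g (basis_vec R b)"
    and "x \<in> carrier (std_res R M k)"
  shows "f x = g x"
  using assms unfolding std_res_def by (rule hom_eq_on_basis)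

lemma std_basis_Suc_cases:
  assumes "b \<in> std_basis R M (Suc k)"
  obtains f where "b = syz R f" "unsyz R b = f" "f \<in> carrier (std_res R M k)"
    "if k = 0 then augm R M f = \<zero>\<^bsub>M\<^esub> else bdry R f = (\<lambda>b. \<zero>)"
proof -
  from assms obtain f where f: "b = syz R f" "f \<in> carrier (std_res R M k)"
    "if k = 0 then augm R M f = \<zero>\<^bsub>M\<^esub> else bdry R f = (\<lambda>b. \<zero>)"
    by (auto simp: std_res_def)
  then show ?thesis
    using that unsyz_syz[of R f] free_carrierD(2)[of f R "std_basis R M k"]
    by (simp add: std_res_def)
qed

lemma std_basis_SucI:
  assumes "f \<in> carrier (std_res R M k)"
    and "if k = 0 then augm R M f = \<zero>\<^bsub>M\<^esub> else bdry R f = (\<lambda>b. \<zero>)"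
  shows "syz R f \<in> std_basis R M (Suc k)"
  using assms unfolding std_res_def std_basis.simps by (intro imageI CollectI conjI)

lemma augm_hom: "module R M \<Longrightarrow> augm R M \<in> module_homs R (std_res R M 0) M"
  unfolding augm_def std_res_def by (rule lin_ext_hom) auto

lemma augm_basis_vec: "module R M \<Longrightarrow> m \<in> carrier M \<Longrightarrow> augm R M (basis_vec R (Gen m)) = m"
  unfolding augm_def using lin_ext_basis_vec[of M ungen "Gen m"] by simp

lemma bdry_hom: "bdry R \<in> module_homs R (std_res R M (Suc k)) (std_res R M k)"
  unfolding bdry_def std_res_def[of R M "Suc k"] std_res_def[of R M k]
proof (rule lin_ext_free_hom, rule Pi_I)
  fix b assume "b \<in> std_basis R M (Suc k)"
  then show "unsyz R b \<in> carrier (free_module R (std_basis R M k))"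
    by (rule std_basis_Suc_cases) (simp add: std_res_def)
qed

lemma bdry_basis_vec:
  assumes "b \<in> std_basis R M (Suc k)"
  shows "bdry R (basis_vec R b) = unsyz R b"
  using assms
proof (rule std_basis_Suc_cases)
  fix f assume f: "unsyz R b = f" "f \<in> carrier (std_res R M k)"
  show ?thesis
    unfolding bdry_def
    by (rule lin_ext_free_basis_vec) (use f in \<open>simp add: std_res_def\<close>)
qed

lemma zero_std_res: "\<zero>\<^bsub>std_res R M k\<^esub> = (\<lambda>b. \<zero>)"
  by (simp add: std_res_def)

text \<open>A basis element of degree \<open>k + 2\<close> stands for a cycle of degree \<open>k + 1\<close>, which is its boundary.\<close>

lemma bdry_bdry:
  assumes "x \<in> carrier (std_res R M (Suc (Suc k)))"
  shows "bdry R (bdry R x) = \<zero>\<^bsub>std_res R M k\<^esub>"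
proof (rule std_hom_eq_on_basis[OF hom_comp[OF bdry_hom bdry_hom] hom_zero_map[OF module_std_res]
      module_std_res _ assms])
  fix b :: "('a, 'c) cell" assume b: "b \<in> std_basis R M (Suc (Suc k))"
  then show "bdry R (bdry R (basis_vec R b)) = \<zero>\<^bsub>std_res R M k\<^esub>"
    unfolding bdry_basis_vec[OF b] zero_std_res by (rule std_basis_Suc_cases) simp
qed

lemma std_map_hom_aux:
  assumes "\<And>b. b \<in> std_basis R M k \<Longrightarrow> cell_map R h k b \<in> std_basis R M' k"
  shows "std_map R h k \<in> module_homs R (std_res R M k) (std_res R M' k)"
    and "b \<in> std_basis R M k \<Longrightarrow> std_map R h k (basis_vec R b) = basis_vec R (cell_map R h k b)"
proof -
  show "std_map R h k \<in> module_homs R (std_res R M k) (std_res R M' k)"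
    unfolding std_map_def free_map_def std_res_def
    using assms by (intro lin_ext_free_hom) (auto intro: basis_vec_closed)
  show "std_map R h k (basis_vec R b) = basis_vec R (cell_map R h k b)" if "b \<in> std_basis R M k"
    unfolding std_map_def free_map_def
    by (rule lin_ext_free_basis_vec) (rule basis_vec_closed[OF assms[OF that]])
qed

lemma unsyz_cell_map:
  assumes cm: "\<And>b. b \<in> std_basis R M k \<Longrightarrow> cell_map R h k b \<in> std_basis R M' k"
    and b: "b \<in> std_basis R M (Suc k)"
  shows "unsyz R (cell_map R h (Suc k) b) = std_map R h k (unsyz R b)"
  using b
proof (rule std_basis_Suc_cases)
  fix f assume f: "unsyz R b = f" "f \<in> carrier (std_res R M k)"
  have "std_map R h k f \<in> carrier (std_res R M' k)"
    by (rule hom_closed[OF std_map_hom_aux(1)[OF cm] f(2)])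
  then show ?thesis
    using f(1) by (simp add: std_map_def[symmetric] unsyz_syz free_carrierD(2) std_res_def)
qed

lemma bdry_std_map_aux:
  assumes cm: "\<And>b. b \<in> std_basis R M k \<Longrightarrow> cell_map R h k b \<in> std_basis R M' k"
    and cm': "\<And>b. b \<in> std_basis R M (Suc k) \<Longrightarrow> cell_map R h (Suc k) b \<in> std_basis R M' (Suc k)"
    and x: "x \<in> carrier (std_res R M (Suc k))"
  shows "bdry R (std_map R h (Suc k) x) = std_map R h k (bdry R x)"
proof (rule std_hom_eq_on_basis[OF hom_comp[OF std_map_hom_aux(1)[OF cm'] bdry_hom]
      hom_comp[OF bdry_hom std_map_hom_aux(1)[OF cm]] module_std_res _ x])
  fix b :: "('a, 'c) cell" assume b: "b \<in> std_basis R M (Suc k)"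
  show "bdry R (std_map R h (Suc k) (basis_vec R b)) = std_map R h k (bdry R (basis_vec R b))"
    by (simp only: std_map_hom_aux(2)[OF cm' b] bdry_basis_vec[OF b] bdry_basis_vec[OF cm'[OF b]]
        unsyz_cell_map[OF cm b])
qed

text \<open>That cells go to cells and that boundaries commute with the induced maps depend on each
  other: a cell of degree \<open>k + 1\<close> stands for a cycle of degree \<open>k\<close>, and the image of this cycle
  is a cycle by the chain map property one degree below. For \<open>k = 0\<close> the augmentation takes the
  place of the boundary. Hence the induction carries two consecutive degrees.\<close>

lemma cell_map_closed:
  assumes M: "module R M" and M': "module R M'" and h: "h \<in> module_homs R M M'"
  shows "b \<in> std_basis R M k \<Longrightarrow> cell_map R h k b \<in> std_basis R M' k"
proof -
  let ?P = "\<lambda>k. \<forall>b\<in>std_basis R M k. cell_map R h k b \<in> std_basis R M' k"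
  have step: "?P (Suc k)"
    if P: "?P k" and cycle: "\<And>f. \<lbrakk>f \<in> carrier (std_res R M k);
        if k = 0 then augm R M f = \<zero>\<^bsub>M\<^esub> else bdry R f = (\<lambda>b. \<zero>)\<rbrakk> \<Longrightarrow>
        if k = 0 then augm R M' (std_map R h k f) = \<zero>\<^bsub>M'\<^esub> else bdry R (std_map R h k f) = (\<lambda>b. \<zero>)" for k
  proof
    fix b assume "b \<in> std_basis R M (Suc k)"
    then obtain f where f: "unsyz R b = f" "f \<in> carrier (std_res R M k)"
      "if k = 0 then augm R M f = \<zero>\<^bsub>M\<^esub> else bdry R f = (\<lambda>b. \<zero>)"
      by (rule std_basis_Suc_cases)
    have "std_map R h k f \<in> carrier (std_res R M' k)"
      using P by (intro hom_closed[OF std_map_hom_aux(1) f(2)]) blast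
    then have "syz R (std_map R h k f) \<in> std_basis R M' (Suc k)"
      by (rule std_basis_SucI[OF _ cycle[OF f(2,3)]])
    then show "cell_map R h (Suc k) b \<in> std_basis R M' (Suc k)"
      by (simp only: cell_map.simps f(1) std_map_def)
  qed
  have P0: "?P 0"
    using hom_closed[OF h] by auto
  have augm: "augm R M' (std_map R h 0 f) = h (augm R M f)" if "f \<in> carrier (std_res R M 0)" for f
  proof (rule std_hom_eq_on_basis[OF hom_comp[OF std_map_hom_aux(1) augm_hom[OF M']]
        hom_comp[OF augm_hom[OF M] h] M' _ that])
    show "cell_map R h 0 b \<in> std_basis R M' 0" if "b \<in> std_basis R M 0" for b
      using P0 that by blast
    fix b assume b: "b \<in> std_basis R M 0"
    then obtain m where m: "m \<in> carrier M" "b = Gen m" by auto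
    have "std_map R h 0 (basis_vec R b) = basis_vec R (cell_map R h 0 b)"
      using P0 by (intro std_map_hom_aux(2)[OF _ b]) blast
    then show "augm R M' (std_map R h 0 (basis_vec R b)) = h (augm R M (basis_vec R b))"
      using m hom_closed[OF h m(1)] by (simp add: augm_basis_vec[OF M] augm_basis_vec[OF M'])
  qed
  have "?P k \<and> ?P (Suc k)" for k
  proof (induction k)
    case 0
    have "?P (Suc 0)"
      using augm hom_zero[OF h M M'] by (intro step P0) simp
    with P0 show ?case by blast
  next
    case (Suc k)
    have "?P (Suc (Suc k))"
    proof (rule step)
      show "?P (Suc k)" using Suc by blast
      fix f assume f: "f \<in> carrier (std_res R M (Suc k))"
        "if Suc k = 0 then augm R M f = \<zero>\<^bsub>M\<^esub> else bdry R f = (\<lambda>b. \<zero>)"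
      have "std_map R h k \<in> module_homs R (std_res R M k) (std_res R M' k)"
        using Suc by (intro std_map_hom_aux(1)) blast
      from hom_zero[OF this module_std_res module_std_res]
      have "bdry R (std_map R h (Suc k) f) = (\<lambda>b. \<zero>)"
        using f bdry_std_map_aux[of M k h M' f] Suc by (simp add: zero_std_res del: cell_map.simps std_basis.simps)
      then show "if Suc k = 0 then augm R M' (std_map R h (Suc k) f) = \<zero>\<^bsub>M'\<^esub>
          else bdry R (std_map R h (Suc k) f) = (\<lambda>b. \<zero>)" by simp
    qed
    with Suc show ?case by blast
  qed
  then show "b \<in> std_basis R M k \<Longrightarrow> cell_map R h k b \<in> std_basis R M' k" by blast
qed

lemma std_map_hom:
  assumes "module R M" "module R M'" "h \<in> module_homs R M M'"
  shows "std_map R h k \<in> module_homs R (std_res R M k) (std_res R M' k)"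
  by (rule std_map_hom_aux(1)[OF cell_map_closed[OF assms]])

lemma std_map_basis_vec:
  assumes "module R M" "module R M'" "h \<in> module_homs R M M'" "b \<in> std_basis R M k"
  shows "std_map R h k (basis_vec R b) = basis_vec R (cell_map R h k b)"
  by (rule std_map_hom_aux(2)[OF cell_map_closed[OF assms(1-3)] assms(4)])

lemma bdry_std_map:
  assumes "module R M" "module R M'" "h \<in> module_homs R M M'" "x \<in> carrier (std_res R M (Suc k))"
  shows "bdry R (std_map R h (Suc k) x) = std_map R h k (bdry R x)"
  by (rule bdry_std_map_aux[OF cell_map_closed[OF assms(1-3)] cell_map_closed[OF assms(1-3)] assms(4)])

text \<open>Homomorphisms out of a free module agree if they agree on cells, and the value of \<open>cell_map\<close> on
  a cell of degree \<open>k + 1\<close> is the value of \<open>std_map\<close> on the chain of degree \<open>k\<close> that the cell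
  stands for; so functoriality climbs from one degree to the next.\<close>

lemma std_map_comp:
  assumes M: "module R M" and M': "module R M'" and M'': "module R M''"
    and h: "h \<in> module_homs R M M'" and h': "h' \<in> module_homs R M' M''"
    and h'': "h'' \<in> module_homs R M M''" and comp: "\<And>x. x \<in> carrier M \<Longrightarrow> h'' x = h' (h x)"
    and x: "x \<in> carrier (std_res R M k)"
  shows "std_map R h'' k x = std_map R h' k (std_map R h k x)"
proof -
  have from_cells: "std_map R h'' k x = std_map R h' k (std_map R h k x)"
    if cells: "\<And>b. b \<in> std_basis R M k \<Longrightarrow> cell_map R h'' k b = cell_map R h' k (cell_map R h k b)"
      and x: "x \<in> carrier (std_res R M k)" for k x
  proof (rule std_hom_eq_on_basis[OF std_map_hom[OF M M'' h'']
        hom_comp[OF std_map_hom[OF M M' h] std_map_hom[OF M' M'' h']] module_std_res _ x])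
    fix b assume b: "b \<in> std_basis R M k"
    show "std_map R h'' k (basis_vec R b) = std_map R h' k (std_map R h k (basis_vec R b))"
      by (simp only: std_map_basis_vec[OF M M'' h'' b] std_map_basis_vec[OF M M' h b]
          std_map_basis_vec[OF M' M'' h' cell_map_closed[OF M M' h b]] cells[OF b])
  qed
  have "b \<in> std_basis R M k \<Longrightarrow> cell_map R h'' k b = cell_map R h' k (cell_map R h k b)" for k b
  proof (induction k arbitrary: b)
    case 0
    then show ?case using comp by auto
  next
    case (Suc k)
    have "unsyz R b \<in> carrier (std_res R M k)"
      using Suc.prems by (rule std_basis_Suc_cases) simp
    from from_cells[OF Suc.IH this]
    have "cell_map R h'' (Suc k) b = syz R (std_map R h' k (std_map R h k (unsyz R b)))"
      by (simp add: std_map_def)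
    also have "\<dots> = cell_map R h' (Suc k) (cell_map R h (Suc k) b)"
      using unsyz_cell_map[OF cell_map_closed[OF M M' h] Suc.prems]
      by (simp add: std_map_def)
    finally show ?case .
  qed
  from from_cells[OF this x] show ?thesis .
qed

lemma std_map_id:
  assumes M: "module R M" and h: "\<And>x. x \<in> carrier M \<Longrightarrow> h x = x"
    and x: "x \<in> carrier (std_res R M k)"
  shows "std_map R h k x = x"
proof -
  have hh: "h \<in> module_homs R M M"
    by (rule hom_cong[OF hom_id M h])
  have from_cells: "std_map R h k x = x"
    if "\<And>b. b \<in> std_basis R M k \<Longrightarrow> cell_map R h k b = b" "x \<in> carrier (std_res R M k)" for k x
  proof (rule std_hom_eq_on_basis[OF std_map_hom[OF M M hh] hom_id module_std_res _ that(2)])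
    fix b assume b: "b \<in> std_basis R M k"
    show "std_map R h k (basis_vec R b) = basis_vec R b"
      by (simp only: std_map_basis_vec[OF M M hh b] that(1)[OF b])
  qed
  have "b \<in> std_basis R M k \<Longrightarrow> cell_map R h k b = b" for k b
  proof (induction k arbitrary: b)
    case 0
    then show ?case using h by auto
  next
    case (Suc k)
    from Suc.prems show ?case
    proof (rule std_basis_Suc_cases)
      fix f assume f: "b = syz R f" "unsyz R b = f" "f \<in> carrier (std_res R M k)"
      then show ?thesis
        using from_cells[OF Suc.IH f(3)] by (simp add: std_map_def)
    qed
  qed
  from from_cells[OF this x] show ?thesis .
qed

end


section \<open>Quotient modules\<close>

lemma a_r_coset_update: "H +>\<^bsub>M\<lparr>carrier := K\<rparr>\<^esub> x = H +>\<^bsub>M\<^esub> x"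
  by (simp add: a_r_coset_def')

context module
begin

lemma submodule_abelian_subgroup: "submodule H R M \<Longrightarrow> abelian_subgroup H M"
  by (intro abelian_subgroupI3 additive_subgroup.intro submodule.axioms(1)) (auto intro: M.abelian_group_axioms)

lemma coset_eq_iff:
  assumes H: "submodule H R M" and x: "x \<in> carrier M" and y: "y \<in> carrier M"
  shows "H +>\<^bsub>M\<^esub> x = H +>\<^bsub>M\<^esub> y \<longleftrightarrow> x \<ominus>\<^bsub>M\<^esub> y \<in> H"
proof -
  interpret H: abelian_subgroup H M by (rule submodule_abelian_subgroup[OF H])
  have "x \<in> H +>\<^bsub>M\<^esub> y \<longleftrightarrow> x \<ominus>\<^bsub>M\<^esub> y \<in> H"
    unfolding a_minus_def by (rule H.a_rcos_module[OF y x])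
  then show ?thesis
    using H.a_repr_independence'[OF _ y] H.a_rcos_self[OF x] by auto
qed

lemma coset_mem_iff:
  assumes H: "submodule H R M" and x: "x \<in> carrier M"
  shows "y \<in> H +>\<^bsub>M\<^esub> x \<longleftrightarrow> y \<in> carrier M \<and> H +>\<^bsub>M\<^esub> y = H +>\<^bsub>M\<^esub> x"
proof -
  interpret H: abelian_subgroup H M by (rule submodule_abelian_subgroup[OF H])
  show ?thesis
    using H.a_elemrcos_carrier[OF x, of y] H.a_repr_independence'[of y x] x H.a_rcos_self[of y]
    by metis
qed

lemma quot_carrier: "carrier (quot_module M H) = (\<lambda>x. H +>\<^bsub>M\<^esub> x) ` carrier M"
  by (auto simp: quot_module_def A_RCOSETS_def')

lemma quot_add:
  assumes "submodule H R M" "x \<in> carrier M" "y \<in> carrier M"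
  shows "(H +>\<^bsub>M\<^esub> x) \<oplus>\<^bsub>quot_module M H\<^esub> (H +>\<^bsub>M\<^esub> y) = H +>\<^bsub>M\<^esub> (x \<oplus>\<^bsub>M\<^esub> y)"
  using abelian_subgroup.a_rcos_sum[OF submodule_abelian_subgroup[OF assms(1)] assms(2,3)]
  by (simp add: quot_module_def)

lemma quot_zero:
  assumes "submodule H R M"
  shows "\<zero>\<^bsub>quot_module M H\<^esub> = H +>\<^bsub>M\<^esub> \<zero>\<^bsub>M\<^esub>"
  using M.a_coset_add_zero[OF submodule_carrier[OF assms]] by (simp add: quot_module_def)

text \<open>Scalar multiplication on a quotient and the maps between quotients are defined as unions over
  all representatives of a coset; this evaluates such a union at one representative.\<close>

lemma union_over_coset:
  assumes H: "submodule H R M" and x: "x \<in> carrier M"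
    and "\<And>y. \<lbrakk>y \<in> carrier M; y \<ominus>\<^bsub>M\<^esub> x \<in> H\<rbrakk> \<Longrightarrow> F y = F x"
  shows "(\<Union>y\<in>H +>\<^bsub>M\<^esub> x. F y) = F x"
proof -
  have F: "F y = F x" if "y \<in> H +>\<^bsub>M\<^esub> x" for y
  proof (rule assms(3))
    show y: "y \<in> carrier M" using that coset_mem_iff[OF H x, of y] by simp
    show "y \<ominus>\<^bsub>M\<^esub> x \<in> H" using that coset_mem_iff[OF H x, of y] coset_eq_iff[OF H y x] by simp
  qed
  have "x \<in> H +>\<^bsub>M\<^esub> x"
    using coset_mem_iff[OF H x, of x] x by simp
  then have "(\<Union>y\<in>H +>\<^bsub>M\<^esub> x. F x) = F x" by auto
  with F show ?thesis by simp
qed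

lemma quot_smult:
  assumes H: "submodule H R M" and r: "r \<in> carrier R" and x: "x \<in> carrier M"
  shows "r \<odot>\<^bsub>quot_module M H\<^esub> (H +>\<^bsub>M\<^esub> x) = H +>\<^bsub>M\<^esub> (r \<odot>\<^bsub>M\<^esub> x)"
proof -
  have "(\<Union>y\<in>H +>\<^bsub>M\<^esub> x. H +>\<^bsub>M\<^esub> (r \<odot>\<^bsub>M\<^esub> y)) = H +>\<^bsub>M\<^esub> (r \<odot>\<^bsub>M\<^esub> x)"
  proof (rule union_over_coset[OF H x])
    fix y assume y: "y \<in> carrier M" "y \<ominus>\<^bsub>M\<^esub> x \<in> H"
    have "r \<odot>\<^bsub>M\<^esub> y \<ominus>\<^bsub>M\<^esub> r \<odot>\<^bsub>M\<^esub> x = r \<odot>\<^bsub>M\<^esub> (y \<ominus>\<^bsub>M\<^esub> x)"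
      using y(1) x r by (simp add: a_minus_def smult_r_distr smult_r_minus)
    then have "r \<odot>\<^bsub>M\<^esub> y \<ominus>\<^bsub>M\<^esub> r \<odot>\<^bsub>M\<^esub> x \<in> H"
      using submodule_smult[OF H r y(2)] by simp
    then show "H +>\<^bsub>M\<^esub> (r \<odot>\<^bsub>M\<^esub> y) = H +>\<^bsub>M\<^esub> (r \<odot>\<^bsub>M\<^esub> x)"
      using coset_eq_iff[OF H] y(1) x r by simp
  qed
  then show ?thesis by (simp add: quot_module_def)
qed

lemma module_quot_module:
  assumes H: "submodule H R M"
  shows "module R (quot_module M H)"
proof (rule moduleI_zero_smult)
  show "\<zero>\<^bsub>quot_module M H\<^esub> \<in> carrier (quot_module M H)"
    unfolding quot_zero[OF H] quot_carrier by auto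
qed (auto simp: quot_carrier quot_zero[OF H] quot_add[OF H] quot_smult[OF H] M.a_ac
    smult_l_distr smult_r_distr smult_assoc1)

end

lemma quot_map:
  assumes M: "module R M" and N: "module R N" and \<phi>: "\<phi> \<in> module_homs R M N"
    and H: "submodule H R M" and K: "submodule K R N" and sub: "\<phi> ` H \<subseteq> K"
  shows quot_map_coset: "x \<in> carrier M \<Longrightarrow> (\<Union>y\<in>H +>\<^bsub>M\<^esub> x. K +>\<^bsub>N\<^esub> \<phi> y) = K +>\<^bsub>N\<^esub> \<phi> x"
    and quot_map_hom: "(\<lambda>X. \<Union>y\<in>X. K +>\<^bsub>N\<^esub> \<phi> y) \<in> module_homs R (quot_module M H) (quot_module N K)"
proof -
  interpret M: module R M by fact
  interpret N: module R N by fact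
  note \<phi>c = hom_closed[OF \<phi>]
  have coset: "(\<Union>y\<in>H +>\<^bsub>M\<^esub> x. K +>\<^bsub>N\<^esub> \<phi> y) = K +>\<^bsub>N\<^esub> \<phi> x" if x: "x \<in> carrier M" for x
  proof (rule M.union_over_coset[OF H x])
    fix y assume y: "y \<in> carrier M" "y \<ominus>\<^bsub>M\<^esub> x \<in> H"
    then have "\<phi> y \<ominus>\<^bsub>N\<^esub> \<phi> x \<in> K"
      using sub hom_minus[OF \<phi> M N y(1) x] by (metis image_subset_iff)
    then show "K +>\<^bsub>N\<^esub> \<phi> y = K +>\<^bsub>N\<^esub> \<phi> x"
      using N.coset_eq_iff[OF K \<phi>c[OF y(1)] \<phi>c[OF x]] by blast
  qed
  then show "x \<in> carrier M \<Longrightarrow> (\<Union>y\<in>H +>\<^bsub>M\<^esub> x. K +>\<^bsub>N\<^esub> \<phi> y) = K +>\<^bsub>N\<^esub> \<phi> x" .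
  show "(\<lambda>X. \<Union>y\<in>X. K +>\<^bsub>N\<^esub> \<phi> y) \<in> module_homs R (quot_module M H) (quot_module N K)"
  proof (rule module_homsI)
    fix X assume "X \<in> carrier (quot_module M H)"
    then obtain x where x: "x \<in> carrier M" "X = H +>\<^bsub>M\<^esub> x" by (auto simp: M.quot_carrier)
    show "(\<Union>y\<in>X. K +>\<^bsub>N\<^esub> \<phi> y) \<in> carrier (quot_module N K)"
      unfolding x(2) coset[OF x(1)] N.quot_carrier by (rule imageI[OF \<phi>c[OF x(1)]])
    fix Y assume "Y \<in> carrier (quot_module M H)"
    then obtain y where y: "y \<in> carrier M" "Y = H +>\<^bsub>M\<^esub> y" by (auto simp: M.quot_carrier)
    show "(\<Union>y\<in>X \<oplus>\<^bsub>quot_module M H\<^esub> Y. K +>\<^bsub>N\<^esub> \<phi> y) =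
        (\<Union>y\<in>X. K +>\<^bsub>N\<^esub> \<phi> y) \<oplus>\<^bsub>quot_module N K\<^esub> (\<Union>y\<in>Y. K +>\<^bsub>N\<^esub> \<phi> y)"
      unfolding x(2) y(2) M.quot_add[OF H x(1) y(1)] coset[OF x(1)] coset[OF y(1)]
        coset[OF M.M.a_closed[OF x(1) y(1)]] N.quot_add[OF K \<phi>c[OF x(1)] \<phi>c[OF y(1)]]
        hom_add[OF \<phi> x(1) y(1)] ..
  next
    fix r X assume r: "r \<in> carrier R" and "X \<in> carrier (quot_module M H)"
    then obtain x where x: "x \<in> carrier M" "X = H +>\<^bsub>M\<^esub> x" by (auto simp: M.quot_carrier)
    show "(\<Union>y\<in>r \<odot>\<^bsub>quot_module M H\<^esub> X. K +>\<^bsub>N\<^esub> \<phi> y) =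
        r \<odot>\<^bsub>quot_module N K\<^esub> (\<Union>y\<in>X. K +>\<^bsub>N\<^esub> \<phi> y)"
      unfolding x(2) M.quot_smult[OF H r x(1)] coset[OF x(1)] coset[OF M.smult_closed[OF r x(1)]]
        N.quot_smult[OF K r \<phi>c[OF x(1)]] hom_smult[OF \<phi> r x(1)] ..
  qed
qed


section \<open>Direct limits\<close>

locale direct_system = cring R for R (structure) +
  fixes G :: "nat \<Rightarrow> ('a, 'e, 'k) module_scheme" and t :: "nat \<Rightarrow> nat \<Rightarrow> 'e \<Rightarrow> 'e"
  assumes module_G: "module R (G n)"
    and t_hom: "n \<le> m \<Longrightarrow> t n m \<in> module_homs R (G n) (G m)"
    and t_refl: "x \<in> carrier (G n) \<Longrightarrow> t n n x = x"
    and t_trans: "\<lbrakk>n \<le> m; m \<le> k; x \<in> carrier (G n)\<rbrakk> \<Longrightarrow> t m k (t n m x) = t n k x"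
begin

lemma G_zero_closed: "\<zero>\<^bsub>G n\<^esub> \<in> carrier (G n)"
  and G_add_closed: "\<lbrakk>x \<in> carrier (G n); y \<in> carrier (G n)\<rbrakk> \<Longrightarrow> x \<oplus>\<^bsub>G n\<^esub> y \<in> carrier (G n)"
proof -
  interpret Gn: module R "G n" by (rule module_G)
  show "\<zero>\<^bsub>G n\<^esub> \<in> carrier (G n)" by (rule Gn.M.zero_closed)
  show "\<lbrakk>x \<in> carrier (G n); y \<in> carrier (G n)\<rbrakk> \<Longrightarrow> x \<oplus>\<^bsub>G n\<^esub> y \<in> carrier (G n)"
    by (rule Gn.M.a_closed)
qed

lemma lim_class_eq_iff:
  assumes x: "x \<in> carrier (G n)" and y: "y \<in> carrier (G m)"
  shows "lim_class G t n x = lim_class G t m y \<longleftrightarrow> (\<exists>k. n \<le> k \<and> m \<le> k \<and> t n k x = t m k y)"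
proof
  assume eq: "lim_class G t n x = lim_class G t m y"
  have "(m, y) \<in> lim_class G t n x"
    unfolding eq using y by (auto simp: lim_class_def)
  then show "\<exists>k. n \<le> k \<and> m \<le> k \<and> t n k x = t m k y"
    by (auto simp: lim_class_def)
next
  have sub: "lim_class G t n x \<subseteq> lim_class G t m y"
    if x: "x \<in> carrier (G n)" and y: "y \<in> carrier (G m)"
      and k: "n \<le> k" "m \<le> k" "t n k x = t m k y" for n m k x y
  proof
    fix p assume "p \<in> lim_class G t n x"
    then obtain l z k' where p: "p = (l, z)" and z: "z \<in> carrier (G l)"
      and k': "n \<le> k'" "l \<le> k'" "t n k' x = t l k' z"
      by (auto simp: lim_class_def)
    let ?K = "max k k'"
    have "t m ?K y = t k ?K (t m k y)" using t_trans[of m k ?K y] k y by simp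
    also have "\<dots> = t n ?K x" using t_trans[of n k ?K x] k x by simp
    also have "\<dots> = t k' ?K (t n k' x)" using t_trans[of n k' ?K x] k' x by simp
    also have "\<dots> = t l ?K z" using t_trans[of l k' ?K z] k' z by simp
    finally show "p \<in> lim_class G t m y"
      using k(2) k'(2) z unfolding p lim_class_def by (auto intro!: exI[of _ ?K])
  qed
  assume "\<exists>k. n \<le> k \<and> m \<le> k \<and> t n k x = t m k y"
  then obtain k where "n \<le> k" "m \<le> k" "t n k x = t m k y" by blast
  then show "lim_class G t n x = lim_class G t m y"
    using sub[OF x y, of k] sub[OF y x, of k] by auto
qed

lemma lim_class_transition:
  assumes "n \<le> k" "x \<in> carrier (G n)"
  shows "lim_class G t n x = lim_class G t k (t n k x)"
proof -
  have "t n k x \<in> carrier (G k)" by (rule hom_closed[OF t_hom[OF assms(1)] assms(2)])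
  then show ?thesis
    using assms by (subst lim_class_eq_iff) (auto intro!: exI[of _ k] simp: t_refl)
qed

lemma lim_class_self: "x \<in> carrier (G n) \<Longrightarrow> (n, x) \<in> lim_class G t n x"
  by (auto simp: lim_class_def)

lemma lim_class_memD:
  assumes "(m, y) \<in> lim_class G t n x" "x \<in> carrier (G n)"
  shows "y \<in> carrier (G m)" "lim_class G t m y = lim_class G t n x"
proof -
  show y: "y \<in> carrier (G m)" using assms(1) by (auto simp: lim_class_def)
  obtain k where "n \<le> k" "m \<le> k" "t n k x = t m k y"
    using assms(1) by (auto simp: lim_class_def)
  then have "lim_class G t n x = lim_class G t m y"
    unfolding lim_class_eq_iff[OF assms(2) y] by blast
  then show "lim_class G t m y = lim_class G t n x" ..
qed

lemma direct_lim_carrier: "carrier (direct_lim G t) = (\<Union>n. lim_class G t n ` carrier (G n))"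
  by (simp add: direct_lim_def)

lemma lim_class_closed: "x \<in> carrier (G n) \<Longrightarrow> lim_class G t n x \<in> carrier (direct_lim G t)"
  by (auto simp: direct_lim_carrier)

lemma lim_class_add:
  assumes x: "x \<in> carrier (G n)" and y: "y \<in> carrier (G n)"
  shows "lim_class G t n x \<oplus>\<^bsub>direct_lim G t\<^esub> lim_class G t n y = lim_class G t n (x \<oplus>\<^bsub>G n\<^esub> y)"
proof -
  let ?f = "\<lambda>a x' b y'. lim_class G t (max a b) (t a (max a b) x' \<oplus>\<^bsub>G (max a b)\<^esub> t b (max a b) y')"
  have eq: "?f a x' b y' = lim_class G t n (x \<oplus>\<^bsub>G n\<^esub> y)"
    if x': "(a, x') \<in> lim_class G t n x" and y': "(b, y') \<in> lim_class G t n y" for a x' b y'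
  proof -
    let ?m = "max a b"
    have x'c: "x' \<in> carrier (G a)" and y'c: "y' \<in> carrier (G b)"
      using lim_class_memD[OF x' x] lim_class_memD[OF y' y] by auto
    obtain k where k: "n \<le> k" "a \<le> k" "t n k x = t a k x'"
      using x' by (auto simp: lim_class_def)
    obtain l where l: "n \<le> l" "b \<le> l" "t n l y = t b l y'"
      using y' by (auto simp: lim_class_def)
    let ?K = "max k l"
    have le: "?m \<le> ?K" "n \<le> ?K" "a \<le> ?m" "b \<le> ?m" "k \<le> ?K" "l \<le> ?K" using k l by auto
    have u: "t a ?m x' \<in> carrier (G ?m)" by (rule hom_closed[OF t_hom[OF le(3)] x'c])
    have v: "t b ?m y' \<in> carrier (G ?m)" by (rule hom_closed[OF t_hom[OF le(4)] y'c])
    have "t ?m ?K (t a ?m x') = t n ?K x"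
      using t_trans[OF le(3,1) x'c] t_trans[OF k(2) le(5) x'c] t_trans[OF k(1) le(5) x] k(3) by simp
    moreover have "t ?m ?K (t b ?m y') = t n ?K y"
      using t_trans[OF le(4,1) y'c] t_trans[OF l(2) le(6) y'c] t_trans[OF l(1) le(6) y] l(3) by simp
    ultimately have "t ?m ?K (t a ?m x' \<oplus>\<^bsub>G ?m\<^esub> t b ?m y') = t n ?K (x \<oplus>\<^bsub>G n\<^esub> y)"
      using hom_add[OF t_hom[OF le(1)] u v] hom_add[OF t_hom[OF le(2)] x y] by simp
    moreover have "t a ?m x' \<oplus>\<^bsub>G ?m\<^esub> t b ?m y' \<in> carrier (G ?m)"
      by (rule G_add_closed[OF u v])
    moreover have "x \<oplus>\<^bsub>G n\<^esub> y \<in> carrier (G n)"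
      by (rule G_add_closed[OF x y])
    ultimately show ?thesis
      using le(1,2) by (subst lim_class_eq_iff) blast+
  qed
  have "lim_class G t n x \<oplus>\<^bsub>direct_lim G t\<^esub> lim_class G t n y =
      (\<Union>(a, x')\<in>lim_class G t n x. \<Union>(b, y')\<in>lim_class G t n y. ?f a x' b y')"
    by (simp add: direct_lim_def)
  also have "\<dots> = lim_class G t n (x \<oplus>\<^bsub>G n\<^esub> y)"
    using eq lim_class_self[OF x] lim_class_self[OF y] by fast
  finally show ?thesis .
qed

lemma lim_class_smult:
  assumes r: "r \<in> carrier R" and x: "x \<in> carrier (G n)"
  shows "r \<odot>\<^bsub>direct_lim G t\<^esub> lim_class G t n x = lim_class G t n (r \<odot>\<^bsub>G n\<^esub> x)"
proof -
  have eq: "lim_class G t a (r \<odot>\<^bsub>G a\<^esub> x') = lim_class G t n (r \<odot>\<^bsub>G n\<^esub> x)"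
    if x': "(a, x') \<in> lim_class G t n x" for a x'
  proof -
    have x'c: "x' \<in> carrier (G a)" using lim_class_memD[OF x' x] by auto
    obtain k where k: "n \<le> k" "a \<le> k" "t n k x = t a k x'"
      using x' by (auto simp: lim_class_def)
    have "t a k (r \<odot>\<^bsub>G a\<^esub> x') = t n k (r \<odot>\<^bsub>G n\<^esub> x)"
      using hom_smult[OF t_hom[OF k(2)] r x'c] hom_smult[OF t_hom[OF k(1)] r x] k(3) by simp
    then show ?thesis
      using k(1,2) module.smult_closed[OF module_G r x] module.smult_closed[OF module_G r x'c]
      by (subst lim_class_eq_iff) blast+
  qed
  have "r \<odot>\<^bsub>direct_lim G t\<^esub> lim_class G t n x =
      (\<Union>(a, x')\<in>lim_class G t n x. lim_class G t a (r \<odot>\<^bsub>G a\<^esub> x'))"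
    by (simp add: direct_lim_def)
  also have "\<dots> = lim_class G t n (r \<odot>\<^bsub>G n\<^esub> x)"
    using eq lim_class_self[OF x] by fast
  finally show ?thesis .
qed

lemma lim_class_zero: "lim_class G t n \<zero>\<^bsub>G n\<^esub> = \<zero>\<^bsub>direct_lim G t\<^esub>"
proof -
  have "lim_class G t n \<zero>\<^bsub>G n\<^esub> = lim_class G t 0 \<zero>\<^bsub>G 0\<^esub>"
    using hom_zero[OF t_hom[of 0 n] module_G module_G] lim_class_transition[of 0 n "\<zero>\<^bsub>G 0\<^esub>"]
    by (simp add: G_zero_closed)
  then show ?thesis by (simp add: direct_lim_def)
qed

lemma lim_class_eq_zero_iff:
  assumes x: "x \<in> carrier (G n)"
  shows "lim_class G t n x = \<zero>\<^bsub>direct_lim G t\<^esub> \<longleftrightarrow> (\<exists>k\<ge>n. t n k x = \<zero>\<^bsub>G k\<^esub>)"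
proof -
  show ?thesis
    unfolding lim_class_zero[of n, symmetric] lim_class_eq_iff[OF x G_zero_closed]
    using hom_zero[OF t_hom module_G module_G] by auto
qed

lemma direct_lim_cases:
  assumes "X \<in> carrier (direct_lim G t)"
  obtains n x where "x \<in> carrier (G n)" "X = lim_class G t n x"
  using assms by (auto simp: direct_lim_carrier)

text \<open>Finitely many elements of the limit come from a common stage, which reduces the module
  axioms to those of the stages.\<close>

lemma direct_lim_common_stage:
  assumes "X \<in> carrier (direct_lim G t)" "Y \<in> carrier (direct_lim G t)" "Z \<in> carrier (direct_lim G t)"
  obtains n x y z where "x \<in> carrier (G n)" "y \<in> carrier (G n)" "z \<in> carrier (G n)"
    "X = lim_class G t n x" "Y = lim_class G t n y" "Z = lim_class G t n z"
proof -
  have move: "\<exists>x. x \<in> carrier (G k) \<and> lim_class G t n x' = lim_class G t k x"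
    if "n \<le> k" "x' \<in> carrier (G n)" for n k x'
    using lim_class_transition[OF that] hom_closed[OF t_hom[OF that(1)] that(2)] by blast
  obtain a x where x: "x \<in> carrier (G a)" "X = lim_class G t a x" by (rule direct_lim_cases[OF assms(1)])
  obtain b y where y: "y \<in> carrier (G b)" "Y = lim_class G t b y" by (rule direct_lim_cases[OF assms(2)])
  obtain c z where z: "z \<in> carrier (G c)" "Z = lim_class G t c z" by (rule direct_lim_cases[OF assms(3)])
  let ?k = "max a (max b c)"
  show ?thesis
    using that[of _ ?k] move[OF _ x(1), of ?k] move[OF _ y(1), of ?k] move[OF _ z(1), of ?k]
    unfolding x(2) y(2) z(2) by (metis max.cobounded1 max.cobounded2 max.coboundedI2)
qed

lemma module_direct_lim: "module R (direct_lim G t)"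
proof (rule moduleI_zero_smult)
  show zero: "\<zero>\<^bsub>direct_lim G t\<^esub> \<in> carrier (direct_lim G t)"
    unfolding lim_class_zero[of 0, symmetric]
    by (rule lim_class_closed[OF G_zero_closed])
  fix X Y Z assume X: "X \<in> carrier (direct_lim G t)" and Y: "Y \<in> carrier (direct_lim G t)"
    and Z: "Z \<in> carrier (direct_lim G t)"
  then obtain n x y z where c: "x \<in> carrier (G n)" "y \<in> carrier (G n)" "z \<in> carrier (G n)"
    and eq: "X = lim_class G t n x" "Y = lim_class G t n y" "Z = lim_class G t n z"
    by (rule direct_lim_common_stage)
  interpret Gn: module R "G n" by (rule module_G)
  show "(X \<oplus>\<^bsub>direct_lim G t\<^esub> Y) \<oplus>\<^bsub>direct_lim G t\<^esub> Z = X \<oplus>\<^bsub>direct_lim G t\<^esub> (Y \<oplus>\<^bsub>direct_lim G t\<^esub> Z)"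
    using c by (simp add: eq lim_class_add Gn.M.a_assoc)
next
  fix X Y assume X: "X \<in> carrier (direct_lim G t)" and Y: "Y \<in> carrier (direct_lim G t)"
  from direct_lim_common_stage[OF X Y Y] obtain n x y where c: "x \<in> carrier (G n)" "y \<in> carrier (G n)"
    and eq: "X = lim_class G t n x" "Y = lim_class G t n y"
    by metis
  interpret Gn: module R "G n" by (rule module_G)
  show "X \<oplus>\<^bsub>direct_lim G t\<^esub> Y \<in> carrier (direct_lim G t)"
    using c by (simp add: eq lim_class_add lim_class_closed)
  show "X \<oplus>\<^bsub>direct_lim G t\<^esub> Y = Y \<oplus>\<^bsub>direct_lim G t\<^esub> X"
    using c by (simp add: eq lim_class_add Gn.M.a_comm)
  fix r assume r: "r \<in> carrier R"
  show "r \<odot>\<^bsub>direct_lim G t\<^esub> (X \<oplus>\<^bsub>direct_lim G t\<^esub> Y)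
      = r \<odot>\<^bsub>direct_lim G t\<^esub> X \<oplus>\<^bsub>direct_lim G t\<^esub> r \<odot>\<^bsub>direct_lim G t\<^esub> Y"
    using c r by (simp add: eq lim_class_add lim_class_smult Gn.smult_r_distr)
next
  fix X assume X: "X \<in> carrier (direct_lim G t)"
  then obtain n x where c: "x \<in> carrier (G n)" and eq: "X = lim_class G t n x"
    by (rule direct_lim_cases)
  interpret Gn: module R "G n" by (rule module_G)
  show "\<zero>\<^bsub>direct_lim G t\<^esub> \<oplus>\<^bsub>direct_lim G t\<^esub> X = X"
    using c by (simp add: eq lim_class_add lim_class_zero[of n, symmetric])
  show "\<one> \<odot>\<^bsub>direct_lim G t\<^esub> X = X"
    using c by (simp add: eq lim_class_smult)
  show "\<zero> \<odot>\<^bsub>direct_lim G t\<^esub> X = \<zero>\<^bsub>direct_lim G t\<^esub>"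
    using c by (simp add: eq lim_class_smult lim_class_zero[of n, symmetric])
  fix r assume r: "r \<in> carrier R"
  show "r \<odot>\<^bsub>direct_lim G t\<^esub> X \<in> carrier (direct_lim G t)"
    using c r by (simp add: eq lim_class_smult lim_class_closed)
  fix s assume s: "s \<in> carrier R"
  show "(r \<oplus> s) \<odot>\<^bsub>direct_lim G t\<^esub> X
      = r \<odot>\<^bsub>direct_lim G t\<^esub> X \<oplus>\<^bsub>direct_lim G t\<^esub> s \<odot>\<^bsub>direct_lim G t\<^esub> X"
    using c r s by (simp add: eq lim_class_smult lim_class_add Gn.smult_l_distr)
  show "(r \<otimes> s) \<odot>\<^bsub>direct_lim G t\<^esub> X = r \<odot>\<^bsub>direct_lim G t\<^esub> (s \<odot>\<^bsub>direct_lim G t\<^esub> X)"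
    using c r s by (simp add: eq lim_class_smult Gn.smult_assoc1)
qed

end


section \<open>Ext and its colimit in terms of cocycles\<close>

text \<open>The elements of \<open>hom_module\<close> are fixed to be undefined outside their domain. The two predicates
  below leave the values there open, so that composites of cocycles with chain maps or with
  coefficient homomorphisms are cocycles without being restricted again.\<close>

definition is_cocycle ::
    "('a, 'r) ring_scheme \<Rightarrow> nat \<Rightarrow> ('a, 'm, 'k) module_scheme \<Rightarrow> ('a, 'n, 'l) module_scheme \<Rightarrow>
      ((('a, 'm) cell \<Rightarrow> 'a) \<Rightarrow> 'n) \<Rightarrow> bool"
  where "is_cocycle R i M N f \<longleftrightarrow> f \<in> module_homs R (std_res R M i) N \<and>
    (\<forall>x\<in>carrier (std_res R M (Suc i)). f (bdry R x) = \<zero>\<^bsub>N\<^esub>)"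

definition is_coboundary ::
    "('a, 'r) ring_scheme \<Rightarrow> nat \<Rightarrow> ('a, 'm, 'k) module_scheme \<Rightarrow> ('a, 'n, 'l) module_scheme \<Rightarrow>
      ((('a, 'm) cell \<Rightarrow> 'a) \<Rightarrow> 'n) \<Rightarrow> bool"
  where "is_coboundary R i M N f \<longleftrightarrow> (case i of
      0 \<Rightarrow> \<forall>x\<in>carrier (std_res R M 0). f x = \<zero>\<^bsub>N\<^esub>
    | Suc j \<Rightarrow> \<exists>u\<in>module_homs R (std_res R M j) N. \<forall>x\<in>carrier (std_res R M i). f x = u (bdry R x))"

abbreviation cocycle_module ::
    "('a, 'r) ring_scheme \<Rightarrow> nat \<Rightarrow> ('a, 'm, 'k) module_scheme \<Rightarrow> ('a, 'n, 'l) module_scheme \<Rightarrow>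
      ('a, (('a, 'm) cell \<Rightarrow> 'a) \<Rightarrow> 'n) module"
  where "cocycle_module R i M N \<equiv> hom_module R (std_res R M i) N \<lparr>carrier := ext_cocycles R i M N\<rparr>"

definition ext_class ::
    "('a, 'r) ring_scheme \<Rightarrow> nat \<Rightarrow> ('a, 'm, 'k) module_scheme \<Rightarrow> ('a, 'n, 'l) module_scheme \<Rightarrow>
      ((('a, 'm) cell \<Rightarrow> 'a) \<Rightarrow> 'n) \<Rightarrow> ((('a, 'm) cell \<Rightarrow> 'a) \<Rightarrow> 'n) set"
  where "ext_class R i M N f =
    ext_coboundaries R i M N +>\<^bsub>cocycle_module R i M N\<^esub> restrict f (carrier (std_res R M i))"

context cring
begin

lemma is_cocycleD:
  assumes "is_cocycle R i M N f"
  shows "f \<in> module_homs R (std_res R M i) N"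
    and "x \<in> carrier (std_res R M (Suc i)) \<Longrightarrow> f (bdry R x) = \<zero>\<^bsub>N\<^esub>"
  using assms by (auto simp: is_cocycle_def)

lemma bdry_closed: "x \<in> carrier (std_res R M (Suc i)) \<Longrightarrow> bdry R x \<in> carrier (std_res R M i)"
  by (rule hom_closed[OF bdry_hom])

lemma is_cocycle_add:
  assumes f: "is_cocycle R i M N f" and g: "is_cocycle R i M N g" and N: "module R N"
  shows "is_cocycle R i M N (\<lambda>x. f x \<oplus>\<^bsub>N\<^esub> g x)"
proof -
  interpret N: module R N by fact
  show ?thesis
    unfolding is_cocycle_def
    by (intro conjI hom_pointwise_add is_cocycleD(1)[OF f] is_cocycleD(1)[OF g] module_std_res N)
      (simp add: is_cocycleD(2)[OF f] is_cocycleD(2)[OF g])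
qed

lemma is_cocycle_smult:
  assumes r: "r \<in> carrier R" and f: "is_cocycle R i M N f" and N: "module R N"
  shows "is_cocycle R i M N (\<lambda>x. r \<odot>\<^bsub>N\<^esub> f x)"
proof -
  interpret N: module R N by fact
  show ?thesis
    unfolding is_cocycle_def
    by (intro conjI hom_pointwise_smult is_cocycleD(1)[OF f] module_std_res N r)
      (simp add: is_cocycleD(2)[OF f] r)
qed

lemma is_cocycle_minus:
  assumes f: "is_cocycle R i M N f" and g: "is_cocycle R i M N g" and N: "module R N"
  shows "is_cocycle R i M N (\<lambda>x. f x \<ominus>\<^bsub>N\<^esub> g x)"
proof -
  interpret N: module R N by fact
  show ?thesis
    unfolding is_cocycle_def
    by (intro conjI hom_pointwise_minus is_cocycleD(1)[OF f] is_cocycleD(1)[OF g] module_std_res N)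
      (simp add: is_cocycleD(2)[OF f] is_cocycleD(2)[OF g] a_minus_def)
qed

lemma is_cocycle_zero: "module R N \<Longrightarrow> is_cocycle R i M N (\<lambda>x. \<zero>\<^bsub>N\<^esub>)"
  by (simp add: is_cocycle_def hom_zero_map)

lemma is_cocycle_post:
  assumes f: "is_cocycle R i M N f" and p: "p \<in> module_homs R N N'" and "module R N" "module R N'"
  shows "is_cocycle R i M N' (\<lambda>x. p (f x))"
  unfolding is_cocycle_def
  using hom_comp[OF is_cocycleD(1)[OF f] p] is_cocycleD(2)[OF f] hom_zero[OF p assms(3,4)] by simp

lemma is_coboundary_post:
  assumes f: "is_coboundary R i M N f" and p: "p \<in> module_homs R N N'" and "module R N" "module R N'"
  shows "is_coboundary R i M N' (\<lambda>x. p (f x))"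
proof (cases i)
  case 0
  then show ?thesis
    using f hom_zero[OF p assms(3,4)] by (simp add: is_coboundary_def)
next
  case (Suc j)
  with f obtain u where u: "u \<in> module_homs R (std_res R M j) N"
    "\<And>x. x \<in> carrier (std_res R M i) \<Longrightarrow> f x = u (bdry R x)"
    by (auto simp: is_coboundary_def)
  then show ?thesis
    unfolding is_coboundary_def Suc nat.case
    by (intro bexI[of _ "\<lambda>x. p (u x)"] hom_comp[OF u(1) p]) (simp add: Suc)
qed

lemma is_cocycle_pre:
  assumes h: "h \<in> module_homs R M M'" and M: "module R M" and M': "module R M'"
    and f: "is_cocycle R i M' N f"
  shows "is_cocycle R i M N (\<lambda>x. f (std_map R h i x))"
  unfolding is_cocycle_def
proof (intro conjI ballI)
  show "(\<lambda>x. f (std_map R h i x)) \<in> module_homs R (std_res R M i) N"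
    by (rule hom_comp[OF std_map_hom[OF M M' h] is_cocycleD(1)[OF f]])
  fix x assume x: "x \<in> carrier (std_res R M (Suc i))"
  show "f (std_map R h i (bdry R x)) = \<zero>\<^bsub>N\<^esub>"
    using is_cocycleD(2)[OF f hom_closed[OF std_map_hom[OF M M' h] x]] bdry_std_map[OF M M' h x] by simp
qed

lemma is_coboundary_pre:
  assumes h: "h \<in> module_homs R M M'" and M: "module R M" and M': "module R M'"
    and f: "is_coboundary R i M' N f"
  shows "is_coboundary R i M N (\<lambda>x. f (std_map R h i x))"
proof (cases i)
  case 0
  then show ?thesis
    using f hom_closed[OF std_map_hom[OF M M' h, of 0]] by (simp add: is_coboundary_def)
next
  case (Suc j)
  with f obtain u where u: "u \<in> module_homs R (std_res R M' j) N"
    "\<And>x. x \<in> carrier (std_res R M' i) \<Longrightarrow> f x = u (bdry R x)"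
    by (auto simp: is_coboundary_def)
  have "f (std_map R h i x) = u (std_map R h j (bdry R x))" if "x \<in> carrier (std_res R M i)" for x
  proof -
    have x: "x \<in> carrier (std_res R M (Suc j))" using that Suc by simp
    show ?thesis
      unfolding u(2)[OF hom_closed[OF std_map_hom[OF M M' h] that]]
      unfolding Suc bdry_std_map[OF M M' h x] ..
  qed
  then show ?thesis
    unfolding is_coboundary_def Suc nat.case
    by (intro bexI[of _ "\<lambda>x. u (std_map R h j x)"] hom_comp[OF std_map_hom[OF M M' h] u(1)])
      (simp add: Suc)
qed

lemma restrict_mem_ext_cocycles:
  assumes "is_cocycle R i M N f"
  shows "restrict f (carrier (std_res R M i)) \<in> ext_cocycles R i M N"
  using hom_restrict[OF module_std_res is_cocycleD(1)[OF assms]] is_cocycleD(2)[OF assms]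
  by (simp add: ext_cocycles_def bdry_closed)

lemma ext_cocyclesD:
  assumes "f \<in> ext_cocycles R i M N"
  shows "is_cocycle R i M N f" "f \<in> extensional (carrier (std_res R M i))"
    "restrict f (carrier (std_res R M i)) = f"
  using assms by (auto simp: ext_cocycles_def is_cocycle_def extensional_restrict)

lemma submodule_ext_cocycles:
  assumes N: "module R N"
  shows "submodule (ext_cocycles R i M N) R (hom_module R (std_res R M i) N)"
proof -
  interpret H: module R "hom_module R (std_res R M i) N"
    by (rule module_hom_module[OF module_std_res N])
  show ?thesis
  proof (rule H.submoduleI_smult)
    show "ext_cocycles R i M N \<subseteq> carrier (hom_module R (std_res R M i) N)"
      by (auto simp: ext_cocycles_def)
    show "\<zero>\<^bsub>hom_module R (std_res R M i) N\<^esub> \<in> ext_cocycles R i M N"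
      using restrict_mem_ext_cocycles[OF is_cocycle_zero[OF N]] by simp
    fix f assume f: "f \<in> ext_cocycles R i M N"
    show "r \<odot>\<^bsub>hom_module R (std_res R M i) N\<^esub> f \<in> ext_cocycles R i M N" if "r \<in> carrier R" for r
      using restrict_mem_ext_cocycles[OF is_cocycle_smult[OF that ext_cocyclesD(1)[OF f] N]] by simp
    fix g assume g: "g \<in> ext_cocycles R i M N"
    show "f \<oplus>\<^bsub>hom_module R (std_res R M i) N\<^esub> g \<in> ext_cocycles R i M N"
      using restrict_mem_ext_cocycles[OF is_cocycle_add[OF ext_cocyclesD(1)[OF f] ext_cocyclesD(1)[OF g] N]]
      by simp
  qed
qed

lemma module_cocycle_module: "module R N \<Longrightarrow> module R (cocycle_module R i M N)"
  by (rule submodule.submodule_is_module[OF submodule_ext_cocycles module_hom_module[OF module_std_res]])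

lemma submodule_ext_coboundaries:
  assumes N: "module R N"
  shows "submodule (ext_coboundaries R i M N) R (cocycle_module R i M N)"
proof (cases i)
  case 0
  interpret C: module R "cocycle_module R i M N" by (rule module_cocycle_module[OF N])
  have "submodule {\<zero>\<^bsub>cocycle_module R i M N\<^esub>} R (cocycle_module R i M N)"
    by (rule C.submoduleI_smult) (use C.M.zero_closed C.M.l_zero[OF C.M.zero_closed] C.smult_r_null in auto)
  then show ?thesis by (simp add: ext_coboundaries_def 0)
next
  case (Suc j)
  let ?\<delta> = "\<lambda>g. \<lambda>x\<in>carrier (std_res R M i). g (bdry R x)"
  interpret N: module R N by fact
  have "?\<delta> \<in> module_homs R (hom_module R (std_res R M j) N) (cocycle_module R i M N)"
  proof (rule module_homsI)
    fix g assume "g \<in> carrier (hom_module R (std_res R M j) N)"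
    then have g: "g \<in> module_homs R (std_res R M j) N" by simp
    have "is_cocycle R i M N (\<lambda>x. g (bdry R x))"
      unfolding is_cocycle_def Suc
      using hom_comp[OF bdry_hom g] bdry_bdry[of _ M j] hom_zero[OF g module_std_res N] by simp
    then show "?\<delta> g \<in> carrier (cocycle_module R i M N)"
      using restrict_mem_ext_cocycles by simp
  qed (auto simp: Suc bdry_closed restrict_def fun_eq_iff)
  from hom_image_submodule[OF this module_hom_module[OF module_std_res N] module_cocycle_module[OF N]]
  show ?thesis by (simp add: ext_coboundaries_def Suc)
qed

lemma restrict_mem_ext_coboundaries_iff:
  assumes N: "module R N"
  shows "restrict f (carrier (std_res R M i)) \<in> ext_coboundaries R i M N \<longleftrightarrow> is_coboundary R i M N f"
proof (cases i)
  case 0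
  then show ?thesis
    by (auto simp: ext_coboundaries_def is_coboundary_def restrict_def fun_eq_iff split: if_splits)
next
  case (Suc j)
  show ?thesis
  proof
    assume "restrict f (carrier (std_res R M i)) \<in> ext_coboundaries R i M N"
    then obtain g where g: "g \<in> module_homs R (std_res R M j) N"
      and eq: "restrict f (carrier (std_res R M i)) = (\<lambda>x\<in>carrier (std_res R M i). g (bdry R x))"
      by (auto simp: ext_coboundaries_def Suc)
    have "f x = g (bdry R x)" if "x \<in> carrier (std_res R M i)" for x
      using fun_cong[OF eq, of x] that by simp
    then show "is_coboundary R i M N f"
      unfolding is_coboundary_def Suc nat.case by (intro bexI[of _ g] g) (simp add: Suc)
  next
    assume "is_coboundary R i M N f"
    then obtain g where g: "g \<in> module_homs R (std_res R M j) N"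
      and eq: "\<And>x. x \<in> carrier (std_res R M i) \<Longrightarrow> f x = g (bdry R x)"
      by (auto simp: is_coboundary_def Suc)
    have "restrict f (carrier (std_res R M i)) =
        (\<lambda>x\<in>carrier (std_res R M i). restrict g (carrier (std_res R M j)) (bdry R x))"
      using eq by (intro restrict_ext) (simp add: Suc bdry_closed)
    moreover have "restrict g (carrier (std_res R M j)) \<in> carrier (hom_module R (std_res R M j) N)"
      using hom_restrict[OF module_std_res g] by simp
    ultimately show "restrict f (carrier (std_res R M i)) \<in> ext_coboundaries R i M N"
      unfolding ext_coboundaries_def Suc nat.case by blast
  qed
qed

lemma module_Ext: "module R N \<Longrightarrow> module R (Ext R i M N)"
  unfolding Ext_def
  by (rule module.module_quot_module[OF module_cocycle_module submodule_ext_coboundaries])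

lemma Ext_carrier:
  assumes N: "module R N"
  shows "carrier (Ext R i M N) = ext_class R i M N ` {f. is_cocycle R i M N f}"
proof -
  interpret C: module R "cocycle_module R i M N" by (rule module_cocycle_module[OF N])
  have "ext_cocycles R i M N = (\<lambda>f. restrict f (carrier (std_res R M i))) ` {f. is_cocycle R i M N f}"
    using ext_cocyclesD restrict_mem_ext_cocycles by (fastforce simp: image_iff)
  then show ?thesis
    unfolding Ext_def C.quot_carrier ext_class_def by auto
qed

lemma ext_class_closed: "module R N \<Longrightarrow> is_cocycle R i M N f \<Longrightarrow> ext_class R i M N f \<in> carrier (Ext R i M N)"
  by (simp add: Ext_carrier)

lemma ext_class_add:
  assumes N: "module R N" and f: "is_cocycle R i M N f" and g: "is_cocycle R i M N g"
  shows "ext_class R i M N f \<oplus>\<^bsub>Ext R i M N\<^esub> ext_class R i M N g = ext_class R i M N (\<lambda>x. f x \<oplus>\<^bsub>N\<^esub> g x)"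
proof -
  interpret C: module R "cocycle_module R i M N" by (rule module_cocycle_module[OF N])
  have "restrict f (carrier (std_res R M i)) \<oplus>\<^bsub>cocycle_module R i M N\<^esub> restrict g (carrier (std_res R M i))
      = (\<lambda>x\<in>carrier (std_res R M i). f x \<oplus>\<^bsub>N\<^esub> g x)"
    by (auto simp: restrict_def)
  then show ?thesis
    unfolding Ext_def ext_class_def
    using C.quot_add[OF submodule_ext_coboundaries[OF N], of "restrict f (carrier (std_res R M i))"
        "restrict g (carrier (std_res R M i))"]
      restrict_mem_ext_cocycles[OF f] restrict_mem_ext_cocycles[OF g] by simp
qed

lemma ext_class_smult:
  assumes N: "module R N" and r: "r \<in> carrier R" and f: "is_cocycle R i M N f"
  shows "r \<odot>\<^bsub>Ext R i M N\<^esub> ext_class R i M N f = ext_class R i M N (\<lambda>x. r \<odot>\<^bsub>N\<^esub> f x)"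
proof -
  interpret C: module R "cocycle_module R i M N" by (rule module_cocycle_module[OF N])
  have "r \<odot>\<^bsub>cocycle_module R i M N\<^esub> restrict f (carrier (std_res R M i))
      = (\<lambda>x\<in>carrier (std_res R M i). r \<odot>\<^bsub>N\<^esub> f x)"
    by (auto simp: restrict_def)
  then show ?thesis
    unfolding Ext_def ext_class_def
    using C.quot_smult[OF submodule_ext_coboundaries[OF N] r, of "restrict f (carrier (std_res R M i))"]
      restrict_mem_ext_cocycles[OF f] by simp
qed

lemma ext_class_eq_zero_iff:
  assumes N: "module R N" and f: "is_cocycle R i M N f"
  shows "ext_class R i M N f = \<zero>\<^bsub>Ext R i M N\<^esub> \<longleftrightarrow> is_coboundary R i M N f"
proof -
  interpret C: module R "cocycle_module R i M N" by (rule module_cocycle_module[OF N])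
  have f': "restrict f (carrier (std_res R M i)) \<in> carrier (cocycle_module R i M N)"
    using restrict_mem_ext_cocycles[OF f] by simp
  have "ext_class R i M N f = \<zero>\<^bsub>Ext R i M N\<^esub> \<longleftrightarrow>
      restrict f (carrier (std_res R M i)) \<in> ext_coboundaries R i M N"
    unfolding Ext_def ext_class_def C.quot_zero[OF submodule_ext_coboundaries[OF N]]
      C.coset_eq_iff[OF submodule_ext_coboundaries[OF N] f' C.M.zero_closed]
    using C.M.r_zero[OF f'] C.smult_r_null[of "\<ominus> \<one>"] C.a_inv_eq_smult[OF C.M.zero_closed]
    unfolding a_minus_def by simp
  then show ?thesis
    by (simp add: restrict_mem_ext_coboundaries_iff[OF N])
qed

lemma Ext_map_ext_class_and_hom:
  assumes N: "module R N" and M: "module R M" and M': "module R M'" and h: "h \<in> module_homs R M M'"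
  shows Ext_map_ext_class: "is_cocycle R i M' N f \<Longrightarrow>
      Ext_map R i M N h (ext_class R i M' N f) = ext_class R i M N (\<lambda>x. f (std_map R h i x))"
    and Ext_map_hom: "Ext_map R i M N h \<in> module_homs R (Ext R i M' N) (Ext R i M N)"
proof -
  let ?\<phi> = "\<lambda>f. \<lambda>x\<in>carrier (std_res R M i). f (std_map R h i x)"
  note s = hom_closed[OF std_map_hom[OF M M' h]]
  have \<phi>: "?\<phi> \<in> module_homs R (cocycle_module R i M' N) (cocycle_module R i M N)"
  proof (rule module_homsI)
    fix f assume "f \<in> carrier (cocycle_module R i M' N)"
    then show "?\<phi> f \<in> carrier (cocycle_module R i M N)"
      using restrict_mem_ext_cocycles[OF is_cocycle_pre[OF h M M' ext_cocyclesD(1)]] by simp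
  qed (auto simp: s restrict_def fun_eq_iff)
  have sub: "?\<phi> ` ext_coboundaries R i M' N \<subseteq> ext_coboundaries R i M N"
  proof (rule image_subsetI)
    fix f assume f: "f \<in> ext_coboundaries R i M' N"
    then have "f \<in> ext_cocycles R i M' N"
      using submodule_carrier[OF submodule_ext_coboundaries[OF N, of i M']] by auto
    from ext_cocyclesD(3)[OF this] have "is_coboundary R i M' N f"
      using f restrict_mem_ext_coboundaries_iff[OF N, of f M' i] by simp
    from is_coboundary_pre[OF h M M' this] show "?\<phi> f \<in> ext_coboundaries R i M N"
      by (simp add: restrict_mem_ext_coboundaries_iff[OF N])
  qed
  have map: "Ext_map R i M N h = (\<lambda>X. \<Union>f\<in>X. ext_coboundaries R i M N +>\<^bsub>cocycle_module R i M N\<^esub> ?\<phi> f)"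
    by (rule ext) (simp add: Ext_map_def a_r_coset_update)
  note q = module_cocycle_module[OF N] module_cocycle_module[OF N] \<phi>
    submodule_ext_coboundaries[OF N] submodule_ext_coboundaries[OF N] sub
  show "Ext_map R i M N h \<in> module_homs R (Ext R i M' N) (Ext R i M N)"
    unfolding map Ext_def by (rule quot_map_hom[OF q])
  assume f: "is_cocycle R i M' N f"
  have "?\<phi> (restrict f (carrier (std_res R M' i))) = ?\<phi> f"
    by (intro restrict_ext) (simp add: s)
  then show "Ext_map R i M N h (ext_class R i M' N f) = ext_class R i M N (\<lambda>x. f (std_map R h i x))"
    unfolding map ext_class_def
    using quot_map_coset[OF q, of "restrict f (carrier (std_res R M' i))"] restrict_mem_ext_cocycles[OF f]
    by simp
qed

lemma ext_class_cong:
  "(\<And>x. x \<in> carrier (std_res R M i) \<Longrightarrow> f x = g x) \<Longrightarrow> ext_class R i M N f = ext_class R i M N g"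
  unfolding ext_class_def by (metis restrict_ext)

end

text \<open>An inverse system of modules \<open>Q n\<close>, with transition maps \<open>h n m\<close> from \<open>Q m\<close> to \<open>Q n\<close> for
  \<open>n \<le> m\<close>. Generalized local cohomology is the case \<open>Q n = M/I\<^sup>nM\<close>. As the second argument \<open>N\<close> varies,
  the colimit of \<open>Ext R i (Q n) N\<close> behaves like a cohomology functor for any such system.\<close>

locale inverse_system = cring R for R (structure) +
  fixes Q :: "nat \<Rightarrow> ('a, 'q, 'k) module_scheme" and h :: "nat \<Rightarrow> nat \<Rightarrow> 'q \<Rightarrow> 'q"
  assumes module_Q: "module R (Q n)"
    and h_hom: "n \<le> m \<Longrightarrow> h n m \<in> module_homs R (Q m) (Q n)"
    and h_refl: "x \<in> carrier (Q n) \<Longrightarrow> h n n x = x"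
    and h_trans: "\<lbrakk>n \<le> m; m \<le> k; x \<in> carrier (Q k)\<rbrakk> \<Longrightarrow> h n m (h m k x) = h n k x"
begin

abbreviation C where "C n i \<equiv> std_res R (Q n) i"

definition ext_lim :: "nat \<Rightarrow> ('a, 'n, 'l) module_scheme
    \<Rightarrow> ('a, (nat \<times> ((('a, 'q) cell \<Rightarrow> 'a) \<Rightarrow> 'n) set) set) module"
  where "ext_lim i N = direct_lim (\<lambda>n. Ext R i (Q n) N) (\<lambda>n m. Ext_map R i (Q m) N (h n m))"

definition cls :: "nat \<Rightarrow> ('a, 'n, 'l) module_scheme \<Rightarrow> nat \<Rightarrow> ((('a, 'q) cell \<Rightarrow> 'a) \<Rightarrow> 'n)
    \<Rightarrow> (nat \<times> ((('a, 'q) cell \<Rightarrow> 'a) \<Rightarrow> 'n) set) set"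
  where "cls i N n f = lim_class (\<lambda>n. Ext R i (Q n) N) (\<lambda>n m. Ext_map R i (Q m) N (h n m)) n
    (ext_class R i (Q n) N f)"

lemma direct_system_Ext:
  assumes N: "module R N"
  shows "direct_system R (\<lambda>n. Ext R i (Q n) N) (\<lambda>n m. Ext_map R i (Q m) N (h n m))"
proof (rule direct_system.intro[OF is_cring direct_system_axioms.intro], goal_cases)
  case (1 n)
  show ?case by (rule module_Ext[OF N])
next
  case (2 n m)
  show ?case by (rule Ext_map_hom[OF N module_Q module_Q h_hom[OF 2]])
next
  case (3 X n)
  then obtain f where f: "is_cocycle R i (Q n) N f" "X = ext_class R i (Q n) N f"
    by (auto simp: Ext_carrier[OF N])
  show ?case
    unfolding f(2) Ext_map_ext_class[OF N module_Q module_Q h_hom[OF order_refl] f(1)]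
    by (rule ext_class_cong) (simp add: std_map_id[OF module_Q h_refl])
next
  case (4 n m k X)
  then obtain f where f: "is_cocycle R i (Q n) N f" "X = ext_class R i (Q n) N f"
    by (auto simp: Ext_carrier[OF N])
  have nk: "n \<le> k" using 4(1,2) by simp
  show ?case
    unfolding f(2) Ext_map_ext_class[OF N module_Q module_Q h_hom[OF 4(1)] f(1)]
      Ext_map_ext_class[OF N module_Q module_Q h_hom[OF nk] f(1)]
      Ext_map_ext_class[OF N module_Q module_Q h_hom[OF 4(2)]
        is_cocycle_pre[OF h_hom[OF 4(1)] module_Q module_Q f(1)]]
    by (rule ext_class_cong)
      (simp add: std_map_comp[OF module_Q module_Q module_Q h_hom[OF 4(2)] h_hom[OF 4(1)] h_hom[OF nk]
          h_trans[OF 4(1,2), symmetric]])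
qed

lemma module_ext_lim: "module R N \<Longrightarrow> module R (ext_lim i N)"
  unfolding ext_lim_def by (rule direct_system.module_direct_lim[OF direct_system_Ext])

lemma cls_closed: "\<lbrakk>module R N; is_cocycle R i (Q n) N f\<rbrakk> \<Longrightarrow> cls i N n f \<in> carrier (ext_lim i N)"
  unfolding ext_lim_def cls_def
  by (rule direct_system.lim_class_closed[OF direct_system_Ext ext_class_closed])

lemma ext_lim_cases:
  assumes N: "module R N" and "X \<in> carrier (ext_lim i N)"
  obtains n f where "is_cocycle R i (Q n) N f" "X = cls i N n f"
proof -
  obtain n x where x: "x \<in> carrier (Ext R i (Q n) N)"
    "X = lim_class (\<lambda>n. Ext R i (Q n) N) (\<lambda>n m. Ext_map R i (Q m) N (h n m)) n x"
    using assms(2) unfolding ext_lim_def by (rule direct_system.direct_lim_cases[OF direct_system_Ext[OF N]])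
  then obtain f where "is_cocycle R i (Q n) N f" "x = ext_class R i (Q n) N f"
    by (auto simp: Ext_carrier[OF N])
  then show ?thesis using that x(2) unfolding cls_def by blast
qed

lemma cls_cong: "(\<And>x. x \<in> carrier (C n i) \<Longrightarrow> f x = g x) \<Longrightarrow> cls i N n f = cls i N n g"
  unfolding cls_def by (rule arg_cong[OF ext_class_cong])

lemma cls_add:
  assumes "module R N" "is_cocycle R i (Q n) N f" "is_cocycle R i (Q n) N g"
  shows "cls i N n f \<oplus>\<^bsub>ext_lim i N\<^esub> cls i N n g = cls i N n (\<lambda>x. f x \<oplus>\<^bsub>N\<^esub> g x)"
  unfolding ext_lim_def cls_def
  by (simp only: direct_system.lim_class_add[OF direct_system_Ext[OF assms(1)]
      ext_class_closed[OF assms(1,2)] ext_class_closed[OF assms(1,3)]] ext_class_add[OF assms])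

lemma cls_smult:
  assumes "module R N" "r \<in> carrier R" "is_cocycle R i (Q n) N f"
  shows "r \<odot>\<^bsub>ext_lim i N\<^esub> cls i N n f = cls i N n (\<lambda>x. r \<odot>\<^bsub>N\<^esub> f x)"
  unfolding ext_lim_def cls_def
  by (simp only: direct_system.lim_class_smult[OF direct_system_Ext[OF assms(1)] assms(2)
      ext_class_closed[OF assms(1,3)]] ext_class_smult[OF assms])

lemma cls_transition:
  assumes N: "module R N" and "n \<le> k" and f: "is_cocycle R i (Q n) N f"
  shows "cls i N n f = cls i N k (\<lambda>x. f (std_map R (h n k) i x))"
  unfolding cls_def
  by (simp only: direct_system.lim_class_transition[OF direct_system_Ext[OF N] assms(2)
      ext_class_closed[OF N f]] Ext_map_ext_class[OF N module_Q module_Q h_hom[OF assms(2)] f])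

lemma cls_eq_zero_iff:
  assumes N: "module R N" and f: "is_cocycle R i (Q n) N f"
  shows "cls i N n f = \<zero>\<^bsub>ext_lim i N\<^esub> \<longleftrightarrow>
    (\<exists>k\<ge>n. is_coboundary R i (Q k) N (\<lambda>x. f (std_map R (h n k) i x)))"
proof -
  have "Ext_map R i (Q k) N (h n k) (ext_class R i (Q n) N f) = \<zero>\<^bsub>Ext R i (Q k) N\<^esub> \<longleftrightarrow>
      is_coboundary R i (Q k) N (\<lambda>x. f (std_map R (h n k) i x))" if "n \<le> k" for k
    unfolding Ext_map_ext_class[OF N module_Q module_Q h_hom[OF that] f]
    by (rule ext_class_eq_zero_iff[OF N is_cocycle_pre[OF h_hom[OF that] module_Q module_Q f]])
  then show ?thesis
    unfolding ext_lim_def cls_def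
      direct_system.lim_class_eq_zero_iff[OF direct_system_Ext[OF N] ext_class_closed[OF N f]]
    by blast
qed

lemma is_cocycle_transition:
  "\<lbrakk>n \<le> k; is_cocycle R i (Q n) N f\<rbrakk> \<Longrightarrow> is_cocycle R i (Q k) N (\<lambda>x. f (std_map R (h n k) i x))"
  by (rule is_cocycle_pre[OF h_hom module_Q module_Q])

end


section \<open>Dimension shifting\<close>

context inverse_system
begin

lemma cls_eq_iff:
  assumes N: "module R N" and f: "is_cocycle R i (Q n) N f" and g: "is_cocycle R i (Q n) N g"
  shows "cls i N n f = cls i N n g \<longleftrightarrow> cls i N n (\<lambda>x. f x \<ominus>\<^bsub>N\<^esub> g x) = \<zero>\<^bsub>ext_lim i N\<^esub>"
proof -
  interpret N: module R N by fact
  interpret X: module R "ext_lim i N" by (rule module_ext_lim[OF N])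
  let ?g = "\<lambda>x. (\<ominus> \<one>) \<odot>\<^bsub>N\<^esub> g x"
  have m: "\<ominus> \<one> \<in> carrier R" by simp
  note g' = is_cocycle_smult[OF m g N]
  have "cls i N n (\<lambda>x. f x \<ominus>\<^bsub>N\<^esub> g x) = cls i N n (\<lambda>x. f x \<oplus>\<^bsub>N\<^esub> ?g x)"
    by (rule cls_cong) (simp add: a_minus_def N.a_inv_eq_smult hom_closed[OF is_cocycleD(1)[OF g]])
  also have "\<dots> = cls i N n f \<oplus>\<^bsub>ext_lim i N\<^esub> cls i N n ?g"
    by (rule cls_add[OF N f g', symmetric])
  also have "\<dots> = cls i N n f \<ominus>\<^bsub>ext_lim i N\<^esub> cls i N n g"
    by (simp add: a_minus_def X.a_inv_eq_smult cls_closed[OF N g] cls_smult[OF N m g])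
  finally show ?thesis
    using X.minus_eq_zero_iff[OF cls_closed[OF N f] cls_closed[OF N g]] by simp
qed

lemma ext_lim_common_stage:
  assumes N: "module R N" and X: "X \<in> carrier (ext_lim i N)" and Y: "Y \<in> carrier (ext_lim i N)"
  obtains n f g where "is_cocycle R i (Q n) N f" "is_cocycle R i (Q n) N g"
    "X = cls i N n f" "Y = cls i N n g"
proof -
  obtain a f where f: "is_cocycle R i (Q a) N f" "X = cls i N a f" by (rule ext_lim_cases[OF N X])
  obtain b g where g: "is_cocycle R i (Q b) N g" "Y = cls i N b g" by (rule ext_lim_cases[OF N Y])
  have a: "a \<le> max a b" and b: "b \<le> max a b" by simp_all
  show ?thesis
    by (rule that[OF is_cocycle_transition[OF a f(1)] is_cocycle_transition[OF b g(1)]])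
      (simp_all only: f(2) g(2) cls_transition[OF N a f(1)] cls_transition[OF N b g(1)])
qed

text \<open>The map induced on the colimit by a coefficient homomorphism is well defined: if two classes
  agree, then the difference of the cocycles becomes a coboundary at a later stage, and \<open>p\<close>
  preserves coboundaries.\<close>

lemma cls_post_eq:
  assumes p: "p \<in> module_homs R N N'" and N: "module R N" and N': "module R N'"
    and f: "is_cocycle R i (Q n) N f" and g: "is_cocycle R i (Q m) N g"
    and eq: "cls i N n f = cls i N m g"
  shows "cls i N' n (\<lambda>x. p (f x)) = cls i N' m (\<lambda>x. p (g x))"
proof -
  let ?k = "max n m"
  have le: "n \<le> ?k" "m \<le> ?k" by simp_all
  define f' where "f' = (\<lambda>x. f (std_map R (h n ?k) i x))"
  define g' where "g' = (\<lambda>x. g (std_map R (h m ?k) i x))"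
  have f': "is_cocycle R i (Q ?k) N f'" and g': "is_cocycle R i (Q ?k) N g'"
    unfolding f'_def g'_def by (rule is_cocycle_transition[OF le(1) f] is_cocycle_transition[OF le(2) g])+
  note pf = is_cocycle_post[OF f p N N'] and pg = is_cocycle_post[OF g p N N']
    and pf' = is_cocycle_post[OF f' p N N'] and pg' = is_cocycle_post[OF g' p N N']
  have d: "is_cocycle R i (Q ?k) N (\<lambda>x. f' x \<ominus>\<^bsub>N\<^esub> g' x)" by (rule is_cocycle_minus[OF f' g' N])
  have "cls i N ?k f' = cls i N ?k g'"
    using eq unfolding cls_transition[OF N le(1) f] cls_transition[OF N le(2) g] f'_def g'_def .
  then have "cls i N ?k (\<lambda>x. f' x \<ominus>\<^bsub>N\<^esub> g' x) = \<zero>\<^bsub>ext_lim i N\<^esub>"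
    by (simp only: cls_eq_iff[OF N f' g'])
  then obtain l where l: "?k \<le> l"
    "is_coboundary R i (Q l) N (\<lambda>x. f' (std_map R (h ?k l) i x) \<ominus>\<^bsub>N\<^esub> g' (std_map R (h ?k l) i x))"
    using cls_eq_zero_iff[OF N d] by blast
  have "cls i N' ?k (\<lambda>x. p (f' x \<ominus>\<^bsub>N\<^esub> g' x)) = \<zero>\<^bsub>ext_lim i N'\<^esub>"
    unfolding cls_eq_zero_iff[OF N' is_cocycle_post[OF d p N N']]
    using is_coboundary_post[OF l(2) p N N'] l(1) by blast
  moreover have "cls i N' ?k (\<lambda>x. p (f' x \<ominus>\<^bsub>N\<^esub> g' x)) = cls i N' ?k (\<lambda>x. p (f' x) \<ominus>\<^bsub>N'\<^esub> p (g' x))"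
    by (rule cls_cong, rule hom_minus[OF p N N'])
      (rule hom_closed[OF is_cocycleD(1)[OF f']] hom_closed[OF is_cocycleD(1)[OF g']], assumption)+
  ultimately have "cls i N' ?k (\<lambda>x. p (f' x)) = cls i N' ?k (\<lambda>x. p (g' x))"
    using cls_eq_iff[OF N' pf' pg'] by simp
  then show ?thesis
    unfolding cls_transition[OF N' le(1) pf] cls_transition[OF N' le(2) pg] f'_def g'_def .
qed

lemma ext_lim_map:
  assumes p: "p \<in> module_homs R N N'" and N: "module R N" and N': "module R N'"
  obtains e where "e \<in> module_homs R (ext_lim i N) (ext_lim i N')"
    "\<And>n f. is_cocycle R i (Q n) N f \<Longrightarrow> e (cls i N n f) = cls i N' n (\<lambda>x. p (f x))"
proof -
  define e where "e X = (SOME Y. \<exists>n f. is_cocycle R i (Q n) N f \<and> X = cls i N n f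
    \<and> Y = cls i N' n (\<lambda>x. p (f x)))" for X
  have e: "e (cls i N n f) = cls i N' n (\<lambda>x. p (f x))" if f: "is_cocycle R i (Q n) N f" for n f
    unfolding e_def
  proof (rule some_equality)
    fix Y assume "\<exists>m g. is_cocycle R i (Q m) N g \<and> cls i N n f = cls i N m g
      \<and> Y = cls i N' m (\<lambda>x. p (g x))"
    then obtain m g where g: "is_cocycle R i (Q m) N g" "cls i N n f = cls i N m g"
      "Y = cls i N' m (\<lambda>x. p (g x))" by blast
    show "Y = cls i N' n (\<lambda>x. p (f x))"
      unfolding g(3) by (rule cls_post_eq[OF p N N' f g(1,2), symmetric])
  qed (use f in blast)
  have "e \<in> module_homs R (ext_lim i N) (ext_lim i N')"
  proof (rule module_homsI)
    fix X assume "X \<in> carrier (ext_lim i N)"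
    then obtain n f where f: "is_cocycle R i (Q n) N f" and X: "X = cls i N n f"
      by (rule ext_lim_cases[OF N])
    show "e X \<in> carrier (ext_lim i N')"
      unfolding X e[OF f] by (rule cls_closed[OF N' is_cocycle_post[OF f p N N']])
    fix r assume r: "r \<in> carrier R"
    show "e (r \<odot>\<^bsub>ext_lim i N\<^esub> X) = r \<odot>\<^bsub>ext_lim i N'\<^esub> e X"
      unfolding X cls_smult[OF N r f] e[OF f] e[OF is_cocycle_smult[OF r f N]]
        cls_smult[OF N' r is_cocycle_post[OF f p N N']]
      by (rule cls_cong, rule hom_smult[OF p r hom_closed[OF is_cocycleD(1)[OF f]]])
  next
    fix X Y assume "X \<in> carrier (ext_lim i N)" "Y \<in> carrier (ext_lim i N)"
    then obtain n f g where f: "is_cocycle R i (Q n) N f" and g: "is_cocycle R i (Q n) N g"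
      and X: "X = cls i N n f" and Y: "Y = cls i N n g"
      by (rule ext_lim_common_stage[OF N])
    show "e (X \<oplus>\<^bsub>ext_lim i N\<^esub> Y) = e X \<oplus>\<^bsub>ext_lim i N'\<^esub> e Y"
      unfolding X Y cls_add[OF N f g] e[OF f] e[OF g] e[OF is_cocycle_add[OF f g N]]
        cls_add[OF N' is_cocycle_post[OF f p N N'] is_cocycle_post[OF g p N N']]
      by (rule cls_cong, rule hom_add[OF p hom_closed[OF is_cocycleD(1)[OF f]]
            hom_closed[OF is_cocycleD(1)[OF g]]])
  qed
  then show ?thesis using e by (rule that)
qed

text \<open>If the identity of \<open>K\<close> is a sum of two endomorphisms that factor through \<open>G1\<close> and \<open>G2\<close>, then by
  functoriality every class with values in \<open>K\<close> is a sum of two classes that come from \<open>G1\<close> and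
  \<open>G2\<close>. This covers finite free modules, by splitting off one coordinate at a time, as well as
  their direct summands.\<close>

lemma fin_gen_ext_lim_decompose:
  assumes K: "module R K" and G1: "module R G1" and G2: "module R G2"
    and a1: "\<alpha>1 \<in> module_homs R K G1" and b1: "\<beta>1 \<in> module_homs R G1 K"
    and a2: "\<alpha>2 \<in> module_homs R K G2" and b2: "\<beta>2 \<in> module_homs R G2 K"
    and sum: "\<And>x. x \<in> carrier K \<Longrightarrow> x = \<beta>1 (\<alpha>1 x) \<oplus>\<^bsub>K\<^esub> \<beta>2 (\<alpha>2 x)"
    and fg1: "fin_gen_module R (ext_lim i G1)" and fg2: "fin_gen_module R (ext_lim i G2)"
  shows "fin_gen_module R (ext_lim i K)"
proof -
  obtain e1 where e1: "e1 \<in> module_homs R (ext_lim i G1) (ext_lim i K)"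
    "\<And>n f. is_cocycle R i (Q n) G1 f \<Longrightarrow> e1 (cls i G1 n f) = cls i K n (\<lambda>x. \<beta>1 (f x))"
    by (rule ext_lim_map[where i = i, OF b1 G1 K]) (rule that; assumption)
  obtain e2 where e2: "e2 \<in> module_homs R (ext_lim i G2) (ext_lim i K)"
    "\<And>n f. is_cocycle R i (Q n) G2 f \<Longrightarrow> e2 (cls i G2 n f) = cls i K n (\<lambda>x. \<beta>2 (f x))"
    by (rule ext_lim_map[where i = i, OF b2 G2 K]) (rule that; assumption)
  show ?thesis
  proof (rule fin_gen_sum_of_images[OF module_ext_lim[OF K] module_ext_lim[OF G1] module_ext_lim[OF G2]
        fg1 fg2 e1(1) e2(1)])
    fix X assume "X \<in> carrier (ext_lim i K)"
    then obtain n f where f: "is_cocycle R i (Q n) K f" and X: "X = cls i K n f"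
      by (rule ext_lim_cases[OF K])
    note f1 = is_cocycle_post[OF f a1 K G1] and f2 = is_cocycle_post[OF f a2 K G2]
    have "X = cls i K n (\<lambda>x. \<beta>1 (\<alpha>1 (f x)) \<oplus>\<^bsub>K\<^esub> \<beta>2 (\<alpha>2 (f x)))"
      unfolding X by (rule cls_cong, rule sum[OF hom_closed[OF is_cocycleD(1)[OF f]]])
    also have "\<dots> = e1 (cls i G1 n (\<lambda>x. \<alpha>1 (f x))) \<oplus>\<^bsub>ext_lim i K\<^esub> e2 (cls i G2 n (\<lambda>x. \<alpha>2 (f x)))"
      unfolding e1(2)[OF f1] e2(2)[OF f2]
      by (rule cls_add[OF K is_cocycle_post[OF f1 b1 G1 K] is_cocycle_post[OF f2 b2 G2 K], symmetric])
    finally show "\<exists>y\<in>carrier (ext_lim i G1). \<exists>z\<in>carrier (ext_lim i G2). X = e1 y \<oplus>\<^bsub>ext_lim i K\<^esub> e2 z"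
      using cls_closed[OF G1 f1] cls_closed[OF G2 f2] by blast
  qed
qed

lemma fin_gen_ext_lim_free:
  assumes fgR: "fin_gen_module R (ext_lim i (ring_module R))" and "finite B"
  shows "fin_gen_module R (ext_lim i (free_module R B))"
  using assms(2)
proof induction
  case empty
  have z: "x = (\<lambda>b. \<zero>)" if "x \<in> carrier (free_module R {})" for x
    using free_carrierD(3)[OF that] by (intro ext) simp
  show ?case
    by (rule fin_gen_ext_lim_decompose[OF module_free_module module_ring_module module_ring_module
          hom_zero_map[OF module_ring_module] hom_zero_map[OF module_free_module]
          hom_zero_map[OF module_ring_module] hom_zero_map[OF module_free_module] _ fgR fgR])
      (auto dest!: z)
next
  case (insert b B)
  let ?F = "free_module R (insert b B)" and ?G = "free_module R B"
  let ?a = "\<lambda>f c. if c = b then \<zero> else f c"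
  have a: "?a \<in> module_homs R ?F ?G"
  proof (rule module_homsI)
    fix f assume f: "f \<in> carrier ?F"
    have "supp R (?a f) \<subseteq> supp R f" by (auto simp: supp_def)
    then show "?a f \<in> carrier ?G"
      using f finite_subset unfolding free_carrier_iff by auto
  qed auto
  have b: "(\<lambda>f. f) \<in> module_homs R ?G ?F"
    using free_module_mono[of B "insert b B" R] by (intro module_homsI) auto
  have a': "(\<lambda>f. f b) \<in> module_homs R ?F (ring_module R)"
    by (rule module_homsI) (auto dest: free_carrierD(1))
  have b': "(\<lambda>r c. r \<otimes> basis_vec R b c) \<in> module_homs R (ring_module R) ?F"
    using free_smult_closed[OF _ basis_vec_closed[of b "insert b B"]] free_carrierD(1)[OF basis_vec_closed[of b "{b}"]]
    by (intro module_homsI) (auto simp: l_distr m_assoc)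
  show ?case
  proof (rule fin_gen_ext_lim_decompose[OF module_free_module module_free_module module_ring_module
        a b a' b' _ insert.IH fgR])
    fix f assume f: "f \<in> carrier ?F"
    show "f = ?a f \<oplus>\<^bsub>?F\<^esub> (\<lambda>c. f b \<otimes> basis_vec R b c)"
      using free_carrierD(1)[OF f] by (auto simp: basis_vec_def)
  qed
qed

text \<open>The part of the long exact sequence that is used, for \<open>0 \<rightarrow> L \<rightarrow> F \<rightarrow> K \<rightarrow> 0\<close> with kernel
  \<open>L\<close>: the connecting map sends the class of \<open>p \<circ> g\<close> to that of \<open>g \<circ> \<partial>\<close>. A cocycle with values
  in \<open>K\<close> is of the form \<open>p \<circ> g\<close> since the modules of the resolution are free, and if
  \<open>g \<circ> \<partial> = u \<circ> \<partial>\<close> with \<open>u\<close> valued in \<open>L\<close> then \<open>g - u\<close> is a cocycle with values in \<open>F\<close> that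
  lifts \<open>p \<circ> g\<close>.\<close>

lemma fin_gen_ext_lim_cokernel:
  assumes noeth: "noetherian_ring R" and F: "module R F" and K: "module R K"
    and p: "p \<in> module_homs R F K" and surj: "p ` carrier F = carrier K"
    and L: "L = F\<lparr>carrier := {x \<in> carrier F. p x = \<zero>\<^bsub>K\<^esub>}\<rparr>"
    and fgF: "fin_gen_module R (ext_lim i F)" and fgL: "fin_gen_module R (ext_lim (Suc i) L)"
  shows "fin_gen_module R (ext_lim i K)"
proof -
  interpret F: module R F by fact
  interpret K: module R K by fact
  note L_sub = hom_kernel_submodule[OF p F K]
  have mL: "module R L"
    unfolding L by (rule submodule.submodule_is_module[OF L_sub F])
  have L_simps: "carrier L = {x \<in> carrier F. p x = \<zero>\<^bsub>K\<^esub>}" "\<zero>\<^bsub>L\<^esub> = \<zero>\<^bsub>F\<^esub>"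
    "\<And>x y. x \<oplus>\<^bsub>L\<^esub> y = x \<oplus>\<^bsub>F\<^esub> y" "\<And>r x. r \<odot>\<^bsub>L\<^esub> x = r \<odot>\<^bsub>F\<^esub> x"
    by (simp_all add: L)
  define good where "good n g \<longleftrightarrow> g \<in> module_homs R (C n i) F \<and>
    (\<forall>x\<in>carrier (C n (Suc i)). p (g (bdry R x)) = \<zero>\<^bsub>K\<^esub>)" for n g
  have goodD: "g \<in> module_homs R (C n i) F" "\<And>x. x \<in> carrier (C n (Suc i)) \<Longrightarrow> p (g (bdry R x)) = \<zero>\<^bsub>K\<^esub>"
    if "good n g" for n g
    using that by (auto simp: good_def)
  have coK: "is_cocycle R i (Q n) K (\<lambda>x. p (g x))" if g: "good n g" for n g
    unfolding is_cocycle_def using hom_comp[OF goodD(1)[OF g] p] goodD(2)[OF g] by blast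
  have coL: "is_cocycle R (Suc i) (Q n) L (\<lambda>x. g (bdry R x))" if g: "good n g" for n g
    unfolding is_cocycle_def
  proof (intro conjI ballI)
    show "(\<lambda>x. g (bdry R x)) \<in> module_homs R (C n (Suc i)) L"
      unfolding L
      by (rule hom_corestrict[OF hom_comp[OF bdry_hom goodD(1)[OF g]]])
        (simp add: goodD(2)[OF g] hom_closed[OF goodD(1)[OF g]] bdry_closed)
    fix x assume x: "x \<in> carrier (C n (Suc (Suc i)))"
    show "g (bdry R (bdry R x)) = \<zero>\<^bsub>L\<^esub>"
      unfolding bdry_bdry[OF x] L_simps by (rule hom_zero[OF goodD(1)[OF g] module_std_res F])
  qed
  define D where "D = {(cls i K n (\<lambda>x. p (g x)), cls (Suc i) L n (\<lambda>x. g (bdry R x))) |n g. good n g}"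
  have DI: "(X, Y) \<in> D"
    if "good n g" "X = cls i K n (\<lambda>x. p (g x))" "Y = cls (Suc i) L n (\<lambda>x. g (bdry R x))" for X Y n g
    using that by (auto simp: D_def)
  have good_trans: "good k (\<lambda>x. g (std_map R (h n k) i x))"
    "cls i K n (\<lambda>x. p (g x)) = cls i K k (\<lambda>x. p (g (std_map R (h n k) i x)))"
    "cls (Suc i) L n (\<lambda>x. g (bdry R x)) = cls (Suc i) L k (\<lambda>x. g (std_map R (h n k) i (bdry R x)))"
    if g: "good n g" and nk: "n \<le> k" for g n k
  proof -
    note s = std_map_hom[OF module_Q module_Q h_hom[OF nk]]
    note ds = bdry_std_map[OF module_Q module_Q h_hom[OF nk]]
    have "p (g (std_map R (h n k) i (bdry R x))) = \<zero>\<^bsub>K\<^esub>" if x: "x \<in> carrier (C k (Suc i))" for x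
      using goodD(2)[OF g hom_closed[OF s x]] unfolding ds[OF x] .
    then show "good k (\<lambda>x. g (std_map R (h n k) i x))"
      unfolding good_def using hom_comp[OF s goodD(1)[OF g]] by blast
    show "cls i K n (\<lambda>x. p (g x)) = cls i K k (\<lambda>x. p (g (std_map R (h n k) i x)))"
      by (rule cls_transition[OF K nk coK[OF g]])
    show "cls (Suc i) L n (\<lambda>x. g (bdry R x)) = cls (Suc i) L k (\<lambda>x. g (std_map R (h n k) i (bdry R x)))"
      unfolding cls_transition[OF mL nk coL[OF g]] by (rule cls_cong) (simp only: ds)
  qed
  obtain e where e: "e \<in> module_homs R (ext_lim i F) (ext_lim i K)"
    "\<And>n f. is_cocycle R i (Q n) F f \<Longrightarrow> e (cls i F n f) = cls i K n (\<lambda>x. p (f x))"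
    by (rule ext_lim_map[where i = i, OF p F K]) (rule that; assumption)
  show ?thesis
  proof (rule fin_gen_middle[OF noeth module_ext_lim[OF K] module_ext_lim[OF mL] module_ext_lim[OF F]
        fgL fgF e(1), of D])
    show "D \<subseteq> carrier (ext_lim i K) \<times> carrier (ext_lim (Suc i) L)"
      using cls_closed[OF K coK] cls_closed[OF mL coL] by (auto simp: D_def)
  next
    fix X assume "X \<in> carrier (ext_lim i K)"
    then obtain n f where f: "is_cocycle R i (Q n) K f" and X: "X = cls i K n f"
      by (rule ext_lim_cases[OF K])
    obtain g where g: "g \<in> module_homs R (C n i) F" "\<And>x. x \<in> carrier (C n i) \<Longrightarrow> p (g x) = f x"
      using free_lift[OF p surj is_cocycleD(1)[OF f, unfolded std_res_def] F K]
      unfolding std_res_def by blast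
    have "good n g"
      unfolding good_def using g is_cocycleD(2)[OF f] by (simp add: bdry_closed)
    moreover have "X = cls i K n (\<lambda>x. p (g x))"
      unfolding X by (rule cls_cong) (simp add: g(2))
    ultimately show "\<exists>Y. (X, Y) \<in> D" by (auto simp: D_def)
  next
    fix X Y X' Y' assume "(X, Y) \<in> D" "(X', Y') \<in> D"
    then obtain n g n' g' where g0: "good n g" and g0': "good n' g'"
      and XY0: "X = cls i K n (\<lambda>x. p (g x))" "Y = cls (Suc i) L n (\<lambda>x. g (bdry R x))"
      and XY0': "X' = cls i K n' (\<lambda>x. p (g' x))" "Y' = cls (Suc i) L n' (\<lambda>x. g' (bdry R x))"
      unfolding D_def by blast
    let ?k = "max n n'"
    define u where "u = (\<lambda>x. g (std_map R (h n ?k) i x))"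
    define u' where "u' = (\<lambda>x. g' (std_map R (h n' ?k) i x))"
    have u: "good ?k u" "X = cls i K ?k (\<lambda>x. p (u x))" "Y = cls (Suc i) L ?k (\<lambda>x. u (bdry R x))"
      unfolding u_def XY0 by (rule good_trans[OF g0 max.cobounded1])+
    have u': "good ?k u'" "X' = cls i K ?k (\<lambda>x. p (u' x))" "Y' = cls (Suc i) L ?k (\<lambda>x. u' (bdry R x))"
      unfolding u'_def XY0' by (rule good_trans[OF g0' max.cobounded2])+
    note uc = hom_closed[OF goodD(1)[OF u(1)]] hom_closed[OF goodD(1)[OF u'(1)]]
    have pp: "p (u x \<oplus>\<^bsub>F\<^esub> u' x) = p (u x) \<oplus>\<^bsub>K\<^esub> p (u' x)" if "x \<in> carrier (C ?k i)" for x
      by (rule hom_add[OF p uc[OF that]])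
    have good: "good ?k (\<lambda>x. u x \<oplus>\<^bsub>F\<^esub> u' x)"
      unfolding good_def
      using hom_pointwise_add[OF goodD(1)[OF u(1)] goodD(1)[OF u'(1)] module_std_res F]
      by (simp add: pp bdry_closed goodD(2)[OF u(1)] goodD(2)[OF u'(1)])
    moreover have "X \<oplus>\<^bsub>ext_lim i K\<^esub> X' = cls i K ?k (\<lambda>x. p (u x \<oplus>\<^bsub>F\<^esub> u' x))"
      unfolding u(2) u'(2) cls_add[OF K coK[OF u(1)] coK[OF u'(1)]]
      by (rule cls_cong) (simp only: pp)
    moreover have "Y \<oplus>\<^bsub>ext_lim (Suc i) L\<^esub> Y' = cls (Suc i) L ?k (\<lambda>x. u (bdry R x) \<oplus>\<^bsub>F\<^esub> u' (bdry R x))"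
      unfolding u(3) u'(3) cls_add[OF mL coL[OF u(1)] coL[OF u'(1)]] L_simps ..
    ultimately show "(X \<oplus>\<^bsub>ext_lim i K\<^esub> X', Y \<oplus>\<^bsub>ext_lim (Suc i) L\<^esub> Y') \<in> D"
      by (rule DI)
  next
    fix r X Y assume r: "r \<in> carrier R" and "(X, Y) \<in> D"
    then obtain n g where g: "good n g"
      and X: "X = cls i K n (\<lambda>x. p (g x))" and Y: "Y = cls (Suc i) L n (\<lambda>x. g (bdry R x))"
      unfolding D_def by blast
    have pp: "p (r \<odot>\<^bsub>F\<^esub> g x) = r \<odot>\<^bsub>K\<^esub> p (g x)" if "x \<in> carrier (C n i)" for x
      by (rule hom_smult[OF p r hom_closed[OF goodD(1)[OF g] that]])
    have "good n (\<lambda>x. r \<odot>\<^bsub>F\<^esub> g x)"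
      unfolding good_def using hom_pointwise_smult[OF goodD(1)[OF g] r module_std_res F]
      by (simp add: pp bdry_closed goodD(2)[OF g] r)
    moreover have "r \<odot>\<^bsub>ext_lim i K\<^esub> X = cls i K n (\<lambda>x. p (r \<odot>\<^bsub>F\<^esub> g x))"
      unfolding X cls_smult[OF K r coK[OF g]] by (rule cls_cong) (simp only: pp)
    moreover have "r \<odot>\<^bsub>ext_lim (Suc i) L\<^esub> Y = cls (Suc i) L n (\<lambda>x. r \<odot>\<^bsub>F\<^esub> g (bdry R x))"
      unfolding Y cls_smult[OF mL r coL[OF g]] L_simps ..
    ultimately show "(r \<odot>\<^bsub>ext_lim i K\<^esub> X, r \<odot>\<^bsub>ext_lim (Suc i) L\<^esub> Y) \<in> D"
      by (rule DI)
  next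
    fix X assume "(X, \<zero>\<^bsub>ext_lim (Suc i) L\<^esub>) \<in> D"
    then obtain n g where g: "good n g" and X: "X = cls i K n (\<lambda>x. p (g x))"
      and zero: "cls (Suc i) L n (\<lambda>x. g (bdry R x)) = \<zero>\<^bsub>ext_lim (Suc i) L\<^esub>"
      unfolding D_def by auto
    obtain k where k: "n \<le> k"
      and cob: "is_coboundary R (Suc i) (Q k) L (\<lambda>x. g (bdry R (std_map R (h n k) (Suc i) x)))"
      using zero unfolding cls_eq_zero_iff[OF mL coL[OF g]] by blast
    obtain u where u: "u \<in> module_homs R (C k i) L"
      "\<And>x. x \<in> carrier (C k (Suc i)) \<Longrightarrow> g (bdry R (std_map R (h n k) (Suc i) x)) = u (bdry R x)"
      using cob unfolding is_coboundary_def nat.case by blast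
    have uF: "u \<in> module_homs R (C k i) F"
      using u(1) unfolding L by (rule hom_into_submodule) auto
    define v where "v = (\<lambda>x. g (std_map R (h n k) i x))"
    have v: "good k v" "X = cls i K k (\<lambda>x. p (v x))"
      unfolding v_def X by (rule good_trans[OF g k])+
    have vu: "v (bdry R x) = u (bdry R x)" if x: "x \<in> carrier (C k (Suc i))" for x
      unfolding v_def u(2)[OF x, symmetric] bdry_std_map[OF module_Q module_Q h_hom[OF k] x] ..
    define f where "f = (\<lambda>x. v x \<ominus>\<^bsub>F\<^esub> u x)"
    have f: "is_cocycle R i (Q k) F f"
      unfolding is_cocycle_def f_def
      using hom_pointwise_minus[OF goodD(1)[OF v(1)] uF module_std_res F] hom_closed[OF uF]
      by (simp add: bdry_closed vu a_minus_def F.M.r_neg)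
    have "X = cls i K k (\<lambda>x. p (f x))"
      unfolding v(2)
    proof (rule cls_cong)
      fix x assume x: "x \<in> carrier (C k i)"
      have "p (u x) = \<zero>\<^bsub>K\<^esub>"
        using hom_closed[OF u(1) x] by (simp add: L_simps)
      moreover have "p (v x) \<in> carrier K"
        by (rule hom_closed[OF p hom_closed[OF goodD(1)[OF v(1)] x]])
      ultimately show "p (v x) = p (f x)"
        unfolding f_def hom_minus[OF p F K hom_closed[OF goodD(1)[OF v(1)] x] hom_closed[OF uF x]]
        using K.smult_r_null[of "\<ominus> \<one>"] by (simp add: a_minus_def K.a_inv_eq_smult)
    qed
    then have "X = e (cls i F k f)"
      unfolding e(2)[OF f] .
    then show "X \<in> e ` carrier (ext_lim i F)"
      using cls_closed[OF F f] by blast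
  qed
qed

end


section \<open>Projective dimension\<close>

text \<open>\<open>K\<close> is a retract of \<open>K'\<close> in the category of modules modulo the homomorphisms that factor
  through finitely generated free modules. This relation compares the syzygies of a resolution by
  finitely generated free modules with those of a given projective resolution, the modules of
  which may be too large for finiteness statements.\<close>

definition retract_mod_free ::
    "('a, 'r) ring_scheme \<Rightarrow> ('a, 'm, 'k) module_scheme \<Rightarrow> ('a, 'n, 'l) module_scheme \<Rightarrow> bool"
  where "retract_mod_free R K K' \<longleftrightarrow> (\<exists>\<phi>\<in>module_homs R K K'. \<exists>\<psi>\<in>module_homs R K' K. \<exists>l::nat.
    \<exists>\<alpha>\<in>module_homs R K (free_module R {..<l}). \<exists>\<beta>\<in>module_homs R (free_module R {..<l}) K.
    \<forall>x\<in>carrier K. x = \<beta> (\<alpha> x) \<oplus>\<^bsub>K\<^esub> \<psi> (\<phi> x))"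

lemma retract_mod_freeI:
  assumes "\<phi> \<in> module_homs R K K'" "\<psi> \<in> module_homs R K' K"
    and "\<alpha> \<in> module_homs R K (free_module R {..<l::nat})" "\<beta> \<in> module_homs R (free_module R {..<l}) K"
    and "\<And>x. x \<in> carrier K \<Longrightarrow> x = \<beta> (\<alpha> x) \<oplus>\<^bsub>K\<^esub> \<psi> (\<phi> x)"
  shows "retract_mod_free R K K'"
  unfolding retract_mod_free_def
  by (rule bexI[OF _ assms(1)], rule bexI[OF _ assms(2)], rule exI, rule bexI[OF _ assms(3)],
      rule bexI[OF _ assms(4)], rule ballI, rule assms(5))

abbreviation ker_module ::
    "('a, 'm, 'k) module_scheme \<Rightarrow> ('a, 'n, 'l) module_scheme \<Rightarrow> ('m \<Rightarrow> 'n) \<Rightarrow> ('a, 'm, 'k) module_scheme"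
  where "ker_module M N f \<equiv> M\<lparr>carrier := {x \<in> carrier M. f x = \<zero>\<^bsub>N\<^esub>}\<rparr>"

lemma module_ker_module:
  "\<lbrakk>f \<in> module_homs R M N; module R M; module R N\<rbrakk> \<Longrightarrow> module R (ker_module M N f)"
  by (rule submodule.submodule_is_module[OF hom_kernel_submodule])

context cring
begin

lemma retract_mod_free_refl:
  assumes K: "module R K"
  shows "retract_mod_free R K K"
proof -
  interpret K: module R K by fact
  show ?thesis
    by (rule retract_mod_freeI[OF hom_id hom_id hom_zero_map[OF module_free_module, of "{..<0::nat}"]
          hom_zero_map[OF K]]) simp
qed

text \<open>The relation passes to syzygies. Write \<open>id = \<beta> \<circ> \<alpha> + \<psi> \<circ> \<phi>\<close> on \<open>K\<close>, and lift \<open>\<phi>\<close> and \<open>\<psi>\<close> to \<open>f\<close> and \<open>g\<close>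
  between the free module over \<open>K\<close> and the projective module \<open>P\<close> over \<open>K'\<close>, and \<open>\<beta>\<close> to \<open>b\<close>. The map
  \<open>\<theta> = id - g \<circ> f - b \<circ> \<alpha> \<circ> p\<close> on the free module has values in the kernel of \<open>p\<close>. On this kernel
  the last term of \<open>\<theta>\<close> vanishes, which leaves \<open>id = \<theta> + g \<circ> f\<close>; there \<open>\<theta>\<close> factors through the
  free module by the inclusion.\<close>

lemma retract_mod_free_syzygy:
  assumes K: "module R K" and K': "module R K'" and retr: "retract_mod_free R K K'"
    and p: "p \<in> module_homs R (free_module R {..<k::nat}) K"
    and p_surj: "p ` carrier (free_module R {..<k}) = carrier K"
    and P: "projective_module R P" and e: "e \<in> module_homs R P K'" and e_surj: "e ` carrier P = carrier K'"
  shows "retract_mod_free R (ker_module (free_module R {..<k}) K p) (ker_module P K' e)"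
proof -
  let ?F = "free_module R {..<k}"
  let ?L = "ker_module ?F K p" and ?L' = "ker_module P K' e"
  interpret K: module R K by fact
  interpret F: module R ?F by (rule module_free_module)
  have mF: "module R ?F" by (rule module_free_module)
  have mP: "module R P" using P by (simp add: projective_module_def)
  obtain \<phi> \<psi> and l :: nat and \<alpha> \<beta> where \<phi>: "\<phi> \<in> module_homs R K K'" and \<psi>: "\<psi> \<in> module_homs R K' K"
    and \<alpha>: "\<alpha> \<in> module_homs R K (free_module R {..<l})"
    and \<beta>: "\<beta> \<in> module_homs R (free_module R {..<l}) K"
    and sum: "\<And>x. x \<in> carrier K \<Longrightarrow> x = \<beta> (\<alpha> x) \<oplus>\<^bsub>K\<^esub> \<psi> (\<phi> x)"
    using retr unfolding retract_mod_free_def by blast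
  obtain f where f: "f \<in> module_homs R ?F P" "\<And>x. x \<in> carrier ?F \<Longrightarrow> e (f x) = \<phi> (p x)"
    by (rule free_lift[OF e e_surj hom_comp[OF p \<phi>] mP K']) (rule that; assumption)
  obtain g where g: "g \<in> module_homs R P ?F" "\<And>x. x \<in> carrier P \<Longrightarrow> p (g x) = \<psi> (e x)"
    by (rule projective_lift[OF P p p_surj hom_comp[OF e \<psi>] mF K]) (rule that; assumption)
  obtain b where b: "b \<in> module_homs R (free_module R {..<l}) ?F"
    "\<And>x. x \<in> carrier (free_module R {..<l}) \<Longrightarrow> p (b x) = \<beta> x"
    by (rule free_lift[OF p p_surj \<beta> mF K]) (rule that; assumption)
  define \<gamma> where "\<gamma> = (\<lambda>x. b (\<alpha> (p x)))"
  define \<theta> where "\<theta> = (\<lambda>x. (x \<ominus>\<^bsub>?F\<^esub> g (f x)) \<ominus>\<^bsub>?F\<^esub> \<gamma> x)"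
  have \<gamma>: "\<gamma> \<in> module_homs R ?F ?F"
    unfolding \<gamma>_def by (rule hom_comp[OF hom_comp[OF p \<alpha>] b(1)])
  have gf: "(\<lambda>x. g (f x)) \<in> module_homs R ?F ?F"
    by (rule hom_comp[OF f(1) g(1)])
  have dgf: "(\<lambda>x. x \<ominus>\<^bsub>?F\<^esub> g (f x)) \<in> module_homs R ?F ?F"
    by (rule hom_pointwise_minus[OF hom_id gf mF mF])
  have \<theta>F: "\<theta> \<in> module_homs R ?F ?F"
    unfolding \<theta>_def by (rule hom_pointwise_minus[OF dgf \<gamma> mF mF])
  have p\<theta>: "p (\<theta> x) = \<zero>\<^bsub>K\<^esub>" if x: "x \<in> carrier ?F" for x
  proof -
    note px = hom_closed[OF p x]
    have c: "\<beta> (\<alpha> (p x)) \<in> carrier K" "\<psi> (\<phi> (p x)) \<in> carrier K"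
      by (rule hom_closed[OF \<beta> hom_closed[OF \<alpha> px]] hom_closed[OF \<psi> hom_closed[OF \<phi> px]])+
    have "p (\<theta> x) = (p x \<ominus>\<^bsub>K\<^esub> p (g (f x))) \<ominus>\<^bsub>K\<^esub> p (\<gamma> x)"
      unfolding \<theta>_def hom_minus[OF p mF K hom_closed[OF dgf x] hom_closed[OF \<gamma> x]]
        hom_minus[OF p mF K x hom_closed[OF gf x]] ..
    also have "\<dots> = (p x \<ominus>\<^bsub>K\<^esub> \<psi> (\<phi> (p x))) \<ominus>\<^bsub>K\<^esub> \<beta> (\<alpha> (p x))"
      unfolding \<gamma>_def b(2)[OF hom_closed[OF \<alpha> px]] g(2)[OF hom_closed[OF f(1) x]] f(2)[OF x] ..
    also have "p x \<ominus>\<^bsub>K\<^esub> \<psi> (\<phi> (p x)) = \<beta> (\<alpha> (p x))"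
    proof -
      have "p x \<ominus>\<^bsub>K\<^esub> \<psi> (\<phi> (p x)) = (\<beta> (\<alpha> (p x)) \<oplus>\<^bsub>K\<^esub> \<psi> (\<phi> (p x))) \<ominus>\<^bsub>K\<^esub> \<psi> (\<phi> (p x))"
        using sum[OF px] by simp
      also have "\<dots> = \<beta> (\<alpha> (p x))"
        using c by (simp add: a_minus_def K.M.a_assoc K.M.r_neg)
      finally show ?thesis .
    qed
    finally show ?thesis
      using c(1) by (simp add: K.minus_eq_zero_iff)
  qed
  have "f \<in> module_homs R ?L ?L'"
  proof (rule hom_corestrict[OF hom_restrict_submodule[OF f(1)]])
    fix x assume "x \<in> carrier ?L"
    then have x: "x \<in> carrier ?F" "p x = \<zero>\<^bsub>K\<^esub>" by auto
    have "e (f x) = \<zero>\<^bsub>K'\<^esub>"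
      unfolding f(2)[OF x(1)] x(2) by (rule hom_zero[OF \<phi> K K'])
    then show "f x \<in> {x \<in> carrier P. e x = \<zero>\<^bsub>K'\<^esub>}"
      using hom_closed[OF f(1) x(1)] by simp
  qed auto
  moreover have "g \<in> module_homs R ?L' ?L"
  proof (rule hom_corestrict[OF hom_restrict_submodule[OF g(1)]])
    fix x assume "x \<in> carrier ?L'"
    then have x: "x \<in> carrier P" "e x = \<zero>\<^bsub>K'\<^esub>" by auto
    have "p (g x) = \<zero>\<^bsub>K\<^esub>"
      unfolding g(2)[OF x(1)] x(2) by (rule hom_zero[OF \<psi> K' K])
    then show "g x \<in> {x \<in> carrier ?F. p x = \<zero>\<^bsub>K\<^esub>}"
      using hom_closed[OF g(1) x(1)] by simp
  qed auto
  moreover have "(\<lambda>x. x) \<in> module_homs R ?L ?F"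
    by (rule hom_restrict_submodule[OF hom_id]) auto
  moreover have "\<theta> \<in> module_homs R ?F ?L"
    by (rule hom_corestrict[OF \<theta>F]) (simp add: p\<theta> hom_closed[OF \<theta>F])
  moreover have "x = \<theta> x \<oplus>\<^bsub>?L\<^esub> g (f x)" if "x \<in> carrier ?L" for x
  proof -
    have x: "x \<in> carrier ?F" "p x = \<zero>\<^bsub>K\<^esub>" using that by auto
    have "\<gamma> x = \<zero>\<^bsub>?F\<^esub>"
      unfolding \<gamma>_def x(2) hom_zero[OF \<alpha> K module_free_module] by (rule hom_zero[OF b(1) module_free_module mF])
    then have "\<theta> x = x \<ominus>\<^bsub>?F\<^esub> g (f x)"
      using hom_closed[OF dgf x(1)] F.smult_r_null[of "\<ominus> \<one>"] F.a_inv_eq_smult[OF F.M.zero_closed] F.M.r_zero[of "x \<ominus>\<^bsub>?F\<^esub> g (f x)"]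
      unfolding \<theta>_def by (simp add: a_minus_def[of ?F _ "\<zero>\<^bsub>?F\<^esub>"] del: free_module_simps)
    moreover have "g (f x) \<oplus>\<^bsub>?F\<^esub> (x \<ominus>\<^bsub>?F\<^esub> g (f x)) = x"
      by (rule F.add_minus_cancel[OF x(1) hom_closed[OF gf x(1)]])
    ultimately show ?thesis
      using F.M.a_comm[OF hom_closed[OF gf x(1)] hom_closed[OF dgf x(1)]]
      by (simp del: free_module_simps)
  qed
  ultimately show ?thesis
    by (rule retract_mod_freeI[where \<alpha> = "\<lambda>x. x"])
qed

lemma projective_resolutionD:
  assumes "projective_resolution R N n P d e"
  shows "projective_module R (P k)" "k > n \<Longrightarrow> carrier (P k) = {\<zero>\<^bsub>P k\<^esub>}"
    "d k \<in> module_homs R (P (Suc k)) (P k)" "e \<in> module_homs R (P 0) N" "e ` carrier (P 0) = carrier N"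
    "{x \<in> carrier (P 0). e x = \<zero>\<^bsub>N\<^esub>} = d 0 ` carrier (P 1)"
    "{x \<in> carrier (P (Suc k)). d k x = \<zero>\<^bsub>P k\<^esub>} = d (Suc k) ` carrier (P (Suc (Suc k)))"
proof -
  note res = assms[unfolded projective_resolution_def]
  show "projective_module R (P k)" using res[THEN conjunct1] by blast
  note res = res[THEN conjunct2]
  show "k > n \<Longrightarrow> carrier (P k) = {\<zero>\<^bsub>P k\<^esub>}" using res[THEN conjunct1] by blast
  note res = res[THEN conjunct2]
  show "d k \<in> module_homs R (P (Suc k)) (P k)" using res[THEN conjunct1] by blast
  note res = res[THEN conjunct2]
  show "e \<in> module_homs R (P 0) N" by (rule res[THEN conjunct1])
  note res = res[THEN conjunct2]
  show "e ` carrier (P 0) = carrier N" by (rule res[THEN conjunct1])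
  note res = res[THEN conjunct2]
  show "{x \<in> carrier (P 0). e x = \<zero>\<^bsub>N\<^esub>} = d 0 ` carrier (P 1)" by (rule res[THEN conjunct1])
  show "{x \<in> carrier (P (Suc k)). d k x = \<zero>\<^bsub>P k\<^esub>} = d (Suc k) ` carrier (P (Suc (Suc k)))"
    by (rule res[THEN conjunct2, THEN spec])
qed

lemma projective_resolution_syzygy:
  assumes res: "projective_resolution R N (Suc n) P d e"
  shows "projective_resolution R (ker_module (P 0) N e) n (\<lambda>k. P (Suc k)) (\<lambda>k. d (Suc k)) (d 0)"
proof -
  note r = projective_resolutionD[OF res]
  have im: "d 0 ` carrier (P (Suc 0)) = {x \<in> carrier (P 0). e x = \<zero>\<^bsub>N\<^esub>}"
    using r(6) by simp
  have "d 0 \<in> module_homs R (P (Suc 0)) (ker_module (P 0) N e)"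
    by (rule hom_corestrict[OF r(3)]) (use im in blast)
  moreover have "{x \<in> carrier (P (Suc 0)). d 0 x = \<zero>\<^bsub>P 0\<^esub>} = d (Suc 0) ` carrier (P (Suc (Suc 0)))"
    by (rule r(7))
  ultimately show ?thesis
    unfolding projective_resolution_def using r(1,2,3,7) im by simp
qed

text \<open>A module with a resolution of length 0 is isomorphic to \<open>P 0\<close> and inherits its lifting
  property.\<close>

lemma projective_resolution_0_lift:
  assumes N: "module R N" and res: "projective_resolution R N 0 P d e"
    and p: "p \<in> module_homs R A B" and surj: "p ` carrier A = carrier B"
    and g: "g \<in> module_homs R N B" and A: "module R A" and B: "module R B"
  obtains h where "h \<in> module_homs R N A" "\<And>x. x \<in> carrier N \<Longrightarrow> p (h x) = g x"
proof -
  note r = projective_resolutionD[OF res]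
  have mP: "module R (P k)" for k using r(1)[of k] by (simp add: projective_module_def)
  interpret P: module R "P 0" by (rule mP)
  interpret N: module R N by fact
  have "d 0 ` carrier (P 1) = {\<zero>\<^bsub>P 0\<^esub>}"
    using r(2)[of 1] hom_zero[OF r(3)[of 0] mP mP] by simp
  then have ker: "x = \<zero>\<^bsub>P 0\<^esub>" if "x \<in> carrier (P 0)" "e x = \<zero>\<^bsub>N\<^esub>" for x
    using r(6) that by blast
  have inj: "inj_on e (carrier (P 0))"
  proof (rule inj_onI)
    fix x y assume x: "x \<in> carrier (P 0)" and y: "y \<in> carrier (P 0)" and "e x = e y"
    then have "e (x \<ominus>\<^bsub>P 0\<^esub> y) = \<zero>\<^bsub>N\<^esub>"
      using hom_minus[OF r(4) mP N x y] N.minus_eq_zero_iff hom_closed[OF r(4)] by simp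
    then show "x = y"
      using ker[of "x \<ominus>\<^bsub>P 0\<^esub> y"] x y P.minus_eq_zero_iff by simp
  qed
  define e' where "e' = inv_into (carrier (P 0)) e"
  have e'c: "e' y \<in> carrier (P 0)" and ee': "e (e' y) = y" if "y \<in> carrier N" for y
    using that inv_into_into[of y e "carrier (P 0)"] f_inv_into_f[of y e "carrier (P 0)"] r(5)
    by (simp_all add: e'_def)
  have e': "e' \<in> module_homs R N (P 0)"
  proof (rule module_homsI[OF e'c])
    fix x y assume x: "x \<in> carrier N" and y: "y \<in> carrier N"
    show "e' (x \<oplus>\<^bsub>N\<^esub> y) = e' x \<oplus>\<^bsub>P 0\<^esub> e' y"
      by (rule inj_onD[OF inj])
        (simp_all add: e'c ee' x y hom_add[OF r(4)])
  next
    fix s x assume s: "s \<in> carrier R" and x: "x \<in> carrier N"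
    show "e' (s \<odot>\<^bsub>N\<^esub> x) = s \<odot>\<^bsub>P 0\<^esub> e' x"
      by (rule inj_onD[OF inj])
        (simp_all add: e'c ee' s x hom_smult[OF r(4)])
  qed
  obtain h where h: "h \<in> module_homs R (P 0) A" "\<And>x. x \<in> carrier (P 0) \<Longrightarrow> p (h x) = g (e x)"
    by (rule projective_lift[OF r(1) p surj hom_comp[OF r(4) g] A B]) (rule that; assumption)
  show ?thesis
    by (rule that[OF hom_comp[OF e' h(1)]]) (simp add: h(2) e'c ee')
qed

end

context inverse_system
begin

text \<open>Here \<open>\<psi>\<close> lifts through a finite free cover of \<open>K\<close>, so the identity of \<open>K\<close> is a sum of two
  endomorphisms that factor through finite free modules.\<close>

lemma fin_gen_ext_lim_of_proj_dim_0:
  assumes K: "module R K" and fgK: "fin_gen_module R K" and K': "module R K'"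
    and res: "projective_resolution R K' 0 P d e" and retr: "retract_mod_free R K K'"
    and fgR: "fin_gen_module R (ext_lim i (ring_module R))"
  shows "fin_gen_module R (ext_lim i K)"
proof -
  obtain k :: nat and p where p: "p \<in> module_homs R (free_module R {..<k}) K"
    "p ` carrier (free_module R {..<k}) = carrier K"
    by (rule fin_gen_free_cover[OF K fgK])
  obtain \<phi> \<psi> and l :: nat and \<alpha> \<beta> where \<phi>: "\<phi> \<in> module_homs R K K'" and \<psi>: "\<psi> \<in> module_homs R K' K"
    and \<alpha>: "\<alpha> \<in> module_homs R K (free_module R {..<l})"
    and \<beta>: "\<beta> \<in> module_homs R (free_module R {..<l}) K"
    and sum: "\<And>x. x \<in> carrier K \<Longrightarrow> x = \<beta> (\<alpha> x) \<oplus>\<^bsub>K\<^esub> \<psi> (\<phi> x)"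
    using retr unfolding retract_mod_free_def by blast
  obtain g where g: "g \<in> module_homs R K' (free_module R {..<k})"
    "\<And>x. x \<in> carrier K' \<Longrightarrow> p (g x) = \<psi> x"
    by (rule projective_resolution_0_lift[OF K' res p \<psi> module_free_module K]) (rule that; assumption)
  show ?thesis
  proof (rule fin_gen_ext_lim_decompose[OF K module_free_module module_free_module \<alpha> \<beta>
        hom_comp[OF \<phi> g(1)] p(1)])
    show "fin_gen_module R (ext_lim i (free_module R {..<l}))"
      "fin_gen_module R (ext_lim i (free_module R {..<k}))"
      by (rule fin_gen_ext_lim_free[OF fgR finite_lessThan])+
    fix x assume x: "x \<in> carrier K"
    show "x = \<beta> (\<alpha> x) \<oplus>\<^bsub>K\<^esub> p (g (\<phi> x))"
      unfolding g(2)[OF hom_closed[OF \<phi> x]] by (rule sum[OF x])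
  qed
qed

text \<open>One step down both resolutions. The new module \<open>L\<close> is a syzygy in a free module on an initial
  segment of the natural numbers, so its type does not depend on that of \<open>K\<close> and the step can be
  repeated by induction.\<close>

lemma fin_gen_ext_lim_syzygy:
  assumes noeth: "noetherian_ring R" and K: "module R K" and fgK: "fin_gen_module R K"
    and K': "module R K'" and res: "projective_resolution R K' (Suc n) P d e"
    and retr: "retract_mod_free R K K'"
  obtains L :: "('a, nat \<Rightarrow> 'a) module" where "module R L" "fin_gen_module R L"
    "retract_mod_free R L (ker_module (P 0) K' e)"
    "\<And>i. \<lbrakk>fin_gen_module R (ext_lim i (ring_module R)); fin_gen_module R (ext_lim (Suc i) L)\<rbrakk>
      \<Longrightarrow> fin_gen_module R (ext_lim i K)"
proof -
  obtain k :: nat and p where p: "p \<in> module_homs R (free_module R {..<k}) K"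
    "p ` carrier (free_module R {..<k}) = carrier K"
    by (rule fin_gen_free_cover[OF K fgK])
  note r = projective_resolutionD[OF res]
  show ?thesis
  proof (rule that[OF module_ker_module[OF p(1) module_free_module K]
        module.fin_gen_submodule[OF module_free_module noeth fin_gen_free_module[OF finite_lessThan]
          hom_kernel_submodule[OF p(1) module_free_module K]]
        retract_mod_free_syzygy[OF K K' retr p r(1,4,5)]])
    fix i assume fg: "fin_gen_module R (ext_lim i (ring_module R))"
      "fin_gen_module R (ext_lim (Suc i) (ker_module (free_module R {..<k}) K p))"
    show "fin_gen_module R (ext_lim i K)"
      by (rule fin_gen_ext_lim_cokernel[OF noeth module_free_module K p refl
            fin_gen_ext_lim_free[OF fg(1) finite_lessThan] fg(2)])
  qed
qed

lemma fin_gen_ext_lim_of_retract: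
  fixes K :: "('a, nat \<Rightarrow> 'a) module" and K' :: "('a, 'p) module" and P :: "nat \<Rightarrow> ('a, 'p) module"
  assumes noeth: "noetherian_ring R" and fgR: "\<And>j. j < s \<Longrightarrow> fin_gen_module R (ext_lim j (ring_module R))"
  shows "\<lbrakk>module R K; fin_gen_module R K; module R K'; projective_resolution R K' n P d e;
    retract_mod_free R K K'; i + n < s\<rbrakk> \<Longrightarrow> fin_gen_module R (ext_lim i K)"
proof (induction n arbitrary: i K K' P d e)
  case 0
  show ?case
    by (rule fin_gen_ext_lim_of_proj_dim_0[OF 0(1-5)]) (use 0(6) in \<open>simp add: fgR\<close>)
next
  case (Suc n)
  note r = projective_resolutionD[OF Suc.prems(4)]
  have mP: "module R (P 0)" using r(1)[of 0] by (simp add: projective_module_def)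
  obtain L :: "('a, nat \<Rightarrow> 'a) module" where L: "module R L" "fin_gen_module R L"
    "retract_mod_free R L (ker_module (P 0) K' e)"
    "\<And>i. \<lbrakk>fin_gen_module R (ext_lim i (ring_module R)); fin_gen_module R (ext_lim (Suc i) L)\<rbrakk>
      \<Longrightarrow> fin_gen_module R (ext_lim i K)"
    by (rule fin_gen_ext_lim_syzygy[OF noeth Suc.prems(1-5)]) (rule that; assumption)
  have "Suc i + n < s" "i < s" using Suc.prems(6) by simp_all
  then show ?case
    by (intro L(4) fgR Suc.IH[OF L(1,2) module_ker_module[OF r(4) mP Suc.prems(3)]
          projective_resolution_syzygy[OF Suc.prems(4)] L(3)])
qed

text \<open>The elements of \<open>N\<close> have a type of their own, so the first step from \<open>N = K = K'\<close> to the first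
  syzygies is taken before the induction over the remaining length starts.\<close>

lemma fin_gen_ext_lim_of_proj_dim:
  assumes noeth: "noetherian_ring R" and N: "module R N" and fgN: "fin_gen_module R N"
    and res: "projective_resolution R N n P d e"
    and fgR: "\<And>j. j \<le> i + n \<Longrightarrow> fin_gen_module R (ext_lim j (ring_module R))"
  shows "fin_gen_module R (ext_lim i N)"
proof (cases n)
  case 0
  show ?thesis
    by (rule fin_gen_ext_lim_of_proj_dim_0[OF N fgN N res[unfolded 0] retract_mod_free_refl[OF N] fgR]) simp
next
  case (Suc m)
  note res' = res[unfolded Suc]
  note r = projective_resolutionD[OF res']
  have mP: "module R (P 0)" using r(1)[of 0] by (simp add: projective_module_def)
  obtain L :: "('a, nat \<Rightarrow> 'a) module" where L: "module R L" "fin_gen_module R L"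
    "retract_mod_free R L (ker_module (P 0) N e)"
    "\<And>i. \<lbrakk>fin_gen_module R (ext_lim i (ring_module R)); fin_gen_module R (ext_lim (Suc i) L)\<rbrakk>
      \<Longrightarrow> fin_gen_module R (ext_lim i N)"
    by (rule fin_gen_ext_lim_syzygy[OF noeth N fgN N res' retract_mod_free_refl[OF N]])
      (rule that; assumption)
  have fgR': "fin_gen_module R (ext_lim j (ring_module R))" if "j < Suc (i + n)" for j
    using fgR[of j] that by simp
  have "Suc i + m < Suc (i + n)" using Suc by simp
  from fin_gen_ext_lim_of_retract[OF noeth fgR' L(1,2) module_ker_module[OF r(4) mP N]
      projective_resolution_syzygy[OF res'] L(3) this]
  have fgL: "fin_gen_module R (ext_lim (Suc i) L)" .
  show ?thesis
    by (rule L(4)[OF fgR fgL]) simp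
qed

end


section \<open>The adic system and the finiteness dimension\<close>

lemma (in cring) ideal_power:
  assumes "ideal I R"
  shows "ideal (I [^]\<^bsub>ideals_set R\<^esub> (n::nat)) R"
proof (induction n)
  case 0
  then show ?case by (simp add: nat_pow_def ideals_set_def oneideal)
next
  case (Suc n)
  have "I [^]\<^bsub>ideals_set R\<^esub> Suc n = (I [^]\<^bsub>ideals_set R\<^esub> n) \<cdot> I"
    by (simp add: nat_pow_def ideals_set_def)
  then show ?case using ideal_prod_is_ideal[OF Suc assms] by simp
qed

lemma (in cring) ideal_power_antimono:
  fixes n m :: nat
  assumes "ideal I R" "n \<le> m"
  shows "I [^]\<^bsub>ideals_set R\<^esub> m \<subseteq> I [^]\<^bsub>ideals_set R\<^esub> n"
  using assms(2)
proof (induction m rule: dec_induct)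
  case (step m)
  have "I [^]\<^bsub>ideals_set R\<^esub> Suc m = (I [^]\<^bsub>ideals_set R\<^esub> m) \<cdot> I"
    by (simp add: nat_pow_def ideals_set_def)
  then show ?case
    using ideal_prod_inter[OF ideal_power[OF assms(1), of m] assms(1)] step.IH by auto
qed simp

context module
begin

lemma submodule_adic_sub:
  assumes "ideal I R"
  shows "submodule (adic_sub R I M n) R M"
  unfolding adic_sub_def ideal_smult_def
  using ideal.Icarr[OF ideal_power[OF assms, of n]] by (intro span_submodule) auto

lemma adic_sub_antimono:
  assumes "ideal I R" "n \<le> m"
  shows "adic_sub R I M m \<subseteq> adic_sub R I M n"
  unfolding adic_sub_def ideal_smult_def
  using ideal_power_antimono[OF assms] by (intro span_mono) blast

lemma coset_add_submodule:
  assumes H: "submodule H R M" and K: "submodule K R M" and sub: "K \<subseteq> H" and x: "x \<in> carrier M"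
  shows "(K +>\<^bsub>M\<^esub> x) <+>\<^bsub>M\<^esub> H = H +>\<^bsub>M\<^esub> x"
proof -
  note Hc = subsetD[OF submodule_carrier[OF H]]
  have "(K +>\<^bsub>M\<^esub> x) <+>\<^bsub>M\<^esub> H = {(k \<oplus>\<^bsub>M\<^esub> x) \<oplus>\<^bsub>M\<^esub> y |k y. k \<in> K \<and> y \<in> H}"
    by (auto simp: set_add_def' a_r_coset_def')
  also have "\<dots> = {y \<oplus>\<^bsub>M\<^esub> x |y. y \<in> H}"
  proof (intro subset_antisym subsetI)
    fix z assume "z \<in> {(k \<oplus>\<^bsub>M\<^esub> x) \<oplus>\<^bsub>M\<^esub> y |k y. k \<in> K \<and> y \<in> H}"
    then obtain k y where z: "z = (k \<oplus>\<^bsub>M\<^esub> x) \<oplus>\<^bsub>M\<^esub> y" and k: "k \<in> H" and y: "y \<in> H" using sub by blast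
    have "z = (k \<oplus>\<^bsub>M\<^esub> y) \<oplus>\<^bsub>M\<^esub> x"
      unfolding z using Hc[OF k] Hc[OF y] x by (simp add: M.a_ac)
    then show "z \<in> {y \<oplus>\<^bsub>M\<^esub> x |y. y \<in> H}"
      using submodule_add[OF H k y] by blast
  next
    fix z assume "z \<in> {y \<oplus>\<^bsub>M\<^esub> x |y. y \<in> H}"
    then obtain y where z: "z = y \<oplus>\<^bsub>M\<^esub> x" and y: "y \<in> H" by blast
    have "z = (\<zero>\<^bsub>M\<^esub> \<oplus>\<^bsub>M\<^esub> x) \<oplus>\<^bsub>M\<^esub> y"
      unfolding z using Hc[OF y] x by (simp add: M.a_comm)
    then show "z \<in> {(k \<oplus>\<^bsub>M\<^esub> x) \<oplus>\<^bsub>M\<^esub> y |k y. k \<in> K \<and> y \<in> H}"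
      using submodule_zero[OF K] y by blast
  qed
  also have "\<dots> = H +>\<^bsub>M\<^esub> x"
    by (auto simp: a_r_coset_def')
  finally show ?thesis .
qed

lemma inverse_system_adic:
  assumes I: "ideal I R"
  shows "inverse_system R (\<lambda>n. quot_module M (adic_sub R I M n)) (\<lambda>n m X. X <+>\<^bsub>M\<^esub> adic_sub R I M n)"
proof -
  let ?H = "adic_sub R I M"
  note H = submodule_adic_sub[OF I]
  have add: "(?H m +>\<^bsub>M\<^esub> x) <+>\<^bsub>M\<^esub> ?H n = ?H n +>\<^bsub>M\<^esub> x" if "n \<le> m" "x \<in> carrier M" for n m x
    by (rule coset_add_submodule[OF H H adic_sub_antimono[OF I that(1)] that(2)])
  show ?thesis
  proof (rule inverse_system.intro[OF is_cring inverse_system_axioms.intro], goal_cases)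
    case (1 n)
    show ?case by (rule module_quot_module[OF H])
  next
    case (2 n m)
    show ?case
    proof (rule module_homsI)
      fix X assume "X \<in> carrier (quot_module M (?H m))"
      then obtain x where x: "x \<in> carrier M" and X: "X = ?H m +>\<^bsub>M\<^esub> x" by (auto simp: quot_carrier)
      show "X <+>\<^bsub>M\<^esub> ?H n \<in> carrier (quot_module M (?H n))"
        unfolding X add[OF 2 x] quot_carrier by (rule imageI[OF x])
      show "(r \<odot>\<^bsub>quot_module M (?H m)\<^esub> X) <+>\<^bsub>M\<^esub> ?H n = r \<odot>\<^bsub>quot_module M (?H n)\<^esub> (X <+>\<^bsub>M\<^esub> ?H n)"
        if r: "r \<in> carrier R" for r
        unfolding X add[OF 2 x] quot_smult[OF H r x] add[OF 2 smult_closed[OF r x]] ..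
      fix Y assume "Y \<in> carrier (quot_module M (?H m))"
      then obtain y where y: "y \<in> carrier M" and Y: "Y = ?H m +>\<^bsub>M\<^esub> y" by (auto simp: quot_carrier)
      show "(X \<oplus>\<^bsub>quot_module M (?H m)\<^esub> Y) <+>\<^bsub>M\<^esub> ?H n
          = (X <+>\<^bsub>M\<^esub> ?H n) \<oplus>\<^bsub>quot_module M (?H n)\<^esub> (Y <+>\<^bsub>M\<^esub> ?H n)"
        unfolding X Y add[OF 2 x] add[OF 2 y] quot_add[OF H x y] add[OF 2 M.a_closed[OF x y]] ..
    qed
  next
    case (3 X n)
    then show ?case by (auto simp: quot_carrier add)
  next
    case (4 n m k X)
    then show ?case by (auto simp: quot_carrier add)
  qed
qed

end

lemma Inf_enat_mem:
  fixes S :: "enat set"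
  assumes "S \<noteq> {}"
  shows "Inf S \<in> S"
  using assms LeastI_ex[of "\<lambda>x. x \<in> S"] by (auto simp: Inf_enat_def)

lemma proj_dim_attained:
  fixes R :: "('a, 'r) ring_scheme" and N :: "('a, 'n, 'l) module_scheme"
  assumes "proj_dim R N < \<infinity>"
  obtains n P d e where "proj_dim R N = enat n"
    "projective_resolution R N n (P :: nat \<Rightarrow> ('a, ('a, 'n) cell \<Rightarrow> 'a) module) d e"
proof -
  let ?S = "{enat n |n. \<exists>(P :: nat \<Rightarrow> ('a, ('a, 'n) cell \<Rightarrow> 'a) module) d e. projective_resolution R N n P d e}"
  have "?S \<noteq> {}"
    using assms unfolding proj_dim_def Inf_enat_def by (auto split: if_splits)
  then have "Inf ?S \<in> ?S"
    by (rule Inf_enat_mem)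
  then show ?thesis
    using that unfolding proj_dim_def by blast
qed

theorem proposition2p4:
  fixes R :: "('a, 'r) ring_scheme"
    and \<aa> :: "'a set"
    and M :: "('a, 'm, 'k) module_scheme"
    and N :: "('a, 'n, 'l) module_scheme"
  assumes "cring R" and "noetherian_ring R"
    and "ideal \<aa> R"
    and "Module.module R M" and "fin_gen_module R M"
    and "Module.module R N" and "fin_gen_module R N"
    and "proj_dim R N < \<infinity>"
  shows "ereal_of_enat (finiteness_dim R \<aa> M N) \<ge>
    ereal_of_enat (finiteness_dim R \<aa> M (ring_module R)) - ereal_of_enat (proj_dim R N)"
proof -
  interpret S: inverse_system R "\<lambda>n. quot_module M (adic_sub R \<aa> M n)"
    "\<lambda>n m X. X <+>\<^bsub>M\<^esub> adic_sub R \<aa> M n"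
    by (rule module.inverse_system_adic[OF assms(4,3)])
  obtain n and P :: "nat \<Rightarrow> ('a, ('a, 'n) cell \<Rightarrow> 'a) module" and d e
    where n: "proj_dim R N = enat n" and res: "projective_resolution R N n P d e"
    by (rule proj_dim_attained[OF assms(8)])
  have lcN: "gen_local_cohomology R \<aa> i M N = S.ext_lim i N" for i
    by (simp add: gen_local_cohomology_def S.ext_lim_def)
  have bound: "finiteness_dim R \<aa> M (ring_module R) \<le> enat i + enat n"
    if i: "\<not> fin_gen_module R (gen_local_cohomology R \<aa> i M N)" for i
  proof -
    obtain j where j: "j \<le> i + n" "\<not> fin_gen_module R (S.ext_lim j (ring_module R))"
      using S.fin_gen_ext_lim_of_proj_dim[OF assms(2,6,7) res, of i] i unfolding lcN by blast
    then have "finiteness_dim R \<aa> M (ring_module R) \<le> enat j"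
      unfolding finiteness_dim_def gen_local_cohomology_def S.ext_lim_def by (intro Inf_lower) blast
    also have "\<dots> \<le> enat i + enat n" using j(1) by simp
    finally show ?thesis .
  qed
  let ?S = "{enat i |i. \<not> fin_gen_module R (gen_local_cohomology R \<aa> i M N)}"
  have le: "finiteness_dim R \<aa> M (ring_module R) \<le> finiteness_dim R \<aa> M N + enat n"
  proof (cases "?S = {}")
    case True
    then show ?thesis by (simp add: finiteness_dim_def Inf_enat_def)
  next
    case False
    then have "Inf ?S \<in> ?S"
      by (rule Inf_enat_mem)
    then show ?thesis
      using bound unfolding finiteness_dim_def[of R \<aa> M N] by auto
  qed
  then have "ereal_of_enat (finiteness_dim R \<aa> M (ring_module R))
      \<le> ereal_of_enat (finiteness_dim R \<aa> M N) + ereal_of_enat (enat n)"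
    by (simp only: ereal_of_enat_add[symmetric] ereal_of_enat_le_iff)
  then show ?thesis
    unfolding n by (simp add: ereal_minus_le_iff)
qed

end
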